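(* Fix an integer $k\ge 2$. There is an algorithm which, given $n$, after a preprocessing phase using $O(n^{k+1})$ time and $O(n^{k})$ space, generates a random $k$-noncrossing RNA structure on $[n]=\{1,\dots,n\}$ such that every $k$-noncrossing RNA structure on $[n]$ is output with the same probability $1/S_k(n)$; each such random structure is generated with $O(n)$ time and space complexity.
   Context: A partial matching on $[n]$ is a graph on vertex set $[n]$ in which every vertex has degree at most one; an arc is written $(i,j)$ with $i<j$. A $k$-crossing is a set of $k$ arcs $(i_1,j_1),\dots,(i_k,j_k)$ with $i_1<\dots<i_k<j_1<\dots<j_k$; a partial matching is $k$-noncrossing if it contains no $k$-crossing. A $k$-noncrossing RNA structure on $[n]$ is a $k$-noncrossing partial matching on $[n]$ containing no arc of the form $(i,i+1)$, $1\le i\le n-1$. $S_k(n)$ denotes the number of $k$-noncrossing RNA structures on $[n]$. *)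

theory Defs
  imports "HOL-Probability.SPMF" "HOL-Library.Landau_Symbols"
begin

subsection \<open>Structures\<close>

text \<open>A graph on \<open>{1..n}\<close> is represented by its set of arcs \<open>(i, j)\<close> with \<open>i < j\<close>.\<close>

type_synonym arcs = "(nat \<times> nat) set"

definition arc_degree :: "arcs \<Rightarrow> nat \<Rightarrow> nat" where
  "arc_degree M v = card {e \<in> M. v = fst e \<or> v = snd e}"

definition partial_matching :: "nat \<Rightarrow> arcs \<Rightarrow> bool" where
  "partial_matching n M \<longleftrightarrow>
     M \<subseteq> {(i, j). 1 \<le> i \<and> i < j \<and> j \<le> n} \<and> (\<forall>v\<in>{1..n}. arc_degree M v \<le> 1)"

definition is_crossing :: "nat \<Rightarrow> arcs \<Rightarrow> bool" where
  "is_crossing k A \<longleftrightarrow>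
     (\<exists>i j :: nat \<Rightarrow> nat. A = (\<lambda>t. (i t, j t)) ` {1..k} \<and>
        (\<forall>t\<in>{1..<k}. i t < i (t + 1)) \<and> i k < j 1 \<and> (\<forall>t\<in>{1..<k}. j t < j (t + 1)))"

definition noncrossing :: "nat \<Rightarrow> arcs \<Rightarrow> bool" where
  "noncrossing k M \<longleftrightarrow> \<not> (\<exists>A\<subseteq>M. is_crossing k A)"

definition rna_structures :: "nat \<Rightarrow> nat \<Rightarrow> arcs set" where
  "rna_structures k n =
     {M. partial_matching n M \<and> noncrossing k M \<and> (\<forall>i. 1 \<le> i \<and> i + 1 \<le> n \<longrightarrow> (i, i + 1) \<notin> M)}"

definition num_rna_structures :: "nat \<Rightarrow> nat \<Rightarrow> nat" where
  "num_rna_structures k n = card (rna_structures k n)"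


subsection \<open>Randomised random access machines\<close>

text \<open>
  The machine has registers, a random access memory and a write-only output of pairs, and is
  charged by the uniform cost criterion: every instruction and every test takes one unit of time,
  and every memory cell is one unit of space. A program mentions only finitely many registers, so
  these contribute a constant to the space. \<open>Random r x\<close> draws uniformly from \<open>{0..<x}\<close>; with fair
  coins alone, no program with a bounded running time could produce probabilities that are not
  dyadic.
\<close>

datatype operand = Imm nat | Reg nat

datatype arith = Add | Sub | Mul | Div | And

datatype test = Less operand operand | Equal operand operand

datatype com =
    Skip
  | Move nat operand
  | Arith arith nat operand operand
  | Load nat operand
  | Store operand operand
  | Random nat operand
  | Print operand operand
  | Seq com com
  | If test com com
  | While test com

record state =
  reg :: "nat \<Rightarrow> nat"
  mem :: "nat \<Rightarrow> nat"
  printed :: "(nat \<times> nat) list"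
  time :: nat

fun val :: "state \<Rightarrow> operand \<Rightarrow> nat" where
  "val s (Imm c) = c"
| "val s (Reg r) = reg s r"

text \<open>On natural numbers subtraction is truncated at \<open>0\<close>, and \<open>x div 0 = 0\<close>.\<close>

fun eval_arith :: "arith \<Rightarrow> nat \<Rightarrow> nat \<Rightarrow> nat" where
  "eval_arith Add x y = x + y"
| "eval_arith Sub x y = x - y"
| "eval_arith Mul x y = x * y"
| "eval_arith Div x y = x div y"
| "eval_arith And x y = Bit_Operations.and x y"

fun holds :: "state \<Rightarrow> test \<Rightarrow> bool" where
  "holds s (Less x y) \<longleftrightarrow> val s x < val s y"
| "holds s (Equal x y) \<longleftrightarrow> val s x = val s y"

definition tick :: "state \<Rightarrow> state" where
  "tick s = s\<lparr>time := time s + 1\<rparr>"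

text \<open>
  The machine is parameterised by the word length \<open>w\<close> and by addresses \<open>a \<le> b\<close>: the cells below \<open>a\<close>
  are read-only, those from \<open>a\<close> up to but excluding \<open>b\<close> can be read and written, and there are no
  further cells. An overflow, an access to a forbidden cell and \<open>Random r x\<close> with \<open>x = 0\<close> abort the
  computation; like nontermination, this shows up as missing probability mass. Hence a computation
  whose result is lossless has respected the word length and the bounds on the memory.
\<close>

definition set_reg :: "nat \<Rightarrow> nat \<Rightarrow> nat \<Rightarrow> state \<Rightarrow> state spmf" where
  "set_reg w r v s =
     (if v < 2 ^ w then return_spmf (tick (s\<lparr>reg := (reg s)(r := v)\<rparr>)) else return_pmf None)"

definition set_mem :: "nat \<Rightarrow> nat \<Rightarrow> nat \<Rightarrow> nat \<Rightarrow> nat \<Rightarrow> state \<Rightarrow> state spmf" where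
  "set_mem w a b i v s =
     (if a \<le> i \<and> i < b \<and> v < 2 ^ w then return_spmf (tick (s\<lparr>mem := (mem s)(i := v)\<rparr>))
      else return_pmf None)"

partial_function (spmf) loop :: "(state \<Rightarrow> bool) \<Rightarrow> (state \<Rightarrow> state spmf) \<Rightarrow> state \<Rightarrow> state spmf" where
  "loop P f s =
     (if P s then bind_spmf (f (tick s)) (loop P f) else return_spmf (tick s))"

primrec exec :: "nat \<Rightarrow> nat \<Rightarrow> nat \<Rightarrow> com \<Rightarrow> state \<Rightarrow> state spmf" where
  "exec w a b Skip = (\<lambda>s. return_spmf (tick s))"
| "exec w a b (Move r x) = (\<lambda>s. set_reg w r (val s x) s)"
| "exec w a b (Arith f r x y) = (\<lambda>s. set_reg w r (eval_arith f (val s x) (val s y)) s)"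
| "exec w a b (Load r x) =
     (\<lambda>s. if val s x < b then set_reg w r (mem s (val s x)) s else return_pmf None)"
| "exec w a b (Store x y) = (\<lambda>s. set_mem w a b (val s x) (val s y) s)"
| "exec w a b (Random r x) =
     (\<lambda>s. bind_spmf (spmf_of_set {0..<val s x}) (\<lambda>v. set_reg w r v s))"
| "exec w a b (Print x y) =
     (\<lambda>s. return_spmf (tick (s\<lparr>printed := printed s @ [(val s x, val s y)]\<rparr>)))"
| "exec w a b (Seq c d) = (\<lambda>s. bind_spmf (exec w a b c s) (exec w a b d))"
| "exec w a b (If t c d) =
     (\<lambda>s. if holds s t then exec w a b c (tick s) else exec w a b d (tick s))"
| "exec w a b (While t c) = loop (\<lambda>s. holds s t) (exec w a b c)"

definition initial_state :: "nat \<Rightarrow> state" where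
  "initial_state n = \<lparr>reg = (\<lambda>r. if r = 0 then n else 0), mem = (\<lambda>_. 0), printed = [], time = 0\<rparr>"

text \<open>
  Surely halts within \<open>t\<close> steps: if some infinite or longer computation existed, then, since a prefix
  of length \<open>t\<close> has positive probability, so would, by losslessness, a halting computation with more
  than \<open>t\<close> steps.
\<close>

definition halts_within :: "nat \<Rightarrow> state spmf \<Rightarrow> bool" where
  "halts_within t p \<longleftrightarrow> lossless_spmf p \<and> (\<forall>s\<in>set_spmf p. time s \<le> t)"

text \<open>
  The states in which a generation may start once the preprocessing has left the table \<open>m\<close> in the
  first \<open>a\<close> cells. Everything but the table is arbitrary, so the generator can be run any number of
  times, each time on what the previous run has left in the registers and the work space.
\<close>

definition ready :: "nat \<Rightarrow> (nat \<Rightarrow> nat) \<Rightarrow> state set" where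
  "ready a m = {s. (\<forall>i<a. mem s i = m i) \<and> printed s = [] \<and> time s = 0}"

definition output_arcs :: "state spmf \<Rightarrow> arcs spmf" where
  "output_arcs p = map_spmf (\<lambda>s. set (printed s)) p"

end

theory Submission
  imports Defs
begin

text \<open>
  Row insertion, read from right to left, turns a partial matching into a closed walk of shapes: a
  closing vertex inserts its partner, an opening vertex deletes itself, being the largest entry. A
  crossing of \<open>K\<close> arcs is a decreasing chain of \<open>K\<close> insertions into the first row, and a chain of
  length \<open>K + 1\<close> in one row amounts to a chain of length \<open>K\<close> in the next, so \<open>k\<close>-noncrossing means
  at most \<open>k - 1\<close> rows. Arcs \<open>(i, i + 1)\<close> correspond to an addition to the first row that is undone
  at once. The numbers of such walks from every shape and time satisfy a linear recurrence with
  \<open>O(n\<^sup>k)\<close> entries of \<open>O(n)\<close> bits.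

  The generator draws one number below the total count and unranks it to a walk with \<open>O(k)\<close> table
  lookups per step. Going from left to right, deletion from a shape replaces in each row the
  predecessor of the element coming from below. To do this in constant time, a row is kept as a bit
  mask in one word, with bit \<open>4\<^bsup>n - v\<^esup>\<close> for the entry \<open>v\<close>; vertices are recovered from bits by a table of
  discrete logarithms modulo a power \<open>q\<close> of \<open>3\<close>, where \<open>4\<close> has order \<open>q / 3\<close>.
\<close>

subsection \<open>Row insertion and its inverse\<close>

type_synonym tableau = "nat \<Rightarrow> nat set"

definition next_above :: "nat set \<Rightarrow> nat \<Rightarrow> nat option" where
  "next_above R y = (if \<exists>z\<in>R. y < z then Some (LEAST z. z \<in> R \<and> y < z) else None)"

lemma next_above_SomeD:
  assumes "next_above R y = Some z"
  shows "z \<in> R" "y < z" "\<And>u. u \<in> R \<Longrightarrow> y < u \<Longrightarrow> z \<le> u"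
proof -
  have ex: "\<exists>z. z \<in> R \<and> y < z" and z: "z = (LEAST z. z \<in> R \<and> y < z)"
    using assms by (auto simp: next_above_def split: if_splits)
  show "z \<in> R" "y < z" using LeastI_ex[OF ex] z by auto
  show "\<And>u. u \<in> R \<Longrightarrow> y < u \<Longrightarrow> z \<le> u" using z by (auto intro: Least_le)
qed

lemma next_above_NoneD: "next_above R y = None \<Longrightarrow> u \<in> R \<Longrightarrow> u \<le> y"
  by (auto simp: next_above_def not_less split: if_splits)

lemma next_above_eq_Some:
  assumes "z \<in> R" "y < z" "\<And>u. u \<in> R \<Longrightarrow> y < u \<Longrightarrow> z \<le> u"
  shows "next_above R y = Some z"
  using assms by (auto simp: next_above_def intro!: Least_equality)

lemma next_above_eq_None: "(\<And>u. u \<in> R \<Longrightarrow> u \<le> y) \<Longrightarrow> next_above R y = None"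
  by (fastforce simp: next_above_def)

primrec bump :: "tableau \<Rightarrow> nat \<Rightarrow> nat \<Rightarrow> nat option" where
  "bump T x 0 = Some x"
| "bump T x (Suc r) = Option.bind (bump T x r) (next_above (T r))"

definition row_insert :: "tableau \<Rightarrow> nat \<Rightarrow> tableau" where
  "row_insert T x = (\<lambda>r. (T r - set_option (bump T x (Suc r))) \<union> set_option (bump T x r))"

definition entries :: "tableau \<Rightarrow> nat set" where
  "entries T = (\<Union>r. T r)"

definition is_tableau :: "tableau \<Rightarrow> bool" where
  "is_tableau T \<longleftrightarrow> finite (entries T) \<and> (\<forall>r s. r \<noteq> s \<longrightarrow> T r \<inter> T s = {}) \<and>
     (\<forall>r v. card {z \<in> T (Suc r). z \<le> v} \<le> card {z \<in> T r. z \<le> v})"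

definition shape :: "tableau \<Rightarrow> nat \<Rightarrow> nat" where
  "shape T r = card (T r)"

lemma in_entries: "z \<in> T r \<Longrightarrow> z \<in> entries T"
  by (auto simp: entries_def)

lemma tableau_finite_row: "is_tableau T \<Longrightarrow> finite (T r)"
  unfolding is_tableau_def entries_def by (rule finite_subset[of _ "\<Union>(range T)"]) auto

lemma tableau_disjoint: "is_tableau T \<Longrightarrow> z \<in> T r \<Longrightarrow> z \<in> T s \<Longrightarrow> r = s"
  by (auto simp: is_tableau_def)

lemma tableau_count: "is_tableau T \<Longrightarrow> card {z \<in> T (Suc r). z \<le> v} \<le> card {z \<in> T r. z \<le> v}"
  by (auto simp: is_tableau_def)

lemma is_tableau_empty: "is_tableau (\<lambda>_. {})"
  by (auto simp: is_tableau_def entries_def)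

lemma count_eq_shape:
  assumes "is_tableau T" "\<And>z. z \<in> entries T \<Longrightarrow> z \<le> v"
  shows "card {z \<in> T r. z \<le> v} = shape T r"
proof -
  have "{z \<in> T r. z \<le> v} = T r" using assms(2) by (auto simp: entries_def)
  thus ?thesis by (simp add: shape_def)
qed

lemma shape_antimono:
  assumes "is_tableau T" shows "shape T (Suc r) \<le> shape T r"
proof -
  have "finite (entries T)" using assms by (simp add: is_tableau_def)
  then obtain v where v: "\<And>z. z \<in> entries T \<Longrightarrow> z \<le> v" by (meson finite_nat_set_iff_bounded_le)
  show ?thesis
    using tableau_count[OF assms, of r v] by (simp add: count_eq_shape[OF assms v])
qed

lemma bump_mono_None: "bump T x r = None \<Longrightarrow> r \<le> s \<Longrightarrow> bump T x s = None"
  by (induction s) (auto simp: le_Suc_eq)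

lemma bump_SucD:
  assumes "bump T x (Suc r) = Some y"
  obtains z where "bump T x r = Some z" "next_above (T r) z = Some y"
  using assms by (auto simp: bind_eq_Some_conv)

lemma bump_Suc_in: "bump T x (Suc r) = Some y \<Longrightarrow> y \<in> T r"
  by (erule bump_SucD) (rule next_above_SomeD)

lemma bump_less:
  "r < s \<Longrightarrow> bump T x s = Some z \<Longrightarrow> \<exists>y. bump T x r = Some y \<and> y < z"
proof (induction s arbitrary: z)
  case (Suc s)
  obtain y where y: "bump T x s = Some y" "next_above (T s) y = Some z"
    using Suc.prems(2) by (rule bump_SucD)
  have yz: "y < z" using next_above_SomeD(2)[OF y(2)] .
  show ?case
  proof (cases "r = s")
    case True thus ?thesis using y yz by auto
  next
    case False
    thus ?thesis using Suc.IH[OF _ y(1)] Suc.prems yz by fastforce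
  qed
qed simp

lemma bump_ge: "bump T x r = Some y \<Longrightarrow> r \<le> y"
proof (induction r arbitrary: y)
  case (Suc r)
  then obtain z where "bump T x r = Some z" "z < y" using bump_less[of r "Suc r"] by blast
  thus ?case using Suc.IH by fastforce
qed simp

lemma bump_notin:
  assumes "is_tableau T" "x \<notin> entries T" "bump T x r = Some y"
  shows "y \<notin> T r"
proof (cases r)
  case 0 thus ?thesis using assms by (auto simp: entries_def)
next
  case (Suc s)
  have "y \<in> T s" using bump_Suc_in assms(3) Suc by blast
  thus ?thesis using tableau_disjoint[OF assms(1)] Suc by (metis n_not_Suc_n)
qed

lemma bump_lands:
  assumes "is_tableau T" "x \<notin> entries T"
  obtains r y where "bump T x r = Some y" "bump T x (Suc r) = None"
proof -
  have "finite (entries T)" using assms by (simp add: is_tableau_def)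
  then obtain v where v: "\<And>z. z \<in> entries T \<Longrightarrow> z \<le> v" by (meson finite_nat_set_iff_bounded_le)
  have "bump T x (Suc (Suc v)) = None"
  proof (rule ccontr)
    assume "bump T x (Suc (Suc v)) \<noteq> None"
    then obtain z where z: "bump T x (Suc (Suc v)) = Some z" by blast
    have "z \<le> v" using bump_Suc_in[OF z] v by (auto simp: entries_def)
    thus False using bump_ge[OF z] by simp
  qed
  then obtain s where s: "bump T x s = None" "\<And>s'. s' < s \<Longrightarrow> bump T x s' \<noteq> None"
    using exists_least_iff[of "\<lambda>s. bump T x s = None"] by blast
  then obtain r where "s = Suc r" by (cases s) auto
  moreover from this obtain y where "bump T x r = Some y" using s(2)[of r] by auto
  ultimately show ?thesis using s(1) that by blast
qed

lemma entries_row_insert: "entries (row_insert T x) = insert x (entries T)"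
proof -
  have 1: "z \<in> entries (row_insert T x)" if "z \<in> T r" for z r
  proof (cases "bump T x (Suc r) = Some z")
    case True
    hence "z \<in> row_insert T x (Suc r)" by (simp add: row_insert_def del: bump.simps)
    thus ?thesis by (rule in_entries)
  next
    case False
    hence "z \<in> row_insert T x r" using that by (auto simp: row_insert_def simp del: bump.simps)
    thus ?thesis by (rule in_entries)
  qed
  have 2: "x \<in> entries (row_insert T x)" by (rule in_entries[of _ _ 0]) (simp add: row_insert_def)
  have 3: "z = x \<or> z \<in> entries T" if "z \<in> row_insert T x r" for z r
  proof (cases "z \<in> T r")
    case True thus ?thesis by (auto intro: in_entries)
  next
    case False
    hence b: "bump T x r = Some z" using that by (auto simp: row_insert_def simp del: bump.simps)
    show ?thesis
    proof (cases r)
      case 0 thus ?thesis using b by simp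
    next
      case (Suc s) thus ?thesis using bump_Suc_in[of T x s z] b by (auto intro: in_entries)
    qed
  qed
  show ?thesis
  proof
    show "entries (row_insert T x) \<subseteq> insert x (entries T)"
      using 3 unfolding entries_def[of "row_insert T x"] by blast
    show "insert x (entries T) \<subseteq> entries (row_insert T x)"
      using 1 2 unfolding entries_def[of T] by blast
  qed
qed

lemma count_row_insert:
  assumes T: "is_tableau T" "x \<notin> entries T"
  shows "card {z \<in> row_insert T x r. z \<le> v} = card {z \<in> T r. z \<le> v} +
     (if (\<exists>b. bump T x r = Some b \<and> b \<le> v) \<and> \<not> (\<exists>b. bump T x (Suc r) = Some b \<and> b \<le> v) then 1 else 0)"
proof (cases "bump T x r")
  case None
  hence "bump T x (Suc r) = None" by simp
  thus ?thesis using None by (simp add: row_insert_def)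
next
  case (Some b)
  have nb: "b \<notin> T r" using bump_notin[OF T Some] .
  have fin: "finite (T r)" using tableau_finite_row[OF T(1)] .
  show ?thesis
  proof (cases "bump T x (Suc r)")
    case None
    have "{z \<in> row_insert T x r. z \<le> v} = {z \<in> T r. z \<le> v} \<union> (if b \<le> v then {b} else {})"
      using None Some by (auto simp: row_insert_def simp del: bump.simps)
    thus ?thesis using Some None nb fin by (auto simp del: bump.simps)
  next
    case (Some b')
    have b': "b' \<in> T r" "b < b'"
      using bump_Suc_in[OF Some] bump_less[of r "Suc r", OF _ Some] \<open>bump T x r = Some b\<close> by auto
    have eq: "{z \<in> row_insert T x r. z \<le> v} =
        ({z \<in> T r. z \<le> v} - {b'}) \<union> (if b \<le> v then {b} else {})"
      using Some \<open>bump T x r = Some b\<close> by (auto simp: row_insert_def simp del: bump.simps)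
    have c: "card ({z \<in> T r. z \<le> v} - {b'}) = card {z \<in> T r. z \<le> v} - (if b' \<le> v then 1 else 0)"
      using b' by auto
    have pos: "card {z \<in> T r. z \<le> v} > 0" if "b' \<le> v"
      using that b' fin by (auto simp: card_gt_0_iff)
    show ?thesis unfolding eq
      using Some \<open>bump T x r = Some b\<close> nb fin b' pos c
      by (auto simp del: bump.simps)
  qed
qed

lemma card_le_strict_mono:
  fixes y v w :: nat
  assumes "finite A" "y \<in> A" "v < y" "y \<le> w"
  shows "card {z \<in> A. z \<le> v} < card {z \<in> A. z \<le> w}"
proof (rule psubset_card_mono)
  have "y \<in> {z \<in> A. z \<le> w} - {z \<in> A. z \<le> v}" using assms by auto
  moreover have "{z \<in> A. z \<le> v} \<subseteq> {z \<in> A. z \<le> w}" using assms by auto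
  ultimately show "{z \<in> A. z \<le> v} \<subset> {z \<in> A. z \<le> w}" by blast
qed (use assms in auto)

lemma is_tableau_row_insert:
  assumes T: "is_tableau T" "x \<notin> entries T"
  shows "is_tableau (row_insert T x)"
  unfolding is_tableau_def
proof (intro conjI allI impI)
  show "finite (entries (row_insert T x))"
    using T by (simp add: entries_row_insert is_tableau_def)
next
  have key: False if rs: "r < s" "z \<in> row_insert T x r" "z \<in> row_insert T x s" for r s z
  proof -
    consider "z \<in> T r" "bump T x (Suc r) \<noteq> Some z" | "bump T x r = Some z"
      using rs(2) by (auto simp: row_insert_def simp del: bump.simps)
    thus False
    proof cases
      case 1
      hence "z \<notin> T s" using tableau_disjoint[OF T(1)] rs(1) by blast
      hence b: "bump T x s = Some z" using rs(3) by (auto simp: row_insert_def simp del: bump.simps)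
      obtain s' where s': "s = Suc s'" using rs(1) by (cases s) auto
      hence "z \<in> T s'" using bump_Suc_in b by blast
      hence "s' = r" using tableau_disjoint[OF T(1)] 1 by blast
      thus False using 1 b s' by simp
    next
      case 2
      show False
      proof (cases "bump T x s = Some z")
        case True thus False using bump_less[OF rs(1) True] 2 by auto
      next
        case False
        hence zs: "z \<in> T s" using rs(3) by (auto simp: row_insert_def simp del: bump.simps)
        show False
        proof (cases r)
          case 0 thus False using 2 zs T(2) by (auto intro: in_entries)
        next
          case (Suc r')
          hence "z \<in> T r'" using bump_Suc_in 2 by blast
          thus False using tableau_disjoint[OF T(1) _ zs] rs(1) Suc by fastforce
        qed
      qed
    qed
  qed
  show "row_insert T x r \<inter> row_insert T x s = {}" if "r \<noteq> s" for r s
    using key[of r s] key[of s r] that by (meson disjoint_iff linorder_neqE_nat)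
next
  fix r v
  let ?c = "\<lambda>r v. card {z \<in> T r. z \<le> v}"
  have base: "?c (Suc r) v \<le> ?c r v" using tableau_count[OF T(1)] .
  show "card {z \<in> row_insert T x (Suc r). z \<le> v} \<le> card {z \<in> row_insert T x r. z \<le> v}"
  proof (cases "(\<exists>b. bump T x (Suc r) = Some b \<and> b \<le> v) \<and> \<not> (\<exists>b. bump T x (Suc (Suc r)) = Some b \<and> b \<le> v)")
    case False
    show ?thesis using base unfolding count_row_insert[OF T] if_not_P[OF False] by (simp del: bump.simps)
  next
    case True
    then obtain b where b: "bump T x (Suc r) = Some b" "b \<le> v" by blast
    have br: "b \<in> T r" using bump_Suc_in[OF b(1)] .
    have bs: "b \<notin> T (Suc r)" using bump_notin[OF T b(1)] .
    have gap: "\<not> (b < z \<and> z \<le> v)" if zT: "z \<in> T (Suc r)" for z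
    proof
      assume z: "b < z \<and> z \<le> v"
      then obtain b' where b': "next_above (T (Suc r)) b = Some b'"
        using zT by (cases "next_above (T (Suc r)) b") (auto dest: next_above_NoneD)
      hence "b' \<le> z" using next_above_SomeD(3) zT z by blast
      moreover have "bump T x (Suc (Suc r)) = Some b'" using b b' by simp
      ultimately show False using True z by (auto simp del: bump.simps)
    qed
    have "{z \<in> T (Suc r). z \<le> v} = {z \<in> T (Suc r). z \<le> b - 1}"
    proof (intro Collect_cong conj_cong refl)
      fix z assume "z \<in> T (Suc r)"
      hence "\<not> (b < z \<and> z \<le> v)" "z \<noteq> b" using gap bs by blast+
      thus "z \<le> v \<longleftrightarrow> z \<le> b - 1" using b(2) by linarith
    qed
    hence "?c (Suc r) v = ?c (Suc r) (b - 1)" by simp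
    also have "\<dots> \<le> ?c r (b - 1)" using tableau_count[OF T(1)] .
    also have "\<dots> < ?c r v"
    proof (rule card_le_strict_mono[OF tableau_finite_row[OF T(1)] br _ b(2)])
      show "b - 1 < b" using bump_less[of r "Suc r", OF _ b(1)] by auto
    qed
    finally show ?thesis unfolding count_row_insert[OF T] if_P[OF True] by (simp del: bump.simps)
  qed
qed

lemma row_insert_landing:
  assumes T: "is_tableau T" "x \<notin> entries T"
    and land: "bump T x \<rho> = Some y" "bump T x (Suc \<rho>) = None"
  shows "shape (row_insert T x) = (shape T)(\<rho> := shape T \<rho> + 1)"
proof
  fix r
  have "finite (entries T)" using T by (simp add: is_tableau_def)
  then obtain v where v: "\<And>z. z \<in> insert x (entries T) \<Longrightarrow> z \<le> v"
    by (meson finite_insert finite_nat_set_iff_bounded_le)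
  have le: "b \<le> v" if "bump T x s = Some b" for s b
  proof (cases s)
    case 0 thus ?thesis using that v by auto
  next
    case (Suc s') thus ?thesis using bump_Suc_in[of T x s' b] that v by (auto intro: in_entries)
  qed
  have some: "bump T x s \<noteq> None \<longleftrightarrow> s \<le> \<rho>" for s
    using bump_mono_None[of T x s \<rho>] bump_mono_None[OF land(2), of s] land(1) by (cases "s \<le> \<rho>") auto
  have s1: "shape (row_insert T x) r = card {z \<in> row_insert T x r. z \<le> v}"
    using v by (subst count_eq_shape[OF is_tableau_row_insert[OF T]]) (auto simp: entries_row_insert)
  have s2: "shape T r = card {z \<in> T r. z \<le> v}"
    using v by (subst count_eq_shape[OF T(1)]) auto
  have e: "(\<exists>b. bump T x s = Some b \<and> b \<le> v) \<longleftrightarrow> s \<le> \<rho>" for s using some[of s] le by auto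
  show "shape (row_insert T x) r = ((shape T)(\<rho> := shape T \<rho> + 1)) r"
    unfolding s1 count_row_insert[OF T] e s2[symmetric] by auto
qed

primrec pop :: "tableau \<Rightarrow> nat \<Rightarrow> nat \<Rightarrow> nat" where
  "pop T \<rho> 0 = Max (T \<rho>)"
| "pop T \<rho> (Suc i) = Max {z \<in> T (\<rho> - Suc i). z < pop T \<rho> i}"

definition row_delete :: "tableau \<Rightarrow> nat \<Rightarrow> tableau" where
  "row_delete T \<rho> = (\<lambda>j. if j < \<rho> then insert (pop T \<rho> (\<rho> - Suc j)) (T j - {pop T \<rho> (\<rho> - j)})
     else if j = \<rho> then T \<rho> - {pop T \<rho> 0} else T j)"

lemma pop_row_insert:
  assumes T: "is_tableau T" "x \<notin> entries T"
    and land: "bump T x \<rho> = Some y" "bump T x (Suc \<rho>) = None"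
  shows "i \<le> \<rho> \<Longrightarrow> bump T x (\<rho> - i) = Some (pop (row_insert T x) \<rho> i)"
proof (induction i)
  case 0
  have "row_insert T x \<rho> = insert y (T \<rho>)"
    using land by (auto simp: row_insert_def simp del: bump.simps)
  moreover have "z \<le> y" if "z \<in> T \<rho>" for z
    using next_above_NoneD[of "T \<rho>" y z] land that by simp
  ultimately have "Max (row_insert T x \<rho>) = y"
    using tableau_finite_row[OF T(1)] by (intro Max_eqI) auto
  thus ?case using land by simp
next
  case (Suc i)
  let ?j = "\<rho> - Suc i"
  have Sj: "Suc ?j = \<rho> - i" using Suc.prems by simp
  have b': "bump T x (Suc ?j) = Some (pop (row_insert T x) \<rho> i)"
    using Suc Sj by simp
  let ?b' = "pop (row_insert T x) \<rho> i"
  obtain b where b: "bump T x ?j = Some b" "next_above (T ?j) b = Some ?b'"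
    using b' by (rule bump_SucD)
  have lt: "b < ?b'" and gap: "\<And>u. u \<in> T ?j \<Longrightarrow> b < u \<Longrightarrow> ?b' \<le> u"
    using next_above_SomeD[OF b(2)] by auto
  have row: "row_insert T x ?j = (T ?j - {?b'}) \<union> {b}"
    using b b' by (auto simp: row_insert_def simp del: bump.simps)
  have "Max {z \<in> row_insert T x ?j. z < ?b'} = b"
  proof (intro Max_eqI)
    show "finite {z \<in> row_insert T x ?j. z < ?b'}" unfolding row using tableau_finite_row[OF T(1)] by simp
    show "b \<in> {z \<in> row_insert T x ?j. z < ?b'}" unfolding row using lt by simp
    fix u assume "u \<in> {z \<in> row_insert T x ?j. z < ?b'}"
    thus "u \<le> b" unfolding row using gap[of u] by force
  qed
  thus ?case using b by simp
qed

lemma row_delete_row_insert: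
  assumes T: "is_tableau T" "x \<notin> entries T"
    and land: "bump T x \<rho> = Some y" "bump T x (Suc \<rho>) = None"
  shows "row_delete (row_insert T x) \<rho> = T" "pop (row_insert T x) \<rho> \<rho> = x"
proof -
  note P = pop_row_insert[OF T land]
  show "pop (row_insert T x) \<rho> \<rho> = x" using P[of \<rho>] by simp
  show "row_delete (row_insert T x) \<rho> = T"
  proof
    fix j
    consider "j < \<rho>" | "j = \<rho>" | "j > \<rho>" by linarith
    thus "row_delete (row_insert T x) \<rho> j = T j"
    proof cases
      case 1
      have a: "bump T x j = Some (pop (row_insert T x) \<rho> (\<rho> - j))" using P[of "\<rho> - j"] 1 by simp
      have b: "bump T x (Suc j) = Some (pop (row_insert T x) \<rho> (\<rho> - Suc j))"
        using P[of "\<rho> - Suc j"] 1 by (simp del: bump.simps add: Suc_diff_Suc)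
      have c: "pop (row_insert T x) \<rho> (\<rho> - Suc j) \<in> T j" using bump_Suc_in[OF b] .
      have d: "pop (row_insert T x) \<rho> (\<rho> - j) \<notin> T j" using bump_notin[OF T a] .
      have e: "row_insert T x j = (T j - {pop (row_insert T x) \<rho> (\<rho> - Suc j)}) \<union> {pop (row_insert T x) \<rho> (\<rho> - j)}"
        unfolding row_insert_def[of T x] a b by simp
      show ?thesis using 1 e c d by (auto simp: row_delete_def)
    next
      case 2
      have a: "bump T x \<rho> = Some (pop (row_insert T x) \<rho> 0)" using P[of 0] by simp
      have d: "pop (row_insert T x) \<rho> 0 \<notin> T \<rho>" using bump_notin[OF T a] .
      have e: "row_insert T x \<rho> = insert (pop (row_insert T x) \<rho> 0) (T \<rho>)"
        unfolding row_insert_def[of T x] a land by simp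
      show ?thesis using 2 e d by (auto simp: row_delete_def)
    next
      case 3
      have "bump T x j = None" "bump T x (Suc j) = None"
        using bump_mono_None[OF land(2)] 3 by (simp_all del: bump.simps)
      thus ?thesis using 3 by (auto simp: row_delete_def row_insert_def simp del: bump.simps)
    qed
  qed
qed

lemma pop_in:
  assumes T: "is_tableau T" "T \<rho> \<noteq> {}"
  shows "i \<le> \<rho> \<Longrightarrow> pop T \<rho> i \<in> T (\<rho> - i)"
    and "Suc i \<le> \<rho> \<Longrightarrow> pop T \<rho> (Suc i) < pop T \<rho> i"
    and "Suc i \<le> \<rho> \<Longrightarrow> z \<in> T (\<rho> - Suc i) \<Longrightarrow> z < pop T \<rho> i \<Longrightarrow> z \<le> pop T \<rho> (Suc i)"
proof -
  have step: "pop T \<rho> (Suc i) \<in> T (\<rho> - Suc i) \<and> pop T \<rho> (Suc i) < pop T \<rho> i"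
    if "Suc i \<le> \<rho>" "pop T \<rho> i \<in> T (\<rho> - i)" for i
  proof -
    let ?x = "pop T \<rho> i" and ?j = "\<rho> - Suc i"
    have Sj: "Suc ?j = \<rho> - i" using that by simp
    have "card {z \<in> T (Suc ?j). z \<le> ?x} > 0"
      using that(2) tableau_finite_row[OF T(1)] Sj by (auto simp: card_gt_0_iff)
    hence "card {z \<in> T ?j. z \<le> ?x} > 0" using tableau_count[OF T(1), of ?j ?x] by simp
    then obtain z where z: "z \<in> T ?j" "z \<le> ?x" by (auto simp: card_gt_0_iff)
    have "?x \<notin> T ?j" using tableau_disjoint[OF T(1) that(2)] Sj by (metis n_not_Suc_n)
    hence "z < ?x" using z by (metis le_neq_implies_less)
    hence ne: "{z \<in> T ?j. z < ?x} \<noteq> {}" using z by auto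
    have "Max {z \<in> T ?j. z < ?x} \<in> {z \<in> T ?j. z < ?x}"
      using Max_in[OF _ ne] tableau_finite_row[OF T(1)] by simp
    thus ?thesis by simp
  qed
  have ind: "i \<le> \<rho> \<Longrightarrow> pop T \<rho> i \<in> T (\<rho> - i)" for i
  proof (induction i)
    case 0 show ?case using T tableau_finite_row[OF T(1)] by simp
  next
    case (Suc i) thus ?case using step[of i] by simp
  qed
  show "i \<le> \<rho> \<Longrightarrow> pop T \<rho> i \<in> T (\<rho> - i)" by (rule ind)
  show "Suc i \<le> \<rho> \<Longrightarrow> pop T \<rho> (Suc i) < pop T \<rho> i" using step[of i] ind[of i] by simp
  show "Suc i \<le> \<rho> \<Longrightarrow> z \<in> T (\<rho> - Suc i) \<Longrightarrow> z < pop T \<rho> i \<Longrightarrow> z \<le> pop T \<rho> (Suc i)"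
    using tableau_finite_row[OF T(1)] by (simp add: Max_ge)
qed

lemma pop_strict:
  assumes T: "is_tableau T" "T \<rho> \<noteq> {}"
  shows "i < j \<Longrightarrow> j \<le> \<rho> \<Longrightarrow> pop T \<rho> j < pop T \<rho> i"
proof (induction j)
  case (Suc j)
  have "pop T \<rho> (Suc j) < pop T \<rho> j" using pop_in(2)[OF T Suc.prems(2)] .
  thus ?case using Suc by (cases "i = j") (auto simp del: pop.simps)
qed simp

lemma bump_row_delete:
  assumes T: "is_tableau T" "T \<rho> \<noteq> {}"
  shows "j \<le> \<rho> \<Longrightarrow> bump (row_delete T \<rho>) (pop T \<rho> \<rho>) j = Some (pop T \<rho> (\<rho> - j))"
    and "bump (row_delete T \<rho>) (pop T \<rho> \<rho>) (Suc \<rho>) = None"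
proof -
  have ind: "j \<le> \<rho> \<Longrightarrow> bump (row_delete T \<rho>) (pop T \<rho> \<rho>) j = Some (pop T \<rho> (\<rho> - j))" for j
  proof (induction j)
    case (Suc j)
    let ?i = "\<rho> - Suc j"
    have Si: "Suc ?i = \<rho> - j" and j: "\<rho> - Suc ?i = j" using Suc.prems by auto
    have row: "row_delete T \<rho> j = insert (pop T \<rho> ?i) (T j - {pop T \<rho> (Suc ?i)})"
      using Suc.prems Si by (simp add: row_delete_def del: pop.simps)
    have lt: "pop T \<rho> (Suc ?i) < pop T \<rho> ?i" using pop_in(2)[OF T, of ?i] Suc.prems by (simp del: pop.simps)
    have "next_above (row_delete T \<rho> j) (pop T \<rho> (Suc ?i)) = Some (pop T \<rho> ?i)"
    proof (rule next_above_eq_Some)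
      show "pop T \<rho> ?i \<in> row_delete T \<rho> j" unfolding row by simp
      show "pop T \<rho> (Suc ?i) < pop T \<rho> ?i" by (rule lt)
      fix u assume u: "u \<in> row_delete T \<rho> j" "pop T \<rho> (Suc ?i) < u"
      show "pop T \<rho> ?i \<le> u"
        using pop_in(3)[OF T, of ?i u] u Suc.prems j unfolding row by (force simp del: pop.simps)
    qed
    thus ?case using Suc Si by (simp del: pop.simps)
  qed simp
  show "j \<le> \<rho> \<Longrightarrow> bump (row_delete T \<rho>) (pop T \<rho> \<rho>) j = Some (pop T \<rho> (\<rho> - j))" by (rule ind)
  have "next_above (row_delete T \<rho> \<rho>) (pop T \<rho> 0) = None"
    using tableau_finite_row[OF T(1)] by (intro next_above_eq_None) (auto simp: row_delete_def)
  thus "bump (row_delete T \<rho>) (pop T \<rho> \<rho>) (Suc \<rho>) = None" using ind[of \<rho>] by (simp del: pop.simps)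
qed

lemma row_insert_row_delete:
  assumes T: "is_tableau T" "T \<rho> \<noteq> {}"
  shows "row_insert (row_delete T \<rho>) (pop T \<rho> \<rho>) = T"
proof
  fix j
  note B = bump_row_delete[OF T]
  consider "j < \<rho>" | "j = \<rho>" | "j > \<rho>" by linarith
  thus "row_insert (row_delete T \<rho>) (pop T \<rho> \<rho>) j = T j"
  proof cases
    case 1
    have a: "pop T \<rho> (\<rho> - j) \<in> T j" using pop_in(1)[OF T, of "\<rho> - j"] 1 by simp
    have b: "pop T \<rho> (\<rho> - Suc j) \<in> T (Suc j)" using pop_in(1)[OF T, of "\<rho> - Suc j"] 1 by simp
    have "pop T \<rho> (\<rho> - Suc j) \<notin> T j" using tableau_disjoint[OF T(1) b, of j] by auto
    thus ?thesis using 1 a B(1)[of j] B(1)[of "Suc j"]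
      by (auto simp: row_insert_def row_delete_def simp del: pop.simps bump.simps)
  next
    case 2
    have a: "pop T \<rho> 0 \<in> T \<rho>" using pop_in(1)[OF T, of 0] by simp
    show ?thesis unfolding row_insert_def 2 B(2) B(1)[OF order_refl]
      using a by (auto simp: row_delete_def simp del: pop.simps)
  next
    case 3
    have "bump (row_delete T \<rho>) (pop T \<rho> \<rho>) j = None" "bump (row_delete T \<rho>) (pop T \<rho> \<rho>) (Suc j) = None"
      using bump_mono_None[OF B(2)] 3 by (simp_all del: bump.simps)
    thus ?thesis using 3 by (auto simp: row_delete_def row_insert_def simp del: bump.simps)
  qed
qed

lemma row_delete_pop_notin:
  assumes T: "is_tableau T" "T \<rho> \<noteq> {}"
  shows "pop T \<rho> \<rho> \<notin> entries (row_delete T \<rho>)"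
proof
  let ?x = "pop T \<rho> \<rho>"
  assume "?x \<in> entries (row_delete T \<rho>)"
  then obtain j where j: "?x \<in> row_delete T \<rho> j" by (auto simp: entries_def)
  have x0: "?x \<in> T 0" using pop_in(1)[OF T, of \<rho>] by simp
  consider "j < \<rho>" "?x = pop T \<rho> (\<rho> - Suc j)" | "?x \<in> T j" "j < \<rho>" "?x \<noteq> pop T \<rho> (\<rho> - j)"
    | "?x \<in> T j" "j = \<rho>" "?x \<noteq> pop T \<rho> 0" | "?x \<in> T j" "j > \<rho>"
    using j by (auto simp: row_delete_def not_less simp del: pop.simps split: if_splits)
  thus False
  proof cases
    case 1
    thus False using pop_strict[OF T, of "\<rho> - Suc j" \<rho>] by simp
  next
    case 2 thus False using tableau_disjoint[OF T(1) x0, of j] by auto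
  next
    case 3 thus False using tableau_disjoint[OF T(1) x0, of j] by auto
  next
    case 4 thus False using tableau_disjoint[OF T(1) x0, of j] by auto
  qed
qed

lemma entries_row_delete:
  assumes T: "is_tableau T" "T \<rho> \<noteq> {}"
  shows "entries (row_delete T \<rho>) = entries T - {pop T \<rho> \<rho>}"
  using entries_row_insert[of "row_delete T \<rho>" "pop T \<rho> \<rho>"] row_delete_pop_notin[OF T]
  unfolding row_insert_row_delete[OF T] by auto

lemma is_tableau_row_delete:
  assumes T: "is_tableau T" and corner: "shape T (Suc \<rho>) < shape T \<rho>"
  shows "is_tableau (row_delete T \<rho>)" and "shape (row_delete T \<rho>) = (shape T)(\<rho> := shape T \<rho> - 1)"
proof -
  have ne: "T \<rho> \<noteq> {}" using corner by (auto simp: shape_def)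
  let ?D = "row_delete T \<rho>" and ?x = "pop T \<rho> \<rho>"
  note fin = tableau_finite_row[OF T]
  let ?c = "\<lambda>T r v. card {z \<in> T r. z \<le> v}"
  have cnt: "?c T j v = ?c ?D j v + (if j \<le> \<rho> \<and> pop T \<rho> (\<rho> - j) \<le> v \<and> (j < \<rho> \<longrightarrow> v < pop T \<rho> (\<rho> - Suc j)) then 1 else 0)" for j v
  proof -
    consider "j < \<rho>" | "j = \<rho>" | "j > \<rho>" by linarith
    thus ?thesis
    proof cases
      case 1
      let ?y = "pop T \<rho> (\<rho> - j)" and ?z = "pop T \<rho> (\<rho> - Suc j)"
      have a: "?y \<in> T j" using pop_in(1)[OF T ne, of "\<rho> - j"] 1 by simp
      have b: "?z \<in> T (Suc j)" using pop_in(1)[OF T ne, of "\<rho> - Suc j"] 1 by simp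
      have c: "?z \<notin> T j" using tableau_disjoint[OF T b, of j] by auto
      have d: "?y < ?z" using pop_strict[OF T ne, of "\<rho> - Suc j" "\<rho> - j"] 1 by simp
      have e: "{z \<in> ?D j. z \<le> v} = ({z \<in> T j. z \<le> v} - {?y}) \<union> (if ?z \<le> v then {?z} else {})"
        using 1 by (auto simp: row_delete_def simp del: pop.simps)
      have f: "?y \<le> v \<Longrightarrow> card {z \<in> T j. z \<le> v} > 0" using a fin by (auto simp: card_gt_0_iff)
      have g: "card ({z \<in> T j. z \<le> v} - {?y}) = card {z \<in> T j. z \<le> v} - (if ?y \<le> v then 1 else 0)"
        using a by auto
      show ?thesis unfolding e using 1 c d f g fin by (auto simp del: pop.simps simp: not_le)
    next
      case 2
      let ?y = "pop T \<rho> 0"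
      have a: "?y \<in> T \<rho>" using pop_in(1)[OF T ne, of 0] by simp
      have e: "{z \<in> ?D j. z \<le> v} = {z \<in> T \<rho>. z \<le> v} - {?y}"
        using 2 by (auto simp: row_delete_def simp del: pop.simps)
      have f: "?y \<le> v \<Longrightarrow> card {z \<in> T \<rho>. z \<le> v} > 0" using a fin by (auto simp: card_gt_0_iff)
      have g: "card ({z \<in> T \<rho>. z \<le> v} - {?y}) = card {z \<in> T \<rho>. z \<le> v} - (if ?y \<le> v then 1 else 0)"
        using a by auto
      show ?thesis unfolding e using 2 f g by (auto simp del: pop.simps)
    next
      case 3
      thus ?thesis by (auto simp: row_delete_def simp del: pop.simps)
    qed
  qed
  show tD: "is_tableau ?D"
    unfolding is_tableau_def
  proof (intro conjI allI impI)
    show "finite (entries ?D)" using T by (simp add: entries_row_delete[OF T ne] is_tableau_def)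
  next
    have key: False if rs: "r < s" "z \<in> ?D r" "z \<in> ?D s" for r s z
    proof -
      have zs: "z \<in> T s \<or> s < \<rho> \<and> z = pop T \<rho> (\<rho> - Suc s)"
        using rs(3) by (auto simp: row_delete_def simp del: pop.simps split: if_splits)
      have up: "pop T \<rho> (\<rho> - Suc j) \<in> T (Suc j)" if "j < \<rho>" for j
        using pop_in(1)[OF T ne, of "\<rho> - Suc j"] that by simp
      have zs': "z \<in> T s \<or> z \<in> T (Suc s)" using zs up by blast
      show False
      proof (cases "z \<in> T r")
        case True
        thus False using zs' tableau_disjoint[OF T True, of s] tableau_disjoint[OF T True, of "Suc s"] rs(1) by auto
      next
        case False
        hence r: "r < \<rho>" "z = pop T \<rho> (\<rho> - Suc r)"
          using rs(2) by (auto simp: row_delete_def simp del: pop.simps split: if_splits)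
        hence "z \<in> T (Suc r)" using up by blast
        hence s: "s = Suc r" using zs' rs(1) tableau_disjoint[OF T, of z] by fastforce
        show False
        proof (cases "s = \<rho>")
          case True
          thus False using rs(3) r s by (simp add: row_delete_def)
        next
          case False
          hence "s < \<rho>" using r s by simp
          moreover have "pop T \<rho> (\<rho> - s) = z" using r s by simp
          ultimately have "z = pop T \<rho> (\<rho> - Suc s)"
            using rs(3) by (auto simp: row_delete_def simp del: pop.simps)
          moreover have "\<rho> - Suc s < \<rho> - s" using \<open>s < \<rho>\<close> by linarith
          ultimately show False
            using pop_strict[OF T ne, of "\<rho> - Suc s" "\<rho> - s"] \<open>pop T \<rho> (\<rho> - s) = z\<close> by simp
        qed
      qed
    qed
    show "?D r \<inter> ?D s = {}" if "r \<noteq> s" for r s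
      using key[of r s] key[of s r] that by (meson disjoint_iff linorder_neqE_nat)
  next
    fix r v
    have base: "?c T (Suc r) v \<le> ?c T r v" using tableau_count[OF T] .
    let ?P = "\<lambda>j. j \<le> \<rho> \<and> pop T \<rho> (\<rho> - j) \<le> v \<and> (j < \<rho> \<longrightarrow> v < pop T \<rho> (\<rho> - Suc j))"
    show "?c ?D (Suc r) v \<le> ?c ?D r v"
    proof (cases "?P r")
      case False
      have "?c T r v = ?c ?D r v" unfolding cnt[of r v] if_not_P[OF False] by simp
      moreover have "?c ?D (Suc r) v \<le> ?c T (Suc r) v" unfolding cnt[of "Suc r" v] by simp
      ultimately show ?thesis using base by linarith
    next
      case True
      have 1: "?c T r v = ?c ?D r v + 1" unfolding cnt[of r v] if_P[OF True] by simp
      have 2: "?c ?D (Suc r) v \<le> ?c T (Suc r) v" unfolding cnt[of "Suc r" v] by simp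
      have "?c T (Suc r) v < ?c T r v"
      proof (cases "r < \<rho>")
        case r: True
        let ?i = "\<rho> - Suc r"
        let ?z = "pop T \<rho> ?i"
        have Si: "Suc ?i = \<rho> - r" using r by simp
        have vz: "v < ?z" using True r by blast
        have zin: "?z \<in> T (Suc r)" using pop_in(1)[OF T ne, of ?i] r by simp
        have "z \<le> v" if z: "z \<in> T r" "z \<le> ?z" for z
        proof -
          have "z \<noteq> ?z" using tableau_disjoint[OF T zin, of r] z by auto
          hence "z \<le> pop T \<rho> (Suc ?i)" using pop_in(3)[OF T ne, of ?i z] z r by (simp del: pop.simps)
          thus ?thesis using True unfolding Si by simp
        qed
        hence "{z \<in> T r. z \<le> v} = {z \<in> T r. z \<le> ?z}" using vz by fastforce
        hence "?c T r v = ?c T r ?z" by simp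
        moreover have "?c T (Suc r) ?z \<le> ?c T r ?z" using tableau_count[OF T] .
        moreover have "?c T (Suc r) v < ?c T (Suc r) ?z"
          by (rule card_le_strict_mono[OF fin zin vz order_refl])
        ultimately show ?thesis by linarith
      next
        case False
        hence r: "r = \<rho>" using True by simp
        have "z \<le> v" if "z \<in> T \<rho>" for z
          using Max_ge[OF fin that] True r by simp
        hence "{z \<in> T \<rho>. z \<le> v} = T \<rho>" by auto
        moreover have "?c T (Suc \<rho>) v \<le> card (T (Suc \<rho>))" using fin by (intro card_mono) auto
        ultimately show ?thesis using corner r by (simp add: shape_def)
      qed
      thus ?thesis using 1 2 by linarith
    qed
  qed
  have "shape T = (shape ?D)(\<rho> := shape ?D \<rho> + 1)"
    using row_insert_landing[OF tD row_delete_pop_notin[OF T ne] bump_row_delete(1)[OF T ne order_refl] bump_row_delete(2)[OF T ne]]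
    unfolding row_insert_row_delete[OF T ne] .
  thus "shape ?D = (shape T)(\<rho> := shape T \<rho> - 1)" by (auto simp: fun_eq_iff)
qed

subsection \<open>Crossings and the number of rows\<close>

lemma partial_matching_iff:
  "partial_matching n M \<longleftrightarrow> M \<subseteq> {(i, j). 1 \<le> i \<and> i < j \<and> j \<le> n} \<and>
     (\<forall>e\<in>M. \<forall>e'\<in>M. e \<noteq> e' \<longrightarrow> {fst e, snd e} \<inter> {fst e', snd e'} = {})"
proof (cases "M \<subseteq> {(i, j). 1 \<le> i \<and> i < j \<and> j \<le> n}")
  case True
  have "finite M" by (rule finite_subset[OF True], rule finite_subset[of _ "{..n} \<times> {..n}"]) auto
  hence fin: "finite {e \<in> M. v = fst e \<or> v = snd e}" for v by simp
  have "(\<forall>v\<in>{1..n}. arc_degree M v \<le> 1) \<longleftrightarrow>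
     (\<forall>v\<in>{1..n}. \<forall>e\<in>M. \<forall>e'\<in>M. (v = fst e \<or> v = snd e) \<longrightarrow> (v = fst e' \<or> v = snd e') \<longrightarrow> e = e')"
    unfolding arc_degree_def One_nat_def card_le_Suc0_iff_eq[OF fin] by blast
  also have "\<dots> \<longleftrightarrow> (\<forall>e\<in>M. \<forall>e'\<in>M. e \<noteq> e' \<longrightarrow> {fst e, snd e} \<inter> {fst e', snd e'} = {})"
  proof -
    have "v \<in> {1..n}" if "e \<in> M" "v = fst e \<or> v = snd e" for e v
      using True that by fastforce
    thus ?thesis by blast
  qed
  finally show ?thesis using True by (simp add: partial_matching_def)
qed (simp add: partial_matching_def)

definition back_step :: "arcs \<Rightarrow> nat \<Rightarrow> tableau \<Rightarrow> tableau" where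
  "back_step M t T = (if \<exists>x. (x, t) \<in> M then row_insert T (THE x. (x, t) \<in> M) else (\<lambda>r. T r - {t}))"

lemma is_tableau_remove_max:
  assumes T: "is_tableau T" and le: "\<And>z. z \<in> entries T \<Longrightarrow> z \<le> Suc t"
  shows "is_tableau (\<lambda>r. T r - {Suc t})"
proof -
  have c: "{z \<in> T r - {Suc t}. z \<le> v} = {z \<in> T r. z \<le> min v t}" for r v
  proof -
    have "z \<le> Suc t" if "z \<in> T r" for z using le that by (auto intro: in_entries)
    thus ?thesis by (auto simp: le_Suc_eq)
  qed
  have "entries (\<lambda>r. T r - {Suc t}) \<subseteq> entries T" by (auto simp: entries_def)
  hence "finite (entries (\<lambda>r. T r - {Suc t}))" using T by (auto simp: is_tableau_def intro: finite_subset)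
  moreover have "(T r - {Suc t}) \<inter> (T s - {Suc t}) = {}" if "r \<noteq> s" for r s
    using T that by (auto simp: is_tableau_def)
  ultimately show ?thesis using tableau_count[OF T] unfolding is_tableau_def c by blast
qed

locale tableau_history =
  fixes n :: nat and M :: arcs and F :: "nat \<Rightarrow> tableau"
  assumes matching: "partial_matching n M"
    and F_end: "F n = (\<lambda>_. {})"
    and F_step: "\<And>t. t < n \<Longrightarrow> F t = back_step M (Suc t) (F (Suc t))"
begin

lemma arc_bounds: "(x, y) \<in> M \<Longrightarrow> 1 \<le> x \<and> x < y \<and> y \<le> n"
  using matching by (auto simp: partial_matching_iff)

lemma arc_unique:
  "(x, t) \<in> M \<Longrightarrow> (y, t) \<in> M \<Longrightarrow> x = y"
  "(t, x) \<in> M \<Longrightarrow> (t, y) \<in> M \<Longrightarrow> x = y"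
  "(x, t) \<in> M \<Longrightarrow> (t, y) \<in> M \<Longrightarrow> False"
proof -
  have sep: "e = e'" if "e \<in> M" "e' \<in> M" "v \<in> {fst e, snd e}" "v \<in> {fst e', snd e'}" for e e' v
    using matching that unfolding partial_matching_iff by blast
  show "(x, t) \<in> M \<Longrightarrow> (y, t) \<in> M \<Longrightarrow> x = y" using sep[of "(x, t)" "(y, t)" t] by simp
  show "(t, x) \<in> M \<Longrightarrow> (t, y) \<in> M \<Longrightarrow> x = y" using sep[of "(t, x)" "(t, y)" t] by simp
  show "(x, t) \<in> M \<Longrightarrow> (t, y) \<in> M \<Longrightarrow> False" using sep[of "(x, t)" "(t, y)" t] arc_bounds by fastforce
qed

lemma the_opener: "(x, t) \<in> M \<Longrightarrow> (THE x. (x, t) \<in> M) = x"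
  using arc_unique(1) by blast

lemma F_closer: "(x, Suc t) \<in> M \<Longrightarrow> F t = row_insert (F (Suc t)) x"
  using F_step[of t] arc_bounds[of x "Suc t"] the_opener[of x "Suc t"] by (auto simp: back_step_def)

lemma F_no_closer: "t < n \<Longrightarrow> (\<And>x. (x, Suc t) \<notin> M) \<Longrightarrow> F t = (\<lambda>r. F (Suc t) r - {Suc t})"
  using F_step[of t] by (auto simp: back_step_def)

lemma history_invariant:
  "t \<le> n \<Longrightarrow> is_tableau (F t) \<and> entries (F t) = {x. \<exists>y. (x, y) \<in> M \<and> x \<le> t \<and> t < y}"
proof (induction t rule: inc_induct)
  case base
  show ?case using is_tableau_empty arc_bounds by (fastforce simp: F_end entries_def)
next
  case (step t)
  let ?E = "\<lambda>t. {x. \<exists>y. (x, y) \<in> M \<and> x \<le> t \<and> t < y}"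
  have T: "is_tableau (F (Suc t))" and E: "entries (F (Suc t)) = ?E (Suc t)" using step.IH by auto
  show ?case
  proof (cases "\<exists>x. (x, Suc t) \<in> M")
    case True
    then obtain x where x: "(x, Suc t) \<in> M" by blast
    have nx: "x \<notin> entries (F (Suc t))" unfolding E using arc_unique(2)[OF x] by blast
    have "insert x (?E (Suc t)) = ?E t"
    proof (intro set_eqI iffI)
      fix z assume "z \<in> insert x (?E (Suc t))"
      then consider "z = x" | y where "(z, y) \<in> M" "z \<le> Suc t" "Suc t < y" by blast
      thus "z \<in> ?E t"
      proof cases
        case 1 thus ?thesis using x arc_bounds[OF x] by auto
      next
        case 2
        hence "z \<noteq> Suc t" using arc_unique(3)[OF x] by blast
        thus ?thesis using 2 by (auto intro!: exI[of _ y])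
      qed
    next
      fix z assume "z \<in> ?E t"
      then obtain y where y: "(z, y) \<in> M" "z \<le> t" "t < y" by blast
      show "z \<in> insert x (?E (Suc t))"
      proof (cases "y = Suc t")
        case True thus ?thesis using arc_unique(1)[OF x] y by auto
      next
        case False thus ?thesis using y by (auto intro!: exI[of _ y])
      qed
    qed
    thus ?thesis using is_tableau_row_insert[OF T nx] unfolding F_closer[OF x] entries_row_insert E by simp
  next
    case False
    hence F: "F t = (\<lambda>r. F (Suc t) r - {Suc t})" using F_no_closer step.hyps by blast
    have "is_tableau (F t)" unfolding F by (rule is_tableau_remove_max[OF T]) (auto simp: E)
    moreover have "entries (F t) = entries (F (Suc t)) - {Suc t}" unfolding F by (auto simp: entries_def)
    moreover have "?E (Suc t) - {Suc t} = ?E t"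
      using False by (auto simp: le_Suc_eq) (metis Suc_lessI)+
    ultimately show ?thesis by (simp add: E)
  qed
qed

lemmas F_tableau = history_invariant[THEN conjunct1] and F_entries = history_invariant[THEN conjunct2]

lemma F_le: "t \<le> n \<Longrightarrow> x \<in> F t r \<Longrightarrow> x \<le> t"
  using F_entries[of t] in_entries[of x "F t" r] by auto

lemma F_start: "F 0 = (\<lambda>_. {})"
proof -
  have "entries (F 0) = {}" using F_entries[of 0] arc_bounds by fastforce
  thus ?thesis by (auto simp: entries_def)
qed

definition inserted :: "nat \<Rightarrow> nat \<Rightarrow> nat option" where
  "inserted t r = (if \<exists>x. (x, t) \<in> M then bump (F t) (THE x. (x, t) \<in> M) r else None)"

lemma inserted_closer: "(x, t) \<in> M \<Longrightarrow> inserted t r = bump (F t) x r"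
  using the_opener by (auto simp: inserted_def)

lemma inserted_SomeD:
  assumes "inserted t r = Some y"
  obtains x where "(x, t) \<in> M" "bump (F t) x r = Some y"
  using assms the_opener by (auto simp: inserted_def split: if_splits)

lemma inserted_0: "inserted t 0 = Some x \<longleftrightarrow> (x, t) \<in> M"
proof
  assume "inserted t 0 = Some x" thus "(x, t) \<in> M" by (rule inserted_SomeD) simp
next
  assume "(x, t) \<in> M" thus "inserted t 0 = Some x" by (simp add: inserted_closer)
qed

lemma inserted_in:
  assumes "inserted t r = Some x" shows "x \<in> F (t - 1) r" "1 \<le> t" "t \<le> n" "x < t"
proof -
  obtain y where y: "(y, t) \<in> M" "bump (F t) y r = Some x" using assms by (rule inserted_SomeD)
  show t: "1 \<le> t" "t \<le> n" using arc_bounds[OF y(1)] by auto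
  then obtain t' where t': "t = Suc t'" by (cases t) auto
  have "F t' = row_insert (F t) y" using F_closer y t' by simp
  thus in': "x \<in> F (t - 1) r" using y t' by (simp add: row_insert_def)
  show "x < t" using F_le[OF _ in'] t by linarith
qed

lemma row_keeps:
  assumes "x \<in> F (Suc t) r" "x \<le> t" "t < n"
  shows "x \<in> F t r \<or> inserted (Suc t) (Suc r) = Some x"
proof (cases "\<exists>y. (y, Suc t) \<in> M")
  case True
  then obtain y where y: "(y, Suc t) \<in> M" by blast
  thus ?thesis using assms unfolding F_closer[OF y] inserted_closer[OF y]
    by (auto simp: row_insert_def simp del: bump.simps)
next
  case False
  thus ?thesis using assms F_no_closer[of t] by auto
qed

lemma row_gains:
  assumes "x \<in> F t r" "t < n"
  shows "x \<in> F (Suc t) r \<or> inserted (Suc t) r = Some x"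
proof (cases "\<exists>y. (y, Suc t) \<in> M")
  case True
  then obtain y where y: "(y, Suc t) \<in> M" by blast
  thus ?thesis using assms unfolding F_closer[OF y] inserted_closer[OF y]
    by (auto simp: row_insert_def simp del: bump.simps)
next
  case False
  thus ?thesis using assms F_no_closer[of t] by auto
qed

lemma row_keeps_until:
  assumes "b \<le> a" "a \<le> n" "x \<in> F a r" "x \<le> b"
  shows "x \<in> F b r \<or> (\<exists>s. b < s \<and> s \<le> a \<and> inserted s (Suc r) = Some x)"
  using assms(1)
proof (induction b rule: inc_induct)
  case base show ?case using assms by simp
next
  case (step t)
  from step.IH show ?case
  proof
    assume "x \<in> F (Suc t) r"
    thus ?thesis using row_keeps[of x t r] assms(2,4) step.hyps by auto
  next
    assume "\<exists>s. Suc t < s \<and> s \<le> a \<and> inserted s (Suc r) = Some x"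
    thus ?thesis using Suc_lessD by blast
  qed
qed

lemma row_origin:
  assumes "b \<le> c" "c \<le> n" "x \<in> F b r"
  shows "x \<in> F c r \<or> (\<exists>s. b < s \<and> s \<le> c \<and> inserted s r = Some x)"
  using assms(1,2)
proof (induction c rule: dec_induct)
  case base show ?case using assms by simp
next
  case (step t)
  have "x \<in> F t r \<or> (\<exists>s. b < s \<and> s \<le> t \<and> inserted s r = Some x)" using step by simp
  thus ?case
  proof
    assume "x \<in> F t r" thus ?thesis using row_gains[of x t r] step by auto
  next
    assume "\<exists>s. b < s \<and> s \<le> t \<and> inserted s r = Some x" thus ?thesis using le_SucI by blast
  qed
qed

text \<open>\<open>chain r v K t x\<close>: there are \<open>K\<close> insertions into row \<open>r\<close> at times \<open>t\<^sub>1 > \<dots> > t\<^sub>K = t\<close> (the history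
  runs backwards) of values \<open>v \<ge> x\<^sub>1 > \<dots> > x\<^sub>K = x\<close>, all of them before the values up to \<open>v\<close> disappear.
  In row \<open>0\<close> this is a \<open>K\<close>-crossing, and row by row a chain gets shorter by exactly one.\<close>

inductive chain :: "nat \<Rightarrow> nat \<Rightarrow> nat \<Rightarrow> nat \<Rightarrow> nat \<Rightarrow> bool" for r v :: nat where
  single: "inserted t r = Some x \<Longrightarrow> x \<le> v \<Longrightarrow> v < t \<Longrightarrow> chain r v (Suc 0) t x"
| extend: "chain r v K t' x' \<Longrightarrow> inserted t r = Some x \<Longrightarrow> t < t' \<Longrightarrow> x < x' \<Longrightarrow> v < t \<Longrightarrow> chain r v (Suc K) t x"

lemma chainD: "chain r v K t x \<Longrightarrow> inserted t r = Some x \<and> x \<le> v \<and> v < t \<and> 0 < K"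
  by (induction rule: chain.induct) auto

lemma bumped_between:
  assumes a: "inserted t' r = Some x'" and b: "inserted t r = Some x" and lt: "t < t'" "x < x'" "x' < t"
  shows "\<exists>s y. t \<le> s \<and> s < t' \<and> x < y \<and> y \<le> x' \<and> inserted s (Suc r) = Some y"
proof -
  note A = inserted_in[OF a]
  have "x' \<in> F t r \<or> (\<exists>s. t < s \<and> s \<le> t' - 1 \<and> inserted s (Suc r) = Some x')"
    by (rule row_keeps_until) (use A lt in auto)
  thus ?thesis
  proof
    assume x': "x' \<in> F t r"
    obtain z where z: "(z, t) \<in> M" "bump (F t) z r = Some x" using b by (rule inserted_SomeD)
    obtain y where y: "next_above (F t r) x = Some y"
      using x' lt(2) by (cases "next_above (F t r) x") (auto dest: next_above_NoneD)
    have "inserted t (Suc r) = Some y" using z y by (simp add: inserted_closer)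
    thus ?thesis using next_above_SomeD[OF y] x' lt by blast
  next
    assume "\<exists>s. t < s \<and> s \<le> t' - 1 \<and> inserted s (Suc r) = Some x'"
    then obtain s where "t < s" "s \<le> t' - 1" "inserted s (Suc r) = Some x'" by blast
    thus ?thesis using A lt by (intro exI[of _ s] exI[of _ x']) auto
  qed
qed

lemma chain_next_row:
  "chain r v K t x \<Longrightarrow> Suc 0 < K \<Longrightarrow> \<exists>s y. chain (Suc r) v (K - 1) s y \<and> t \<le> s \<and> x < y"
proof (induction rule: chain.induct)
  case (extend K t' x' t x)
  note D = chainD[OF extend.hyps(1)]
  obtain s y where s: "t \<le> s" "s < t'" "x < y" "y \<le> x'" "inserted s (Suc r) = Some y"
    using bumped_between[of t' r x' t x] D extend.hyps by auto
  show ?case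
  proof (cases "Suc 0 < K")
    case True
    then obtain s' y' where c: "chain (Suc r) v (K - 1) s' y'" "t' \<le> s'" "x' < y'" using extend.IH by blast
    hence "chain (Suc r) v (Suc (K - 1)) s y" using s extend.hyps by (intro chain.extend[OF c(1)]) auto
    thus ?thesis using s True by auto
  next
    case False
    hence "K = Suc 0" using D by simp
    moreover have "chain (Suc r) v (Suc 0) s y" using s D extend.hyps by (intro chain.single) auto
    ultimately show ?thesis using s by auto
  qed
qed simp

lemma chain_previous_row_aux:
  "chain (Suc r) v K s y \<Longrightarrow> \<exists>t x. chain r v K t x \<and> s < t \<and> y \<le> x"
proof (induction rule: chain.induct)
  case (single s y)
  obtain z where z: "(z, s) \<in> M" "bump (F s) z (Suc r) = Some y" using single(1) by (rule inserted_SomeD)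
  have "y \<in> F s r" using bump_Suc_in[OF z(2)] .
  hence "\<exists>t. s < t \<and> t \<le> n \<and> inserted t r = Some y"
    using row_origin[of s n y r] inserted_in[OF single(1)] by (auto simp: F_end)
  then obtain t where "s < t" "inserted t r = Some y" by blast
  hence "chain r v (Suc 0) t y" using single by (intro chain.single) auto
  thus ?case using \<open>s < t\<close> by blast
next
  case (extend K s' y' s y)
  obtain t' x' where t': "chain r v K t' x'" "s' < t'" "y' \<le> x'" using extend.IH by blast
  note D = chainD[OF extend.hyps(1)]
  obtain z where z: "(z, s) \<in> M" "bump (F s) z (Suc r) = Some y" using extend.hyps(2) by (rule inserted_SomeD)
  have "y \<in> F s r" using bump_Suc_in[OF z(2)] .
  hence "y \<in> F s' r \<or> (\<exists>t. s < t \<and> t \<le> s' \<and> inserted t r = Some y)"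
    using row_origin[of s s' y r] inserted_in[of s' "Suc r" y'] D extend.hyps by auto
  thus ?case
  proof
    assume "\<exists>t. s < t \<and> t \<le> s' \<and> inserted t r = Some y"
    then obtain t where t: "s < t" "t \<le> s'" "inserted t r = Some y" by blast
    have "chain r v (Suc K) t y" by (rule chain.extend[OF t'(1)]) (use t t' extend.hyps in auto)
    thus ?thesis using t by blast
  next
    assume y: "y \<in> F s' r"
    obtain z' where z': "(z', s') \<in> M" "bump (F s') z' (Suc r) = Some y'" using D by (blast elim: inserted_SomeD)
    then obtain u where u: "bump (F s') z' r = Some u" "next_above (F s' r) u = Some y'" by (blast elim: bump_SucD)
    have "y \<le> u" "u < y'" using next_above_SomeD[OF u(2)] y extend.hyps by (meson leD leI)+
    moreover have "inserted s' r = Some u" using u z' by (simp add: inserted_closer)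
    ultimately have "chain r v (Suc K) s' u" using t' D by (intro chain.extend[OF t'(1)]) auto
    thus ?thesis using \<open>y \<le> u\<close> extend.hyps by blast
  qed
qed

lemma chain_previous_row:
  assumes "chain (Suc r) v K s y" shows "\<exists>x. chain r v (Suc K) s x"
proof -
  obtain t x where t: "chain r v K t x" "s < t" "y \<le> x" using chain_previous_row_aux[OF assms] by blast
  note D = chainD[OF assms]
  obtain z where z: "(z, s) \<in> M" "bump (F s) z (Suc r) = Some y" using D by (blast elim: inserted_SomeD)
  then obtain u where u: "bump (F s) z r = Some u" "next_above (F s r) u = Some y" by (blast elim: bump_SucD)
  have "u < y" using next_above_SomeD[OF u(2)] by blast
  moreover have "inserted s r = Some u" using u z by (simp add: inserted_closer)
  ultimately have "chain r v (Suc K) s u" using t D by (intro chain.extend[OF t(1)]) auto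
  thus ?thesis by blast
qed

lemma chain_shift:
  "(\<exists>t x. chain r v (Suc m) t x) \<longleftrightarrow> (\<exists>t x. chain (r + m) v (Suc 0) t x)"
proof (induction m arbitrary: r)
  case (Suc m)
  have "(\<exists>t x. chain r v (Suc (Suc m)) t x) \<longleftrightarrow> (\<exists>t x. chain (Suc r) v (Suc m) t x)"
    using chain_next_row[of r v "Suc (Suc m)"] chain_previous_row[of r v "Suc m"] by fastforce
  thus ?case using Suc[of "Suc r"] by simp
qed simp

lemma chain_iff_row_nonempty: "(\<exists>v t x. chain r v (Suc 0) t x) \<longleftrightarrow> (\<exists>t\<le>n. F t r \<noteq> {})"
proof
  assume "\<exists>v t x. chain r v (Suc 0) t x"
  then obtain v t x where "chain r v (Suc 0) t x" by blast
  hence "inserted t r = Some x" using chainD by blast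
  from inserted_in[OF this] have "t - 1 \<le> n \<and> F (t - 1) r \<noteq> {}" by auto
  thus "\<exists>t\<le>n. F t r \<noteq> {}" by blast
next
  assume "\<exists>t\<le>n. F t r \<noteq> {}"
  then obtain t x where "t \<le> n" "x \<in> F t r" by blast
  then obtain s where s: "inserted s r = Some x" using row_origin[of t n x r] by (auto simp: F_end)
  show "\<exists>v t x. chain r v (Suc 0) t x" using chain.single[OF s order_refl inserted_in(4)[OF s]] by blast
qed

lemma crossing_imp_chain:
  assumes sub: "A \<subseteq> M" and cr: "is_crossing (Suc m) A"
  shows "\<exists>v t x. chain 0 v (Suc m) t x"
proof -
  let ?K = "Suc m"
  obtain i j :: "nat \<Rightarrow> nat" where ij: "A = (\<lambda>t. (i t, j t)) ` {1..?K}"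
      "\<forall>t\<in>{1..<?K}. i t < i (t + 1)" "i ?K < j 1" "\<forall>t\<in>{1..<?K}. j t < j (t + 1)"
    using cr unfolding is_crossing_def by blast
  have mem: "(i s, j s) \<in> M" if "1 \<le> s" "s \<le> ?K" for s using ij(1) sub that by auto
  have j1: "1 \<le> s \<Longrightarrow> s \<le> ?K \<Longrightarrow> j 1 \<le> j s" for s
  proof (induction s rule: dec_induct)
    case (step s) thus ?case using ij(4)[rule_format, of s] by auto
  qed simp
  have "d \<le> m \<Longrightarrow> chain 0 (i ?K) (Suc d) (j (?K - d)) (i (?K - d))" for d
  proof (induction d)
    case 0
    show ?case using mem[of ?K] j1[of ?K] ij(3) by (intro chain.single) (auto simp: inserted_0)
  next
    case (Suc d)
    have s: "?K - Suc d \<in> {1..<?K}" "?K - Suc d + 1 = ?K - d" using Suc.prems by auto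
    show ?case
    proof (rule chain.extend[of 0 "i ?K" "Suc d" "j (?K - d)" "i (?K - d)"])
      show "chain 0 (i ?K) (Suc d) (j (?K - d)) (i (?K - d))" using Suc by simp
      show "inserted (j (?K - Suc d)) 0 = Some (i (?K - Suc d))" using mem[of "?K - Suc d"] s(1) by (simp add: inserted_0)
      show "j (?K - Suc d) < j (?K - d)" "i (?K - Suc d) < i (?K - d)" using ij(2,4) s by metis+
      show "i ?K < j (?K - Suc d)" using j1[of "?K - Suc d"] s(1) ij(3) by simp
    qed
  qed
  from this[of m] show ?thesis by blast
qed

lemma chain_imp_crossing:
  "chain 0 v K t x \<Longrightarrow> \<exists>i j :: nat \<Rightarrow> nat. (\<forall>s\<in>{1..K}. (i s, j s) \<in> M) \<and>
     (\<forall>s\<in>{1..<K}. i s < i (s + 1)) \<and> i K \<le> v \<and> v < j 1 \<and> (\<forall>s\<in>{1..<K}. j s < j (s + 1)) \<and> i 1 = x \<and> j 1 = t"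
proof (induction rule: chain.induct)
  case (single t x)
  thus ?case by (intro exI[of _ "\<lambda>_. x"] exI[of _ "\<lambda>_. t"]) (auto simp: inserted_0)
next
  case (extend K t' x' t x)
  then obtain i j :: "nat \<Rightarrow> nat" where ij: "\<forall>s\<in>{1..K}. (i s, j s) \<in> M" "\<forall>s\<in>{1..<K}. i s < i (s + 1)"
    "i K \<le> v" "v < j 1" "\<forall>s\<in>{1..<K}. j s < j (s + 1)" "i 1 = x'" "j 1 = t'" by blast
  have K: "K > 0" using chainD[OF extend.hyps(1)] by blast
  let ?i = "\<lambda>s. if s = 1 then x else i (s - 1)" and ?j = "\<lambda>s. if s = 1 then t else j (s - 1)"
  have 1: "(?i s, ?j s) \<in> M" if "s \<in> {1..Suc K}" for s
  proof (cases "s = 1")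
    case True thus ?thesis using extend.hyps by (simp add: inserted_0)
  next
    case False
    hence "s - 1 \<in> {1..K}" using that by auto
    thus ?thesis using False ij(1) by simp
  qed
  have 2: "?i s < ?i (s + 1)" "?j s < ?j (s + 1)" if "s \<in> {1..<Suc K}" for s
  proof -
    have *: "i (s - 1) < i s \<and> j (s - 1) < j s" if "s \<noteq> 1"
    proof -
      have "s - 1 \<in> {1..<K}" "s - 1 + 1 = s" using that \<open>s \<in> {1..<Suc K}\<close> by auto
      thus ?thesis using ij(2,5) by metis
    qed
    show "?i s < ?i (s + 1)" "?j s < ?j (s + 1)" using * that ij(6,7) extend.hyps by auto
  qed
  show ?case
    by (rule exI[of _ ?i], rule exI[of _ ?j]) (use 1 2 ij K extend.hyps in auto)
qed

theorem noncrossing_iff_rows: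
  assumes "k \<ge> 1"
  shows "noncrossing k M \<longleftrightarrow> (\<forall>t\<le>n. F t (k - 1) = {})"
proof -
  obtain m where m: "k = Suc m" using assms by (cases k) auto
  have "(\<exists>A\<subseteq>M. is_crossing (Suc m) A) \<longleftrightarrow> (\<exists>v t x. chain 0 v (Suc m) t x)"
  proof
    assume "\<exists>v t x. chain 0 v (Suc m) t x"
    then obtain v t x where "chain 0 v (Suc m) t x" by blast
    from chain_imp_crossing[OF this] obtain i j :: "nat \<Rightarrow> nat" where
      ij: "\<forall>s\<in>{1..Suc m}. (i s, j s) \<in> M" "\<forall>s\<in>{1..<Suc m}. i s < i (s + 1)"
      "i (Suc m) \<le> v" "v < j 1" "\<forall>s\<in>{1..<Suc m}. j s < j (s + 1)" by blast
    have "is_crossing (Suc m) ((\<lambda>t. (i t, j t)) ` {1..Suc m})"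
      unfolding is_crossing_def using ij by (intro exI[of _ i] exI[of _ j]) auto
    moreover have "(\<lambda>t. (i t, j t)) ` {1..Suc m} \<subseteq> M" using ij(1) by blast
    ultimately show "\<exists>A\<subseteq>M. is_crossing (Suc m) A" by blast
  qed (use crossing_imp_chain in blast)
  also have "\<dots> \<longleftrightarrow> (\<exists>v t x. chain m v (Suc 0) t x)" using chain_shift[of 0 _ m] by simp
  also have "\<dots> \<longleftrightarrow> (\<exists>t\<le>n. F t m \<noteq> {})" by (rule chain_iff_row_nonempty)
  finally show ?thesis using m by (auto simp: noncrossing_def)
qed

end

subsection \<open>Structures and walks of shapes\<close>

datatype move = Stay | Up nat | Down nat

fun move_shape :: "move \<Rightarrow> (nat \<Rightarrow> nat) \<Rightarrow> nat \<Rightarrow> nat" where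
  "move_shape Stay \<mu> = \<mu>"
| "move_shape (Up r) \<mu> = \<mu>(r := \<mu> r + 1)"
| "move_shape (Down r) \<mu> = \<mu>(r := \<mu> r - 1)"

definition is_shape :: "nat \<Rightarrow> (nat \<Rightarrow> nat) \<Rightarrow> bool" where
  "is_shape l \<mu> \<longleftrightarrow> (\<forall>r. \<mu> (Suc r) \<le> \<mu> r) \<and> \<mu> l = 0"

fun legal :: "nat \<Rightarrow> (nat \<Rightarrow> nat) \<Rightarrow> move \<Rightarrow> bool" where
  "legal l \<mu> Stay \<longleftrightarrow> True"
| "legal l \<mu> (Up r) \<longleftrightarrow> is_shape l (move_shape (Up r) \<mu>)"
| "legal l \<mu> (Down r) \<longleftrightarrow> 0 < \<mu> r \<and> is_shape l (move_shape (Down r) \<mu>)"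

text \<open>The flag forbids a first move \<open>Down 0\<close>: immediately after \<open>Up 0\<close> it would create an arc \<open>(i, i + 1)\<close>.\<close>

primrec walk :: "nat \<Rightarrow> bool \<Rightarrow> (nat \<Rightarrow> nat) \<Rightarrow> move list \<Rightarrow> bool" where
  "walk l f \<mu> [] \<longleftrightarrow> \<mu> = (\<lambda>_. 0)"
| "walk l f \<mu> (m # w) \<longleftrightarrow> legal l \<mu> m \<and> \<not> (f \<and> m = Down 0) \<and> walk l (m = Up 0) (move_shape m \<mu>) w"

definition shape_at :: "(nat \<Rightarrow> nat) \<Rightarrow> move list \<Rightarrow> nat \<Rightarrow> nat \<Rightarrow> nat" where
  "shape_at \<mu> w t = foldl (\<lambda>s m. move_shape m s) \<mu> (take t w)"

lemma shape_at_0 [simp]: "shape_at \<mu> w 0 = \<mu>"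
  by (simp add: shape_at_def)

lemma shape_at_Suc: "t < length w \<Longrightarrow> shape_at \<mu> w (Suc t) = move_shape (w ! t) (shape_at \<mu> w t)"
  by (simp add: shape_at_def take_Suc_conv_app_nth)

lemma shape_at_Cons: "shape_at \<mu> (m # w) (Suc t) = shape_at (move_shape m \<mu>) w t"
  by (simp add: shape_at_def)

lemma walk_iff:
  "walk l f \<mu> w \<longleftrightarrow> (\<forall>t<length w. legal l (shape_at \<mu> w t) (w ! t)) \<and> shape_at \<mu> w (length w) = (\<lambda>_. 0) \<and>
     (\<forall>t. Suc t < length w \<longrightarrow> \<not> (w ! t = Up 0 \<and> w ! Suc t = Down 0)) \<and> (f \<longrightarrow> w \<noteq> [] \<longrightarrow> w ! 0 \<noteq> Down 0)"
proof (induction w arbitrary: f \<mu>)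
  case (Cons m w)
  have 1: "(\<forall>t<length (m # w). legal l (shape_at \<mu> (m # w) t) ((m # w) ! t)) \<longleftrightarrow>
      legal l \<mu> m \<and> (\<forall>t<length w. legal l (shape_at (move_shape m \<mu>) w t) (w ! t))"
    by (auto simp: shape_at_Cons All_less_Suc2)
  have 2: "(\<forall>t. Suc t < length (m # w) \<longrightarrow> \<not> ((m # w) ! t = Up 0 \<and> (m # w) ! Suc t = Down 0)) \<longleftrightarrow>
     (m = Up 0 \<longrightarrow> w \<noteq> [] \<longrightarrow> w ! 0 \<noteq> Down 0) \<and> (\<forall>t. Suc t < length w \<longrightarrow> \<not> (w ! t = Up 0 \<and> w ! Suc t = Down 0))"
    (is "?L \<longleftrightarrow> ?R")
  proof
    assume L: ?L
    show ?R
    proof (intro conjI impI allI)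
      assume "m = Up 0" "w \<noteq> []" thus "w ! 0 \<noteq> Down 0" using L[rule_format, of 0] by simp
    next
      fix t assume "Suc t < length w" thus "\<not> (w ! t = Up 0 \<and> w ! Suc t = Down 0)" using L[rule_format, of "Suc t"] by simp
    qed
  next
    assume R: ?R
    show ?L
    proof (intro allI impI)
      fix t assume "Suc t < length (m # w)"
      thus "\<not> ((m # w) ! t = Up 0 \<and> (m # w) ! Suc t = Down 0)" using R by (cases t) auto
    qed
  qed
  show ?case unfolding 1 2 walk.simps Cons.IH by (auto simp: shape_at_Cons)
qed auto

fun tableau_step :: "nat \<Rightarrow> move \<Rightarrow> tableau \<Rightarrow> tableau" where
  "tableau_step t Stay T = T"
| "tableau_step t (Up r) T = T(r := insert t (T r))"
| "tableau_step t (Down r) T = row_delete T r"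

fun step_arcs :: "nat \<Rightarrow> move \<Rightarrow> tableau \<Rightarrow> arcs" where
  "step_arcs t Stay T = {}"
| "step_arcs t (Up r) T = {}"
| "step_arcs t (Down r) T = {(pop T r r, t)}"

primrec tableau_at :: "move list \<Rightarrow> nat \<Rightarrow> tableau" where
  "tableau_at w 0 = (\<lambda>_. {})"
| "tableau_at w (Suc t) = tableau_step (Suc t) (w ! t) (tableau_at w t)"

definition walk_arcs :: "move list \<Rightarrow> arcs" where
  "walk_arcs w = (\<Union>t<length w. step_arcs (Suc t) (w ! t) (tableau_at w t))"

lemma is_shape_beyond: "l \<le> r \<Longrightarrow> is_shape l \<mu> \<Longrightarrow> \<mu> r = 0"
proof (induction r rule: dec_induct)
  case (step r) thus ?case unfolding is_shape_def by (metis le_zero_eq)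
qed (simp add: is_shape_def)

lemma is_shape_0: "is_shape l (\<lambda>_. 0)"
  by (simp add: is_shape_def)

lemma legal_is_shape: "is_shape l \<mu> \<Longrightarrow> legal l \<mu> m \<Longrightarrow> is_shape l (move_shape m \<mu>)"
  by (cases m) auto

lemma legal_Down_corner: "legal l \<mu> (Down r) \<Longrightarrow> \<mu> (Suc r) < \<mu> r"
  by (auto simp: is_shape_def dest!: spec[of _ r])

lemma is_tableau_add_max:
  assumes T: "is_tableau T" and le: "\<And>z. z \<in> entries T \<Longrightarrow> z \<le> t"
    and sh: "\<And>j. ((shape T)(r := shape T r + 1)) (Suc j) \<le> ((shape T)(r := shape T r + 1)) j"
  shows "is_tableau (T(r := insert (Suc t) (T r)))" "shape (T(r := insert (Suc t) (T r))) = (shape T)(r := shape T r + 1)"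
proof -
  let ?T = "T(r := insert (Suc t) (T r))"
  have new: "Suc t \<notin> T j" for j using le[of "Suc t"] in_entries[of "Suc t" T j] by auto
  have fin: "finite (T j)" for j by (rule tableau_finite_row[OF T])
  show s: "shape ?T = (shape T)(r := shape T r + 1)"
    using new fin by (auto simp: shape_def fun_eq_iff)
  have ent: "entries ?T = insert (Suc t) (entries T)" by (auto simp: entries_def split: if_splits)
  have "card {z \<in> ?T (Suc j). z \<le> v} \<le> card {z \<in> ?T j. z \<le> v}" for j v
  proof (cases "v \<le> t")
    case True
    hence "{z \<in> ?T j. z \<le> v} = {z \<in> T j. z \<le> v}" for j by auto
    thus ?thesis using tableau_count[OF T] by simp
  next
    case False
    have "z \<le> v" if "z \<in> ?T j" for z j
    proof (cases "z = Suc t")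
      case True thus ?thesis using False by simp
    next
      case neq: False
      hence "z \<in> T j" using that by (auto split: if_splits)
      thus ?thesis using le[of z] False in_entries[of z T j] by auto
    qed
    hence "{z \<in> ?T j. z \<le> v} = ?T j" for j by blast
    hence "card {z \<in> ?T j. z \<le> v} = shape ?T j" for j by (simp add: shape_def)
    thus ?thesis using sh[of j] s by simp
  qed
  moreover have "?T i \<inter> ?T j = {}" if "i \<noteq> j" for i j
    using T new that by (auto simp: is_tableau_def)
  moreover have "finite (entries ?T)" using T by (simp add: ent is_tableau_def)
  ultimately show "is_tableau ?T" unfolding is_tableau_def by blast
qed

lemma walk_invariant:
  assumes "walk l f (\<lambda>_. 0) w" "t \<le> length w"
  shows "is_tableau (tableau_at w t) \<and> shape (tableau_at w t) = shape_at (\<lambda>_. 0) w t \<and>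
    entries (tableau_at w t) \<subseteq> {1..t} \<and> is_shape l (shape_at (\<lambda>_. 0) w t)"
  using assms(2)
proof (induction t)
  case 0
  show ?case by (simp add: is_tableau_empty shape_def entries_def is_shape_0)
next
  case (Suc t)
  let ?T = "tableau_at w t" and ?\<mu> = "shape_at (\<lambda>_. 0) w t"
  have IH: "is_tableau ?T" "shape ?T = ?\<mu>" "entries ?T \<subseteq> {1..t}" "is_shape l ?\<mu>" using Suc by auto
  have lt: "t < length w" using Suc.prems by simp
  have leg: "legal l ?\<mu> (w ! t)" using assms(1) lt unfolding walk_iff by blast
  have sh: "is_shape l (shape_at (\<lambda>_. 0) w (Suc t))"
    using legal_is_shape[OF IH(4) leg] by (simp add: shape_at_Suc[OF lt])
  have "is_tableau (tableau_at w (Suc t)) \<and> shape (tableau_at w (Suc t)) = move_shape (w ! t) ?\<mu> \<and>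
    entries (tableau_at w (Suc t)) \<subseteq> {1..Suc t}"
  proof (cases "w ! t")
    case Stay thus ?thesis using IH by auto
  next
    case (Up r)
    have "is_tableau (?T(r := insert (Suc t) (?T r)))" "shape (?T(r := insert (Suc t) (?T r))) = (shape ?T)(r := shape ?T r + 1)"
      by (rule is_tableau_add_max; use IH leg Up in \<open>auto simp: is_shape_def\<close>)+
    moreover have "entries (?T(r := insert (Suc t) (?T r))) \<subseteq> {1..Suc t}"
      using IH(3) by (fastforce simp: entries_def split: if_splits)
    ultimately show ?thesis using Up IH by simp
  next
    case (Down r)
    have corner: "shape ?T (Suc r) < shape ?T r" using legal_Down_corner leg Down IH by simp
    hence ne: "?T r \<noteq> {}" by (auto simp: shape_def)
    show ?thesis using is_tableau_row_delete[OF IH(1) corner] entries_row_delete[OF IH(1) ne] IH Down by auto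
  qed
  thus ?case using sh by (simp add: shape_at_Suc[OF lt])
qed

context
  fixes l f w
  assumes walk: "walk l f (\<lambda>_. 0) w"
begin

private abbreviation T where "T \<equiv> tableau_at w"
private abbreviation n where "n \<equiv> length w"

lemma walk_tableau: "t \<le> n \<Longrightarrow> is_tableau (T t)"
  and walk_shape: "t \<le> n \<Longrightarrow> shape (T t) = shape_at (\<lambda>_. 0) w t"
  and walk_entries: "t \<le> n \<Longrightarrow> entries (T t) \<subseteq> {1..t}"
  and walk_is_shape: "t \<le> n \<Longrightarrow> is_shape l (shape_at (\<lambda>_. 0) w t)"
  using walk_invariant[OF walk] by auto

lemma walk_legal: "t < n \<Longrightarrow> legal l (shape (T t)) (w ! t)"
  using walk walk_shape[of t] unfolding walk_iff by auto

lemma walk_Down_nonempty: "t < n \<Longrightarrow> w ! t = Down r \<Longrightarrow> T t r \<noteq> {}"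
  using walk_legal[of t] by (auto simp: shape_def)

lemma walk_pop_in:
  assumes "t < n" "w ! t = Down r" shows "pop (T t) r r \<in> T t 0"
  using pop_in(1)[OF walk_tableau walk_Down_nonempty, of t r r] assms by simp

lemma walk_entries_Down:
  assumes "t < n" "w ! t = Down r" shows "entries (T (Suc t)) = entries (T t) - {pop (T t) r r}"
  using entries_row_delete[OF walk_tableau walk_Down_nonempty, of t r] assms by simp

lemma walk_entries_mono: "t < n \<Longrightarrow> entries (T (Suc t)) \<subseteq> insert (Suc t) (entries (T t))"
proof (cases "w ! t")
  case (Up r) thus ?thesis by (auto simp: entries_def split: if_splits)
next
  case (Down r) thus "t < n \<Longrightarrow> ?thesis" using walk_entries_Down[of t r] by auto
qed auto

lemma walk_entries_gone:
  assumes "a \<le> b" "b \<le> n" "x \<notin> entries (T a)" "x \<le> a" shows "x \<notin> entries (T b)"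
  using assms(1,2)
proof (induction b rule: dec_induct)
  case (step b) thus ?case using walk_entries_mono[of b] assms(4) by auto
qed (use assms in auto)

lemma walk_arcs_iff: "(x, y) \<in> walk_arcs w \<longleftrightarrow> (\<exists>t r. y = Suc t \<and> t < n \<and> w ! t = Down r \<and> x = pop (T t) r r)"
proof -
  have "(x, y) \<in> step_arcs (Suc t) m U \<longleftrightarrow> (\<exists>r. y = Suc t \<and> m = Down r \<and> x = pop U r r)" for t m U
    by (cases m) auto
  thus ?thesis by (auto simp: walk_arcs_def)
qed

lemma walk_pop_range:
  assumes "t < n" "w ! t = Down r" shows "pop (T t) r r \<in> entries (T t)" "1 \<le> pop (T t) r r" "pop (T t) r r \<le> t"
proof -
  show e: "pop (T t) r r \<in> entries (T t)" using walk_pop_in[OF assms] by (rule in_entries)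
  show "1 \<le> pop (T t) r r" "pop (T t) r r \<le> t" using e walk_entries[of t] assms by auto
qed

lemma walk_arcs_matching: "partial_matching n (walk_arcs w)"
proof -
  have bounds: "1 \<le> x \<and> x < y \<and> y \<le> n" if "(x, y) \<in> walk_arcs w" for x y
    using that walk_pop_range unfolding walk_arcs_iff by fastforce
  have same_opener: False if ab: "a < b" "b < n" "w ! a = Down r" "w ! b = Down s"
    and eq: "pop (T a) r r = pop (T b) s s" for a b r s
  proof -
    have "pop (T a) r r \<notin> entries (T (Suc a))" using walk_entries_Down[of a r] ab by simp
    hence "pop (T a) r r \<notin> entries (T b)"
      using walk_entries_gone[of "Suc a" b] walk_pop_range[of a r] ab by auto
    thus False using walk_pop_range[of b s] ab eq by simp
  qed
  have opener_closer: False if xyz: "(x, y) \<in> walk_arcs w" "(z, x) \<in> walk_arcs w" for x y z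
  proof -
    obtain t r where t: "y = Suc t" "t < n" "w ! t = Down r" "x = pop (T t) r r" using xyz(1) walk_arcs_iff by blast
    obtain s q where s: "x = Suc s" "s < n" "w ! s = Down q" using xyz(2) walk_arcs_iff by blast
    have "Suc s \<notin> entries (T s)" using walk_entries[of s] s by auto
    hence "Suc s \<notin> entries (T (Suc s))" using walk_entries_Down[of s q] s by simp
    moreover have "Suc s \<le> t" using t s walk_pop_range[of t r] by simp
    ultimately have "x \<notin> entries (T t)" using walk_entries_gone[of "Suc s" t x] s t by simp
    thus False using walk_pop_range[of t r] t by simp
  qed
  have "e = e'" if ee: "e \<in> walk_arcs w" "e' \<in> walk_arcs w" "{fst e, snd e} \<inter> {fst e', snd e'} \<noteq> {}" for e e'
  proof -
    obtain x y x' y' where e: "e = (x, y)" "e' = (x', y')" by fastforce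
    obtain t r where t: "y = Suc t" "t < n" "w ! t = Down r" "x = pop (T t) r r" using ee(1) e walk_arcs_iff by blast
    obtain t' r' where t': "y' = Suc t'" "t' < n" "w ! t' = Down r'" "x' = pop (T t') r' r'" using ee(2) e walk_arcs_iff by blast
    consider "x = x'" | "x = y'" | "y = x'" | "y = y'" using ee(3) e by auto
    thus ?thesis
    proof cases
      case 1
      hence "\<not> t < t'" "\<not> t' < t" using same_opener[of t t' r r'] same_opener[of t' t r' r] t t' by auto
      hence "t = t'" by simp
      thus ?thesis using 1 e t(1) t'(1) by simp
    next
      case 2 thus ?thesis using opener_closer[of x y x'] ee e by simp
    next
      case 3 thus ?thesis using opener_closer[of x' y' x] ee e by simp
    next
      case 4
      hence "t = t'" using t(1) t'(1) by simp
      moreover from this have "r = r'" using t(3) t'(3) by simp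
      ultimately show ?thesis using 4 e t(4) t'(4) by simp
    qed
  qed
  thus ?thesis using bounds unfolding partial_matching_iff by fast
qed

lemma walk_end: "T n = (\<lambda>_. {})"
proof -
  have "shape (T n) = (\<lambda>_. 0)" using walk walk_shape[of n] unfolding walk_iff by simp
  thus ?thesis using tableau_finite_row[OF walk_tableau[of n]] by (auto simp: shape_def fun_eq_iff)
qed

lemma walk_history: "tableau_history n (walk_arcs w) T"
proof
  show "partial_matching n (walk_arcs w)" by (rule walk_arcs_matching)
  show "T n = (\<lambda>_. {})" by (rule walk_end)
  fix t assume t: "t < n"
  have new: "Suc t \<notin> T t j" for j using walk_entries[of t] t in_entries[of "Suc t" "T t" j] by auto
  show "T t = back_step (walk_arcs w) (Suc t) (T (Suc t))"
  proof (cases "w ! t")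
    case Stay
    hence "(x, Suc t) \<notin> walk_arcs w" for x by (simp add: walk_arcs_iff)
    thus ?thesis using Stay new by (simp add: back_step_def)
  next
    case (Up r)
    hence "(x, Suc t) \<notin> walk_arcs w" for x by (simp add: walk_arcs_iff)
    thus ?thesis using Up new by (auto simp: back_step_def fun_eq_iff)
  next
    case (Down r)
    hence iff: "(x, Suc t) \<in> walk_arcs w \<longleftrightarrow> x = pop (T t) r r" for x using t by (auto simp: walk_arcs_iff)
    show ?thesis unfolding back_step_def iff
      using row_insert_row_delete[OF walk_tableau walk_Down_nonempty, of t r] t Down by simp
  qed
qed

end

lemma history_unique:
  assumes "tableau_history n M F" "tableau_history n M G" "t \<le> n"
  shows "F t = G t"
  using assms(3)
proof (induction t rule: inc_induct)
  case base
  show ?case using tableau_history.F_end[OF assms(1)] tableau_history.F_end[OF assms(2)] by simp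
next
  case (step t)
  thus ?case using tableau_history.F_step[OF assms(1), of t] tableau_history.F_step[OF assms(2), of t] by simp
qed

lemma legal_move_unique:
  assumes "legal l \<mu> m" "legal l \<mu> m'" "move_shape m \<mu> = move_shape m' \<mu>"
  shows "m = m'"
proof -
  have "m = m'" if l: "legal l \<mu> m" "legal l \<mu> m'" "move_shape m \<mu> = move_shape m' \<mu>" and r: "m = Up r \<or> m = Down r" for m m' r
  proof -
    have ne: "move_shape m \<mu> r \<noteq> \<mu> r" using r l(1) by auto
    have "move_shape m' \<mu> r = move_shape m \<mu> r" using l by simp
    thus ?thesis using r ne l(1,2) by (cases m') (auto split: if_splits)
  qed
  note * = this
  show ?thesis using *[OF assms] *[OF assms(2,1) assms(3)[symmetric]] by (cases m; cases m') auto
qed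

lemma walk_arcs_in_rna:
  assumes "walk l f (\<lambda>_. 0) w"
  shows "walk_arcs w \<in> rna_structures (Suc l) (length w)"
proof -
  interpret tableau_history "length w" "walk_arcs w" "tableau_at w" by (rule walk_history[OF assms])
  have "tableau_at w t l = {}" if "t \<le> length w" for t
  proof -
    have "shape (tableau_at w t) l = 0"
      using walk_is_shape[OF assms that] walk_shape[OF assms that] by (simp add: is_shape_def)
    thus ?thesis using tableau_finite_row[OF walk_tableau[OF assms that]] by (simp add: shape_def)
  qed
  hence nc: "noncrossing (Suc l) (walk_arcs w)" using noncrossing_iff_rows[of "Suc l"] by simp
  have no1: "(i, i + 1) \<notin> walk_arcs w" if i1: "1 \<le> i" for i
  proof
    assume "(i, i + 1) \<in> walk_arcs w"
    then obtain r where r: "i < length w" "w ! i = Down r" "i = pop (tableau_at w i) r r"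
      unfolding walk_arcs_iff[OF assms] by auto
    obtain j where j: "i = Suc j" using i1 by (cases i) auto
    let ?T = "tableau_at w i"
    have T: "is_tableau ?T" "?T r \<noteq> {}"
      using walk_tableau[OF assms] walk_Down_nonempty[OF assms] r by auto
    have r0: "r = 0"
    proof (rule ccontr)
      assume "r \<noteq> 0"
      hence "i < pop ?T r 0" using pop_strict[OF T, of 0 r] r(3) by simp
      moreover have "pop ?T r 0 \<in> ?T r" using pop_in(1)[OF T, of 0] by simp
      hence "pop ?T r 0 \<le> i" using F_le[of i] r(1) by simp
      ultimately show False by simp
    qed
    have i0: "i \<in> ?T 0" using walk_pop_in[OF assms r(1,2)] r(3) by simp
    have old: "Suc j \<notin> entries (tableau_at w j)" using walk_entries[OF assms, of j] j r(1) by auto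
    have "w ! j = Up 0"
    proof (cases "w ! j")
      case Stay
      hence "?T = tableau_at w j" using j by simp
      thus ?thesis using i0 old j by (auto intro: in_entries)
    next
      case (Up q)
      hence "i \<in> ?T q" using j by simp
      hence "q = 0" using tableau_disjoint[OF T(1) i0] by simp
      thus ?thesis using Up by simp
    next
      case (Down q)
      hence "entries ?T \<subseteq> entries (tableau_at w j)" using walk_entries_Down[OF assms, of j q] j r(1) by auto
      thus ?thesis using i0 old j by (auto intro: in_entries)
    qed
    thus False using assms r r0 j unfolding walk_iff by blast
  qed
  show ?thesis using nc no1 matching by (simp add: rna_structures_def)
qed

lemma walk_arcs_inj:
  assumes w: "walk l f (\<lambda>_. 0) w" "walk l f (\<lambda>_. 0) w'" and len: "length w = length w'" and eq: "walk_arcs w = walk_arcs w'"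
  shows "w = w'"
proof (rule nth_equalityI[OF len])
  fix t assume t: "t < length w"
  have T: "tableau_at w s = tableau_at w' s" if "s \<le> length w" for s
    using history_unique[OF walk_history[OF w(1)]] walk_history[OF w(2)] len eq that by simp
  have sh: "move_shape (w ! t) (shape (tableau_at w t)) = shape (tableau_at w (Suc t))"
    if "walk l f (\<lambda>_. 0) w" "t < length w" for w
    using walk_shape[OF that(1), of t] walk_shape[OF that(1), of "Suc t"] shape_at_Suc[of t w] that(2) by simp
  show "w ! t = w' ! t"
    by (rule legal_move_unique[of l "shape (tableau_at w t)"])
      (use walk_legal[OF w(1), of t] walk_legal[OF w(2), of t] sh[OF w(1)] sh[OF w(2)] T[of t] T[of "Suc t"] t len in auto)
qed

primrec back_run :: "nat \<Rightarrow> arcs \<Rightarrow> nat \<Rightarrow> tableau" where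
  "back_run n M 0 = (\<lambda>_. {})"
| "back_run n M (Suc i) = back_step M (n - i) (back_run n M i)"

lemma back_run_history:
  assumes "partial_matching n M" shows "tableau_history n M (\<lambda>t. back_run n M (n - t))"
proof
  fix t assume "t < n"
  hence "n - t = Suc (n - Suc t)" "n - (n - Suc t) = Suc t" by auto
  thus "back_run n M (n - t) = back_step M (Suc t) (back_run n M (n - Suc t))" by simp
qed (use assms in auto)

lemma (in tableau_history) history_move:
  assumes rows: "\<And>t. t \<le> n \<Longrightarrow> F t l = {}" and t: "t < n"
  shows "\<exists>m. legal l (shape (F t)) m \<and> tableau_step (Suc t) m (F t) = F (Suc t) \<and>
    step_arcs (Suc t) m (F t) = {e \<in> M. snd e = Suc t} \<and> shape (F (Suc t)) = move_shape m (shape (F t))"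
proof -
  have sh: "is_shape l (shape (F s))" if "s \<le> n" for s
    using shape_antimono[OF F_tableau[OF that]] rows[OF that] by (auto simp: is_shape_def shape_def)
  have T: "is_tableau (F (Suc t))" using F_tableau t by simp
  consider x where "(x, Suc t) \<in> M" | "\<And>x. (x, Suc t) \<notin> M" "Suc t \<in> entries (F (Suc t))"
    | "\<And>x. (x, Suc t) \<notin> M" "Suc t \<notin> entries (F (Suc t))" by blast
  thus ?thesis
  proof cases
    case 1
    have nx: "x \<notin> entries (F (Suc t))" using F_entries[of "Suc t"] t arc_unique(2)[OF 1] by auto
    obtain r y where land: "bump (F (Suc t)) x r = Some y" "bump (F (Suc t)) x (Suc r) = None"
      using bump_lands[OF T nx] .
    note D = row_delete_row_insert[OF T nx land, folded F_closer[OF 1]]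
    have s: "shape (F t) = (shape (F (Suc t)))(r := shape (F (Suc t)) r + 1)"
      using row_insert_landing[OF T nx land] F_closer[OF 1] by simp
    hence s': "shape (F (Suc t)) = move_shape (Down r) (shape (F t))" by (auto simp: fun_eq_iff)
    have "{e \<in> M. snd e = Suc t} = {(x, Suc t)}"
    proof (intro set_eqI iffI)
      fix e assume e: "e \<in> {e \<in> M. snd e = Suc t}"
      obtain y z where "e = (y, z)" by fastforce
      thus "e \<in> {(x, Suc t)}" using e arc_unique(1)[OF 1, of y] by auto
    qed (use 1 in simp)
    moreover have "0 < shape (F t) r" unfolding s by simp
    hence "legal l (shape (F t)) (Down r)" using sh[of "Suc t"] t unfolding s' by simp
    ultimately show ?thesis using D s' by (intro exI[of _ "Down r"]) (simp del: move_shape.simps)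
  next
    case 2
    note F = F_no_closer[OF t 2(1)]
    obtain r where r: "Suc t \<in> F (Suc t) r" using 2(2) by (auto simp: entries_def)
    have "Suc t \<notin> F (Suc t) j" if "j \<noteq> r" for j using tableau_disjoint[OF T r, of j] that by auto
    hence step: "tableau_step (Suc t) (Up r) (F t) = F (Suc t)" using r F by (auto simp: fun_eq_iff)
    have fin: "finite (F t r)" using tableau_finite_row[OF F_tableau] t by simp
    have new: "Suc t \<notin> F t r" using F by simp
    have "shape (tableau_step (Suc t) (Up r) (F t)) = move_shape (Up r) (shape (F t))"
      using new fin by (auto simp: shape_def fun_eq_iff)
    hence s: "shape (F (Suc t)) = move_shape (Up r) (shape (F t))" unfolding step .
    hence "legal l (shape (F t)) (Up r)" using sh[of "Suc t"] t by simp
    moreover have "{e \<in> M. snd e = Suc t} = {}" using 2(1) by auto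
    ultimately show ?thesis using s step by (intro exI[of _ "Up r"]) (simp del: move_shape.simps tableau_step.simps)
  next
    case 3
    have "F t = F (Suc t)" using F_no_closer[OF t 3(1)] 3(2) by (auto simp: fun_eq_iff entries_def)
    moreover have "{e \<in> M. snd e = Suc t} = {}" using 3(1) by auto
    ultimately show ?thesis by (intro exI[of _ Stay]) simp
  qed
qed

lemma walk_arcs_surj:
  assumes M: "M \<in> rna_structures (Suc l) n"
  obtains w where "length w = n" "walk l False (\<lambda>_. 0) w" "walk_arcs w = M"
proof -
  define F where "F = (\<lambda>t. back_run n M (n - t))"
  have pm: "partial_matching n M" and nc: "noncrossing (Suc l) M"
    and no1: "\<And>i. 1 \<le> i \<Longrightarrow> i + 1 \<le> n \<Longrightarrow> (i, i + 1) \<notin> M" using M by (auto simp: rna_structures_def)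
  interpret tableau_history n M F unfolding F_def by (rule back_run_history[OF pm])
  have rows: "F t l = {}" if "t \<le> n" for t using nc noncrossing_iff_rows[of "Suc l"] that by simp
  define mv where "mv t = (SOME m. legal l (shape (F t)) m \<and> tableau_step (Suc t) m (F t) = F (Suc t) \<and>
    step_arcs (Suc t) m (F t) = {e \<in> M. snd e = Suc t} \<and> shape (F (Suc t)) = move_shape m (shape (F t)))" for t
  have mv: "legal l (shape (F t)) (mv t)" "tableau_step (Suc t) (mv t) (F t) = F (Suc t)"
    "step_arcs (Suc t) (mv t) (F t) = {e \<in> M. snd e = Suc t}" "shape (F (Suc t)) = move_shape (mv t) (shape (F t))"
    if "t < n" for t
    using someI_ex[OF history_move[OF rows that]] unfolding mv_def by blast+
  define w where "w = map mv [0..<n]"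
  have len: "length w = n" and nth: "t < n \<Longrightarrow> w ! t = mv t" for t by (simp_all add: w_def)
  have T: "t \<le> n \<Longrightarrow> tableau_at w t = F t" for t
    by (induction t) (simp_all add: F_start nth mv(2))
  have S: "t \<le> n \<Longrightarrow> shape_at (\<lambda>_. 0) w t = shape (F t)" for t
  proof (induction t)
    case 0 show ?case by (simp add: F_start shape_def)
  next
    case (Suc t) thus ?case using shape_at_Suc[of t w] len nth[of t] mv(4)[of t] by simp
  qed
  have arcs: "walk_arcs w = M"
  proof -
    have "walk_arcs w = (\<Union>t<n. {e \<in> M. snd e = Suc t})"
      unfolding walk_arcs_def len using T nth mv(3) by simp
    also have "\<dots> = M"
    proof
      show "M \<subseteq> (\<Union>t<n. {e \<in> M. snd e = Suc t})"
      proof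
        fix e assume e: "e \<in> M"
        obtain x y where xy: "e = (x, y)" by fastforce
        have "1 \<le> x" "x < y" "y \<le> n" using arc_bounds e xy by auto
        thus "e \<in> (\<Union>t<n. {e \<in> M. snd e = Suc t})" using e xy by (auto intro!: bexI[of _ "y - 1"])
      qed
    qed auto
    finally show ?thesis .
  qed
  have "walk l False (\<lambda>_. 0) w"
    unfolding walk_iff len
  proof (intro conjI allI impI)
    show "legal l (shape_at (\<lambda>_. 0) w t) (w ! t)" if "t < n" for t using mv(1)[OF that] S[of t] nth that by simp
    show "shape_at (\<lambda>_. 0) w n = (\<lambda>_. 0)" using S[of n] by (simp add: F_end shape_def fun_eq_iff)
    show "\<not> (w ! t = Up 0 \<and> w ! Suc t = Down 0)" if t: "Suc t < n" for t
    proof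
      assume a: "w ! t = Up 0 \<and> w ! Suc t = Down 0"
      have "F (Suc t) = tableau_step (Suc t) (Up 0) (F t)" using mv(2)[of t] a t nth by simp
      hence "Suc t \<in> F (Suc t) 0" by simp
      hence "Max (F (Suc t) 0) = Suc t"
        using F_le[of "Suc t"] t tableau_finite_row[OF F_tableau, of "Suc t"] by (intro Max_eqI) auto
      hence "(Suc t, Suc (Suc t)) \<in> M" using mv(3)[OF t] a nth[OF t] by auto
      thus False using no1[of "Suc t"] t by simp
    qed
  qed auto
  thus ?thesis using that len arcs by blast
qed

theorem walk_arcs_bij:
  "bij_betw walk_arcs {w. length w = n \<and> walk l False (\<lambda>_. 0) w} (rna_structures (Suc l) n)"
proof (rule bij_betwI')
  fix w w' assume "w \<in> {w. length w = n \<and> walk l False (\<lambda>_. 0) w}" "w' \<in> {w. length w = n \<and> walk l False (\<lambda>_. 0) w}"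
  thus "(walk_arcs w = walk_arcs w') = (w = w')" using walk_arcs_inj[of l False w w'] by auto
next
  fix w assume "w \<in> {w. length w = n \<and> walk l False (\<lambda>_. 0) w}"
  thus "walk_arcs w \<in> rna_structures (Suc l) n" using walk_arcs_in_rna[of l False w] by auto
next
  fix M assume "M \<in> rna_structures (Suc l) n"
  thus "\<exists>w\<in>{w. length w = n \<and> walk l False (\<lambda>_. 0) w}. M = walk_arcs w"
    by (rule walk_arcs_surj) blast
qed

subsection \<open>Counting and unranking walks\<close>

fun walk_count :: "nat \<Rightarrow> nat \<Rightarrow> (nat \<Rightarrow> nat) \<Rightarrow> nat" where
  "walk_count l 0 \<mu> = 0"
| "walk_count l (Suc 0) \<mu> = (if \<mu> = (\<lambda>_. 0) then 1 else 0)"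
| "walk_count l (Suc (Suc j)) \<mu> = (if is_shape l \<mu> then
     walk_count l (Suc j) \<mu> + (\<Sum>r<l. walk_count l (Suc j) (move_shape (Up r) \<mu>) +
       (if 0 < \<mu> r then walk_count l (Suc j) (move_shape (Down r) \<mu>) else 0)) - walk_count l j \<mu> else 0)"

definition down_count :: "nat \<Rightarrow> nat \<Rightarrow> (nat \<Rightarrow> nat) \<Rightarrow> nat \<Rightarrow> nat" where
  "down_count l j \<mu> r = (if 0 < \<mu> r then walk_count l j (move_shape (Down r) \<mu>) else 0)"

text \<open>\<open>Down 0\<close> comes last, so that forbidding it only shortens the range of ranks.\<close>

definition choices :: "nat \<Rightarrow> nat \<Rightarrow> (nat \<Rightarrow> nat) \<Rightarrow> (move \<times> nat) list" where
  "choices l j \<mu> = (Stay, walk_count l j \<mu>) # (Up 0, walk_count l j (move_shape (Up 0) \<mu>) - walk_count l (j - 1) \<mu>) #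
     map (\<lambda>r. (Up r, walk_count l j (move_shape (Up r) \<mu>))) [1..<l] @ map (\<lambda>r. (Down r, down_count l j \<mu> r)) [1..<l]"

definition all_choices :: "nat \<Rightarrow> bool \<Rightarrow> nat \<Rightarrow> (nat \<Rightarrow> nat) \<Rightarrow> (move \<times> nat) list" where
  "all_choices l f j \<mu> = choices l j \<mu> @ (if f then [] else [(Down 0, down_count l j \<mu> 0)])"

fun select :: "(move \<times> nat) list \<Rightarrow> nat \<Rightarrow> move \<times> nat" where
  "select [] u = (Stay, u)"
| "select ((m, c) # cs) u = (if u < c then (m, u) else select cs (u - c))"

primrec unrank :: "nat \<Rightarrow> nat \<Rightarrow> (nat \<Rightarrow> nat) \<Rightarrow> nat \<Rightarrow> move list" where
  "unrank l 0 \<mu> u = []"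
| "unrank l (Suc m) \<mu> u = (let (mv, v) = select (all_choices l False (Suc m) \<mu>) u in mv # unrank l m (move_shape mv \<mu>) v)"

definition walk_number :: "nat \<Rightarrow> bool \<Rightarrow> nat \<Rightarrow> (nat \<Rightarrow> nat) \<Rightarrow> nat" where
  "walk_number l f m \<mu> = (case m of 0 \<Rightarrow> walk_count l 1 \<mu> | Suc j \<Rightarrow> sum_list (map snd (all_choices l f (Suc j) \<mu>)))"

lemma select_append: "u < sum_list (map snd a) \<Longrightarrow> select (a @ b) u = select a u"
  by (induction a u rule: select.induct) auto

lemma select_in:
  "u < sum_list (map snd cs) \<Longrightarrow> select cs u = (m, v) \<Longrightarrow> \<exists>c. (m, c) \<in> set cs \<and> v < c"
proof (induction cs u rule: select.induct)
  case (2 m' c cs u)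
  show ?case
  proof (cases "u < c")
    case True thus ?thesis using 2 by auto
  next
    case False
    hence "u - c < sum_list (map snd cs)" "select cs (u - c) = (m, v)" using 2 by auto
    thus ?thesis using 2(1)[OF False] by auto
  qed
qed simp

lemma select_le: "select cs u = (m, v) \<Longrightarrow> v \<le> u"
proof (induction cs u rule: select.induct)
  case (2 m' c cs u) thus ?case by (cases "u < c") auto
qed simp

lemma select_ex1:
  "distinct (map fst cs) \<Longrightarrow> (m, c) \<in> set cs \<Longrightarrow> v < c \<Longrightarrow> \<exists>!u. u < sum_list (map snd cs) \<and> select cs u = (m, v)"
proof (induction cs)
  case (Cons a cs)
  obtain m0 c0 where a: "a = (m0, c0)" by fastforce
  show ?case
  proof (cases "m = m0")
    case True
    hence c: "c = c0" using Cons.prems a by (force simp: image_iff)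
    show ?thesis
    proof (rule ex1I[of _ v])
      show "v < sum_list (map snd (a # cs)) \<and> select (a # cs) v = (m, v)" using a c True Cons.prems by simp
      fix u assume u: "u < sum_list (map snd (a # cs)) \<and> select (a # cs) u = (m, v)"
      show "u = v"
      proof (cases "u < c0")
        case True thus ?thesis using u a by simp
      next
        case False
        hence "select cs (u - c0) = (m, v)" "u - c0 < sum_list (map snd cs)" using u a by auto
        then obtain c' where "(m, c') \<in> set cs" using select_in by blast
        thus ?thesis using True Cons.prems(1) a by (force simp: image_iff)
      qed
    qed
  next
    case False
    hence "(m, c) \<in> set cs" using Cons.prems a by auto
    then obtain u where u: "u < sum_list (map snd cs)" "select cs u = (m, v)"
      and uniq: "\<And>u'. u' < sum_list (map snd cs) \<Longrightarrow> select cs u' = (m, v) \<Longrightarrow> u' = u"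
      using Cons.IH Cons.prems by (metis distinct.simps(2) list.simps(9))
    show ?thesis
    proof (rule ex1I[of _ "c0 + u"])
      show "c0 + u < sum_list (map snd (a # cs)) \<and> select (a # cs) (c0 + u) = (m, v)" using u a by simp
      fix u' assume u': "u' < sum_list (map snd (a # cs)) \<and> select (a # cs) u' = (m, v)"
      hence "\<not> u' < c0" using False a by auto
      hence "u' - c0 = u" using u' a by (intro uniq) auto
      thus "u' = c0 + u" using \<open>\<not> u' < c0\<close> by simp
    qed
  qed
qed simp

lemma walk_count_not_shape: "\<not> is_shape l \<mu> \<Longrightarrow> walk_count l j \<mu> = 0"
  using is_shape_0 by (induction l j \<mu> rule: walk_count.induct) auto

lemma is_shape_Up_0: "is_shape l \<mu> \<Longrightarrow> 1 \<le> l \<Longrightarrow> is_shape l (move_shape (Up 0) \<mu>)"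
  by (auto simp: is_shape_def le_SucI)

lemma Down_Up: "move_shape (Down r) (move_shape (Up r) \<mu>) = \<mu>"
  by (auto simp: fun_eq_iff)

lemma walk_count_le_Up_0:
  assumes "1 \<le> l"
  shows "is_shape l \<mu> \<Longrightarrow> walk_count l m \<mu> \<le> walk_count l (Suc m) (move_shape (Up 0) \<mu>)"
proof (induction m arbitrary: \<mu>)
  case (Suc m)
  let ?\<nu> = "move_shape (Up 0) \<mu>"
  let ?g = "\<lambda>r. walk_count l (Suc m) (move_shape (Up r) ?\<nu>) + (if 0 < ?\<nu> r then walk_count l (Suc m) (move_shape (Down r) ?\<nu>) else 0)"
  have sh: "is_shape l ?\<nu>" using is_shape_Up_0[OF Suc.prems assms] .
  have "walk_count l m ?\<nu> \<le> walk_count l (Suc m) (move_shape (Up 0) ?\<nu>)" using Suc.IH[OF sh] .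
  hence "walk_count l m ?\<nu> + walk_count l (Suc m) \<mu> \<le> ?g 0" using Down_Up[of 0 \<mu>] by simp
  also have "?g 0 \<le> (\<Sum>r<l. ?g r)" using assms by (intro member_le_sum) auto
  finally have "walk_count l m ?\<nu> + walk_count l (Suc m) \<mu> \<le> (\<Sum>r<l. ?g r)" .
  moreover have "walk_count l (Suc (Suc m)) ?\<nu> = walk_count l (Suc m) ?\<nu> + (\<Sum>r<l. ?g r) - walk_count l m ?\<nu>"
    using sh by (simp only: walk_count.simps if_True)
  ultimately show ?case by linarith
qed simp

lemma sum_lessThan_split_0: "1 \<le> (l::nat) \<Longrightarrow> (\<Sum>r<l. f r) = f 0 + (\<Sum>r=1..<l. f r :: nat)"
  using sum.atLeast_Suc_lessThan[of 0 l f] by (simp add: atLeast0LessThan)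

lemma walk_number_mono: "walk_number l f (Suc j) \<mu> \<le> sum_list (map snd (all_choices l False (Suc j) \<mu>))"
  by (auto simp: walk_number_def all_choices_def)

lemma walk_number_False:
  assumes "1 \<le> l" "is_shape l \<mu>"
  shows "walk_number l False m \<mu> = walk_count l (Suc m) \<mu>"
proof (cases m)
  case 0 thus ?thesis by (simp add: walk_number_def)
next
  case (Suc j)
  have le: "walk_count l j \<mu> \<le> walk_count l (Suc j) (move_shape (Up 0) \<mu>)"
    using walk_count_le_Up_0[OF assms] .
  have s: "sum_list (map h [Suc 0..<l]) = (\<Sum>r=Suc 0..<l. h r)" for h :: "nat \<Rightarrow> nat"
    by (simp add: interv_sum_list_conv_sum_set_nat)
  have "walk_count l (Suc (Suc j)) \<mu> = walk_count l (Suc j) \<mu> +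
    (\<Sum>r<l. walk_count l (Suc j) (move_shape (Up r) \<mu>) + down_count l (Suc j) \<mu> r) - walk_count l j \<mu>"
    using assms(2) by (simp add: down_count_def)
  also have "\<dots> = sum_list (map snd (all_choices l False (Suc j) \<mu>))"
    using le unfolding sum_lessThan_split_0[OF assms(1)]
    by (simp add: all_choices_def choices_def s comp_def sum.distrib del: move_shape.simps)
  finally show ?thesis using Suc by (simp add: walk_number_def)
qed

lemma walk_number_True:
  assumes "1 \<le> l" "is_shape l \<mu>"
  shows "walk_number l True m \<mu> = walk_count l (Suc m) \<mu> - down_count l m \<mu> 0"
proof (cases m)
  case 0 thus ?thesis by (simp add: walk_number_def down_count_def)
next
  case (Suc j)
  have "walk_number l False m \<mu> = walk_number l True m \<mu> + down_count l m \<mu> 0"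
    using Suc by (simp add: walk_number_def all_choices_def)
  thus ?thesis using walk_number_False[OF assms, of m] by simp
qed

lemma choice_count:
  assumes l: "1 \<le> l" "is_shape l \<mu>" and mem: "(m, c) \<in> set (all_choices l f (Suc j) \<mu>)" and pos: "0 < c"
  shows "legal l \<mu> m" "\<not> (f \<and> m = Down 0)" "c = walk_number l (m = Up 0) j (move_shape m \<mu>)"
proof -
  consider "m = Stay" "c = walk_count l (Suc j) \<mu>"
    | "m = Up 0" "c = walk_count l (Suc j) (move_shape (Up 0) \<mu>) - walk_count l j \<mu>"
    | r where "m = Up r" "r \<noteq> 0" "c = walk_count l (Suc j) (move_shape (Up r) \<mu>)"
    | r where "m = Down r" "c = down_count l (Suc j) \<mu> r" "r = 0 \<longrightarrow> \<not> f"
    using mem by (auto simp: all_choices_def choices_def simp del: move_shape.simps split: if_splits)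
  hence "legal l \<mu> m \<and> \<not> (f \<and> m = Down 0) \<and> c = walk_number l (m = Up 0) j (move_shape m \<mu>)"
  proof cases
    case 1 thus ?thesis using walk_number_False[OF l] by simp
  next
    case 2
    have sh: "is_shape l (move_shape (Up 0) \<mu>)" using is_shape_Up_0[OF l(2,1)] .
    have "down_count l j (move_shape (Up 0) \<mu>) 0 = walk_count l j \<mu>"
      unfolding down_count_def Down_Up by simp
    thus ?thesis using 2 sh walk_number_True[OF l(1) sh, of j] by (simp del: move_shape.simps)
  next
    case 3
    hence sh: "is_shape l (move_shape (Up r) \<mu>)" using pos walk_count_not_shape by (metis less_irrefl)
    show ?thesis using 3 sh walk_number_False[OF l(1) sh, of j] by (simp del: move_shape.simps)
  next
    case 4
    hence r: "0 < \<mu> r" "c = walk_count l (Suc j) (move_shape (Down r) \<mu>)"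
      using pos by (auto simp: down_count_def simp del: move_shape.simps split: if_splits)
    hence sh: "is_shape l (move_shape (Down r) \<mu>)" using pos walk_count_not_shape by (metis less_irrefl)
    show ?thesis using 4 r sh walk_number_False[OF l(1) sh, of j] by (auto simp del: move_shape.simps)
  qed
  thus "legal l \<mu> m" "\<not> (f \<and> m = Down 0)" "c = walk_number l (m = Up 0) j (move_shape m \<mu>)" by auto
qed

lemma legal_Up_bound: "legal l \<mu> (Up r) \<Longrightarrow> r < l"
  using is_shape_beyond[of l r "move_shape (Up r) \<mu>"] by (cases "l \<le> r") auto

lemma legal_Down_bound: "is_shape l \<mu> \<Longrightarrow> legal l \<mu> (Down r) \<Longrightarrow> r < l"
  using is_shape_beyond[of l r \<mu>] by (cases "l \<le> r") auto

lemma legal_choice: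
  assumes l: "1 \<le> l" "is_shape l \<mu>" and leg: "legal l \<mu> m" "\<not> (f \<and> m = Down 0)"
  shows "(m, walk_number l (m = Up 0) j (move_shape m \<mu>)) \<in> set (all_choices l f (Suc j) \<mu>)"
proof (cases m)
  case Stay thus ?thesis using walk_number_False[OF l] by (simp add: all_choices_def choices_def)
next
  case (Up r)
  have sh: "is_shape l (move_shape (Up r) \<mu>)" using leg Up by simp
  have r: "r < l" using legal_Up_bound leg Up by blast
  show ?thesis
  proof (cases "r = 0")
    case True
    have "down_count l j (move_shape (Up 0) \<mu>) 0 = walk_count l j \<mu>"
      unfolding down_count_def Down_Up by simp
    thus ?thesis using Up True walk_number_True[OF l(1) sh, of j]
      by (simp add: all_choices_def choices_def del: move_shape.simps)
  next
    case False
    thus ?thesis using Up r walk_number_False[OF l(1) sh, of j]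
      by (auto simp: all_choices_def choices_def image_iff simp del: move_shape.simps)
  qed
next
  case (Down r)
  have sh: "is_shape l (move_shape (Down r) \<mu>)" and pos: "0 < \<mu> r" using leg Down by auto
  have r: "r < l" using legal_Down_bound[OF l(2)] leg Down by blast
  have "down_count l (Suc j) \<mu> r = walk_number l False j (move_shape (Down r) \<mu>)"
    using pos walk_number_False[OF l(1) sh, of j] by (simp add: down_count_def del: move_shape.simps)
  thus ?thesis using Down r leg(2)
    by (cases "r = 0") (auto simp: all_choices_def choices_def image_iff simp del: move_shape.simps)
qed

lemma distinct_choices: "distinct (map fst (all_choices l f j \<mu>))"
  by (auto simp: all_choices_def choices_def distinct_map comp_def inj_on_def)

lemma select_all_choices:
  "u < sum_list (map snd (all_choices l f j \<mu>)) \<Longrightarrow> select (all_choices l False j \<mu>) u = select (all_choices l f j \<mu>) u"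
  by (auto simp: all_choices_def select_append)

lemma unrank_walk:
  assumes "1 \<le> l"
  shows "is_shape l \<mu> \<Longrightarrow> u < walk_number l f m \<mu> \<Longrightarrow> length (unrank l m \<mu> u) = m \<and> walk l f \<mu> (unrank l m \<mu> u)"
proof (induction m arbitrary: \<mu> u f)
  case 0
  thus ?case by (auto simp: walk_number_def split: if_splits)
next
  case (Suc m)
  have u: "u < sum_list (map snd (all_choices l f (Suc m) \<mu>))" using Suc.prems by (simp add: walk_number_def)
  obtain mv v where mv: "select (all_choices l f (Suc m) \<mu>) u = (mv, v)" by fastforce
  obtain c where c: "(mv, c) \<in> set (all_choices l f (Suc m) \<mu>)" "v < c" using select_in[OF u mv] by blast
  note C = choice_count[OF assms Suc.prems(1) c(1)]
  have leg: "legal l \<mu> mv" "\<not> (f \<and> mv = Down 0)" "v < walk_number l (mv = Up 0) m (move_shape mv \<mu>)" using C c by auto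
  have "select (all_choices l False (Suc m) \<mu>) u = (mv, v)" using select_all_choices[OF u] mv by simp
  hence "unrank l (Suc m) \<mu> u = mv # unrank l m (move_shape mv \<mu>) v" by simp
  thus ?case using leg Suc.IH[OF legal_is_shape[OF Suc.prems(1) leg(1)] leg(3)] by simp
qed

lemma unrank_ex1:
  assumes "1 \<le> l"
  shows "is_shape l \<mu> \<Longrightarrow> walk l f \<mu> w \<Longrightarrow> length w = m \<Longrightarrow> \<exists>!u. u < walk_number l f m \<mu> \<and> unrank l m \<mu> u = w"
proof (induction m arbitrary: \<mu> f w)
  case 0
  thus ?case by (auto simp: walk_number_def)
next
  case (Suc m)
  obtain mv w' where w: "w = mv # w'" "length w' = m" using Suc.prems(3) by (cases w) auto
  have leg: "legal l \<mu> mv" "\<not> (f \<and> mv = Down 0)" "walk l (mv = Up 0) (move_shape mv \<mu>) w'" using Suc.prems w by auto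
  obtain v where v: "v < walk_number l (mv = Up 0) m (move_shape mv \<mu>)" "unrank l m (move_shape mv \<mu>) v = w'"
    and v_uniq: "\<And>v'. v' < walk_number l (mv = Up 0) m (move_shape mv \<mu>) \<Longrightarrow> unrank l m (move_shape mv \<mu>) v' = w' \<Longrightarrow> v' = v"
    using Suc.IH[OF legal_is_shape[OF Suc.prems(1) leg(1)] leg(3) w(2)] by blast
  let ?cs = "all_choices l f (Suc m) \<mu>"
  have mem: "(mv, walk_number l (mv = Up 0) m (move_shape mv \<mu>)) \<in> set ?cs"
    using legal_choice[OF assms Suc.prems(1) leg(1,2)] .
  obtain u where u: "u < sum_list (map snd ?cs)" "select ?cs u = (mv, v)"
    and u_uniq: "\<And>u'. u' < sum_list (map snd ?cs) \<Longrightarrow> select ?cs u' = (mv, v) \<Longrightarrow> u' = u"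
    using select_ex1[OF distinct_choices mem v(1)] by blast
  have num: "walk_number l f (Suc m) \<mu> = sum_list (map snd ?cs)" by (simp add: walk_number_def)
  show ?case
  proof (rule ex1I[of _ u])
    show "u < walk_number l f (Suc m) \<mu> \<and> unrank l (Suc m) \<mu> u = w"
      using u v w num select_all_choices[OF u(1)] by simp
    fix u' assume u': "u' < walk_number l f (Suc m) \<mu> \<and> unrank l (Suc m) \<mu> u' = w"
    obtain mv' v' where s: "select ?cs u' = (mv', v')" by fastforce
    have lt: "u' < sum_list (map snd ?cs)" using u' num by simp
    have "unrank l (Suc m) \<mu> u' = mv' # unrank l m (move_shape mv' \<mu>) v'"
      using s select_all_choices[OF lt] by simp
    hence e: "mv' = mv" "unrank l m (move_shape mv \<mu>) v' = w'" using u' w by auto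
    obtain c where c: "(mv', c) \<in> set ?cs" "v' < c" using select_in[OF lt s] by blast
    have "v' < walk_number l (mv = Up 0) m (move_shape mv \<mu>)"
      using choice_count[OF assms Suc.prems(1) c(1)] c(2) e by auto
    hence "v' = v" using v_uniq e by blast
    thus "u' = u" using u_uniq lt s e by blast
  qed
qed

theorem unrank_bij:
  assumes "1 \<le> l"
  shows "bij_betw (unrank l n (\<lambda>_. 0)) {..<walk_count l (Suc n) (\<lambda>_. 0)} {w. length w = n \<and> walk l False (\<lambda>_. 0) w}"
proof -
  let ?\<mu> = "\<lambda>_::nat. 0::nat"
  have num: "walk_number l False n ?\<mu> = walk_count l (Suc n) ?\<mu>" using walk_number_False[OF assms is_shape_0] .
  show ?thesis
  proof (rule bij_betwI')
    fix u v assume uv: "u \<in> {..<walk_count l (Suc n) ?\<mu>}" "v \<in> {..<walk_count l (Suc n) ?\<mu>}"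
    have "length (unrank l n ?\<mu> u) = n \<and> walk l False ?\<mu> (unrank l n ?\<mu> u)"
      using unrank_walk[OF assms is_shape_0, of u False n] uv num by simp
    from unrank_ex1[OF assms is_shape_0 this[THEN conjunct2] this[THEN conjunct1]]
    show "(unrank l n ?\<mu> u = unrank l n ?\<mu> v) = (u = v)" using uv num by (metis lessThan_iff)
  next
    fix u assume "u \<in> {..<walk_count l (Suc n) ?\<mu>}"
    thus "unrank l n ?\<mu> u \<in> {w. length w = n \<and> walk l False ?\<mu> w}"
      using unrank_walk[OF assms is_shape_0, of u False n] num by simp
  next
    fix w assume "w \<in> {w. length w = n \<and> walk l False ?\<mu> w}"
    hence "\<exists>!u. u < walk_number l False n ?\<mu> \<and> unrank l n ?\<mu> u = w"
      using unrank_ex1[OF assms is_shape_0, of False w n] by simp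
    thus "\<exists>u\<in>{..<walk_count l (Suc n) ?\<mu>}. w = unrank l n ?\<mu> u" unfolding num by blast
  qed
qed

lemma unrank_step:
  assumes "1 \<le> l" "is_shape l \<mu>" "u < walk_number l f (Suc m) \<mu>" "select (all_choices l False (Suc m) \<mu>) u = (mv, v)"
  shows "legal l \<mu> mv" "v < walk_number l (mv = Up 0) m (move_shape mv \<mu>)"
proof -
  have u: "u < sum_list (map snd (all_choices l f (Suc m) \<mu>))" using assms(3) by (simp add: walk_number_def)
  have mv: "select (all_choices l f (Suc m) \<mu>) u = (mv, v)" using select_all_choices[OF u] assms(4) by simp
  obtain c where c: "(mv, c) \<in> set (all_choices l f (Suc m) \<mu>)" "v < c" using select_in[OF u mv] by blast
  show "legal l \<mu> mv" "v < walk_number l (mv = Up 0) m (move_shape mv \<mu>)"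
    using choice_count[OF assms(1,2) c(1)] c(2) by auto
qed

subsection \<open>Shapes as numbers\<close>

definition digit :: "nat \<Rightarrow> nat \<Rightarrow> nat \<Rightarrow> nat" where
  "digit B p r = p div B ^ r mod B"

definition encode :: "nat \<Rightarrow> nat \<Rightarrow> (nat \<Rightarrow> nat) \<Rightarrow> nat" where
  "encode B l d = (\<Sum>r<l. d r * B ^ r)"

definition valid_code :: "nat \<Rightarrow> nat \<Rightarrow> nat \<Rightarrow> bool" where
  "valid_code B l p \<longleftrightarrow> p < B ^ l \<and> (\<forall>r<l. 0 < digit B p r) \<and> (\<forall>r. Suc r < l \<longrightarrow> digit B p (Suc r) \<le> digit B p r)"

lemma encode_less: "(\<And>r. r < l \<Longrightarrow> d r < B) \<Longrightarrow> encode B l d < B ^ l"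
proof (induction l)
  case (Suc l)
  have "encode B l d < B ^ l" using Suc by simp
  moreover have "(d l + 1) * B ^ l \<le> B * B ^ l" using Suc.prems[of l] by (intro mult_right_mono) auto
  ultimately show ?case by (simp add: encode_def algebra_simps)
qed (simp add: encode_def)

lemma digit_encode: "(\<And>r. r < l \<Longrightarrow> d r < B) \<Longrightarrow> r < l \<Longrightarrow> digit B (encode B l d) r = d r"
proof (induction l)
  case (Suc l)
  have less: "encode B l d < B ^ l" using encode_less[of l d B] Suc.prems by simp
  have e: "encode B (Suc l) d = encode B l d + d l * B ^ l" by (simp add: encode_def)
  have B: "0 < B" using Suc.prems(1)[of l] by simp
  show ?case
  proof (cases "r = l")
    case True
    have "(encode B l d + d l * B ^ l) div B ^ l = d l" using less B by simp
    thus ?thesis using True Suc.prems(1)[of l] by (simp add: digit_def e)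
  next
    case False
    hence r: "r < l" using Suc.prems by simp
    have "d l * B ^ l = (d l * B ^ (l - Suc r) * B) * B ^ r"
      using r by (simp add: power_add[symmetric] mult.assoc power_Suc[symmetric] del: power_Suc)
    moreover have "(encode B l d + x * B ^ r) div B ^ r = encode B l d div B ^ r + x" for x
      using B by simp
    ultimately have "(encode B l d + d l * B ^ l) div B ^ r = encode B l d div B ^ r + d l * B ^ (l - Suc r) * B"
      by metis
    hence "digit B (encode B (Suc l) d) r = digit B (encode B l d) r" by (simp add: digit_def e)
    thus ?thesis using Suc r by simp
  qed
qed simp

lemma encode_upd: "r < l \<Longrightarrow> encode B l (d(r := x)) + d r * B ^ r = encode B l d + x * B ^ r"
proof -
  assume r: "r < l"
  have "encode B l e = e r * B ^ r + (\<Sum>i\<in>{..<l} - {r}. e i * B ^ i)" for e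
    unfolding encode_def using r by (intro sum.remove) auto
  moreover have "(\<Sum>i\<in>{..<l} - {r}. (d(r := x)) i * B ^ i) = (\<Sum>i\<in>{..<l} - {r}. d i * B ^ i)"
    by (intro sum.cong) auto
  ultimately show ?thesis by simp
qed

lemma valid_encode:
  assumes "\<And>r. r < l \<Longrightarrow> d r < B"
  shows "valid_code B l (encode B l d) \<longleftrightarrow> (\<forall>r<l. 0 < d r) \<and> (\<forall>r. Suc r < l \<longrightarrow> d (Suc r) \<le> d r)"
  using encode_less[OF assms] digit_encode[OF assms] by (auto simp: valid_code_def)

fun code_table :: "nat \<Rightarrow> nat \<Rightarrow> nat \<Rightarrow> nat \<Rightarrow> nat" where
  "code_table B l 0 p = 0"
| "code_table B l (Suc 0) p = (if p = encode B l (\<lambda>_. 1) then 1 else 0)"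
| "code_table B l (Suc (Suc j)) p = (if valid_code B l p then
     code_table B l (Suc j) p + (\<Sum>r<l. code_table B l (Suc j) (p + B ^ r) + code_table B l (Suc j) (p - B ^ r))
       - code_table B l j p else 0)"

lemma code_table_invalid: "2 \<le> B \<Longrightarrow> \<not> valid_code B l p \<Longrightarrow> code_table B l j p = 0"
proof (induction B l j p rule: code_table.induct)
  case (2 B l p)
  have "valid_code B l (encode B l (\<lambda>_. 1))" using 2 by (subst valid_encode) auto
  thus ?case using 2 by auto
qed auto

lemma code_table_bound: "code_table B l j p \<le> (2 * l + 1) ^ j"
proof (induction B l j p rule: code_table.induct)
  case (3 B l j p)
  show ?case
  proof (cases "valid_code B l p")
    case True
    let ?b = "(2 * l + 1) ^ Suc j"
    have "code_table B l (Suc (Suc j)) p \<le> code_table B l (Suc j) p +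
      (\<Sum>r<l. code_table B l (Suc j) (p + B ^ r) + code_table B l (Suc j) (p - B ^ r))" by simp
    also have "\<dots> \<le> ?b + (\<Sum>r<l. ?b + ?b)"
      using True 3 by (intro add_mono sum_mono) blast+
    also have "\<dots> = (2 * l + 1) ^ Suc (Suc j)" by (simp add: algebra_simps)
    finally show ?thesis .
  qed simp
qed auto

definition shape_code :: "nat \<Rightarrow> nat \<Rightarrow> (nat \<Rightarrow> nat) \<Rightarrow> nat" where
  "shape_code B l \<mu> = encode B l (\<lambda>r. \<mu> r + 1)"

lemma shape_code_Up: "r < l \<Longrightarrow> shape_code B l (move_shape (Up r) \<mu>) = shape_code B l \<mu> + B ^ r"
proof -
  assume r: "r < l"
  have "(\<lambda>i. move_shape (Up r) \<mu> i + 1) = (\<lambda>i. \<mu> i + 1)(r := \<mu> r + 2)" by auto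
  thus ?thesis using encode_upd[OF r, of B "\<lambda>i. \<mu> i + 1" "\<mu> r + 2"] by (simp add: shape_code_def algebra_simps)
qed

lemma shape_code_Down: "r < l \<Longrightarrow> 0 < \<mu> r \<Longrightarrow> shape_code B l (move_shape (Down r) \<mu>) + B ^ r = shape_code B l \<mu>"
  using shape_code_Up[of r l B "move_shape (Down r) \<mu>"] by (simp add: fun_upd_idem)

lemma shape_code_ge: "r < l \<Longrightarrow> B ^ r \<le> shape_code B l \<mu>"
proof -
  assume r: "r < l"
  have "B ^ r \<le> (\<mu> r + 1) * B ^ r" by simp
  also have "\<dots> \<le> shape_code B l \<mu>" unfolding shape_code_def encode_def using r by (intro member_le_sum) auto
  finally show ?thesis .
qed

lemma is_shape_le_0: "is_shape l \<mu> \<Longrightarrow> \<mu> r \<le> \<mu> 0"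
  unfolding is_shape_def by (induction r) (auto intro: le_trans)

lemma shape_code_less: "is_shape l \<mu> \<Longrightarrow> \<mu> 0 + 1 < B \<Longrightarrow> shape_code B l \<mu> < B ^ l"
  unfolding shape_code_def using is_shape_le_0[of l \<mu>] by (intro encode_less) (meson add_le_mono1 le_less_trans)

lemma code_table_out_of_shape:
  assumes \<mu>: "\<And>r. r < l \<Longrightarrow> \<mu> r + 1 < B" "\<not> is_shape l \<mu>" "\<And>r. l \<le> r \<Longrightarrow> \<mu> r = 0" and B: "2 \<le> B"
  shows "code_table B l j (shape_code B l \<mu>) = 0"
proof (rule code_table_invalid[OF B])
  have "\<not> (\<forall>r. Suc r < l \<longrightarrow> \<mu> (Suc r) \<le> \<mu> r)"
  proof
    assume a: "\<forall>r. Suc r < l \<longrightarrow> \<mu> (Suc r) \<le> \<mu> r"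
    have "\<mu> (Suc r) \<le> \<mu> r" for r using a \<mu>(3)[of "Suc r"] by (cases "Suc r < l") auto
    thus False using \<mu>(2,3) by (simp add: is_shape_def)
  qed
  thus "\<not> valid_code B l (shape_code B l \<mu>)"
    unfolding shape_code_def using \<mu>(1) by (subst valid_encode) auto
qed

lemma code_table_Down_0:
  assumes \<mu>: "\<And>r. r < l \<Longrightarrow> \<mu> r + 1 < B" and r: "r < l" "\<mu> r = 0" and B: "2 \<le> B"
  shows "code_table B l j (shape_code B l \<mu> - B ^ r) = 0"
proof (rule code_table_invalid[OF B])
  let ?d = "(\<lambda>i. \<mu> i + 1)(r := 0)"
  have e: "shape_code B l \<mu> - B ^ r = encode B l ?d"
    using encode_upd[OF r(1), of B "\<lambda>i. \<mu> i + 1" 0] r(2) by (simp add: shape_code_def)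
  have "?d i < B" if "i < l" for i using \<mu>[OF that] B by auto
  thus "\<not> valid_code B l (shape_code B l \<mu> - B ^ r)"
    unfolding e using r(1) by (subst valid_encode) auto
qed

lemma code_table_Up:
  assumes sh: "is_shape l \<mu>" and r: "r < l" and bound: "\<mu> 0 + 2 < B"
    and IH: "is_shape l (move_shape (Up r) \<mu>) \<Longrightarrow>
      code_table B l j (shape_code B l (move_shape (Up r) \<mu>)) = walk_count l j (move_shape (Up r) \<mu>)"
  shows "code_table B l j (shape_code B l \<mu> + B ^ r) = walk_count l j (move_shape (Up r) \<mu>)"
proof (cases "is_shape l (move_shape (Up r) \<mu>)")
  case True
  thus ?thesis using IH shape_code_Up[OF r, of B \<mu>] by simp
next
  case False
  have "code_table B l j (shape_code B l (move_shape (Up r) \<mu>)) = 0"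
  proof (rule code_table_out_of_shape)
    fix i assume "i < l" show "move_shape (Up r) \<mu> i + 1 < B" using is_shape_le_0[OF sh, of i] bound by auto
  next
    fix i assume "l \<le> i" thus "move_shape (Up r) \<mu> i = 0" using is_shape_beyond[OF _ sh, of i] r by simp
  qed (use bound False in auto)
  thus ?thesis using shape_code_Up[OF r, of B \<mu>] walk_count_not_shape[OF False] by simp
qed

lemma code_table_Down:
  assumes sh: "is_shape l \<mu>" and r: "r < l" and bound: "\<mu> 0 + 2 < B"
    and IH: "is_shape l (move_shape (Down r) \<mu>) \<Longrightarrow> 0 < \<mu> r \<Longrightarrow>
      code_table B l j (shape_code B l (move_shape (Down r) \<mu>)) = walk_count l j (move_shape (Down r) \<mu>)"
  shows "code_table B l j (shape_code B l \<mu> - B ^ r) = down_count l j \<mu> r"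
proof (cases "0 < \<mu> r")
  case False
  moreover have "\<mu> i + 1 < B" for i using is_shape_le_0[OF sh, of i] bound by simp
  ultimately show ?thesis using code_table_Down_0[of l \<mu> B r j] r bound by (simp add: down_count_def)
next
  case pos: True
  have e: "shape_code B l \<mu> - B ^ r = shape_code B l (move_shape (Down r) \<mu>)"
    using shape_code_Down[where B = B and l = l and r = r and \<mu> = \<mu>] r pos by simp
  show ?thesis
  proof (cases "is_shape l (move_shape (Down r) \<mu>)")
    case True
    thus ?thesis using IH[OF True pos] pos e by (simp add: down_count_def)
  next
    case False
    have "code_table B l j (shape_code B l (move_shape (Down r) \<mu>)) = 0"
    proof (rule code_table_out_of_shape)
      fix i assume "i < l" show "move_shape (Down r) \<mu> i + 1 < B" using is_shape_le_0[OF sh, of i] bound by auto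
    next
      fix i assume "l \<le> i" thus "move_shape (Down r) \<mu> i = 0" using is_shape_beyond[OF _ sh, of i] by auto
    qed (use bound False in auto)
    thus ?thesis using pos e walk_count_not_shape[OF False] by (simp add: down_count_def)
  qed
qed

text \<open>The bound on the first row keeps all digits below the base, so no carries occur.\<close>

lemma code_table_shape_code:
  "is_shape l \<mu> \<Longrightarrow> 1 \<le> l \<Longrightarrow> \<mu> 0 + j + 1 \<le> B \<Longrightarrow> 3 \<le> B \<Longrightarrow> code_table B l j (shape_code B l \<mu>) = walk_count l j \<mu>"
proof (induction l j \<mu> rule: walk_count.induct)
  case (1 l \<mu>)
  show ?case by simp
next
  case (2 l \<mu>)
  have bound: "\<mu> r + 1 < B" for r using is_shape_le_0[OF 2(1), of r] 2 by simp
  have "shape_code B l \<mu> = encode B l (\<lambda>_. 1) \<longleftrightarrow> \<mu> = (\<lambda>_. 0)"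
  proof
    assume eq: "shape_code B l \<mu> = encode B l (\<lambda>_. 1)"
    have "\<mu> r = 0" for r
    proof (cases "r < l")
      case True
      have "digit B (shape_code B l \<mu>) r = \<mu> r + 1" unfolding shape_code_def
        using digit_encode[of l "\<lambda>r. \<mu> r + 1" B r] bound True by simp
      moreover have "digit B (encode B l (\<lambda>_. 1)) r = 1" using digit_encode[of l "\<lambda>_. 1" B r] 2 True by simp
      ultimately show ?thesis using eq by simp
    next
      case False thus ?thesis using is_shape_beyond[of l r \<mu>] 2 by simp
    qed
    thus "\<mu> = (\<lambda>_. 0)" by auto
  qed (simp add: shape_code_def)
  thus ?case by simp
next
  case (3 l j \<mu>)
  have sh: "is_shape l \<mu>" by fact
  have bound: "\<mu> r + 1 < B" for r using is_shape_le_0[OF sh, of r] 3 by simp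
  have up: "code_table B l (Suc j) (shape_code B l \<mu> + B ^ r) = walk_count l (Suc j) (move_shape (Up r) \<mu>)"
    if r: "r < l" for r
  proof (rule code_table_Up[OF sh r])
    assume "is_shape l (move_shape (Up r) \<mu>)"
    moreover have "move_shape (Up r) \<mu> 0 \<le> \<mu> 0 + 1" by simp
    ultimately show "code_table B l (Suc j) (shape_code B l (move_shape (Up r) \<mu>)) = walk_count l (Suc j) (move_shape (Up r) \<mu>)"
      using 3(2)[OF sh, of r] 3(6-8) r by (simp del: move_shape.simps)
  qed (use 3(7) in simp)
  have dn: "code_table B l (Suc j) (shape_code B l \<mu> - B ^ r) = down_count l (Suc j) \<mu> r" if r: "r < l" for r
  proof (rule code_table_Down[OF sh r])
    assume "is_shape l (move_shape (Down r) \<mu>)" "0 < \<mu> r"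
    moreover have "move_shape (Down r) \<mu> 0 \<le> \<mu> 0 + 1" by auto
    ultimately show "code_table B l (Suc j) (shape_code B l (move_shape (Down r) \<mu>)) = walk_count l (Suc j) (move_shape (Down r) \<mu>)"
      using 3(3)[OF sh, of r] 3(6-8) r by (simp del: move_shape.simps)
  qed (use 3(7) in simp)
  have valid: "valid_code B l (shape_code B l \<mu>)"
    unfolding shape_code_def using bound sh by (subst valid_encode) (auto simp: is_shape_def)
  have "code_table B l (Suc j) (shape_code B l \<mu>) = walk_count l (Suc j) \<mu>"
    "code_table B l j (shape_code B l \<mu>) = walk_count l j \<mu>"
    using 3(1)[OF sh sh] 3(4)[OF sh sh] 3 by simp_all
  thus ?case using valid sh up dn by (simp add: down_count_def del: move_shape.simps)
qed

subsection \<open>Weakest preconditions\<close>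

type_synonym assertion = "(nat \<Rightarrow> nat) \<Rightarrow> (nat \<Rightarrow> nat) \<Rightarrow> (nat \<times> nat) list \<Rightarrow> nat \<Rightarrow> bool"

abbreviation mk_state :: "(nat \<Rightarrow> nat) \<Rightarrow> (nat \<Rightarrow> nat) \<Rightarrow> (nat \<times> nat) list \<Rightarrow> nat \<Rightarrow> state" where
  "mk_state R M O' t \<equiv> \<lparr>reg = R, mem = M, printed = O', time = t\<rparr>"

fun operand_value :: "(nat \<Rightarrow> nat) \<Rightarrow> operand \<Rightarrow> nat" where
  "operand_value R (Imm c) = c"
| "operand_value R (Reg r) = R r"

fun test_value :: "(nat \<Rightarrow> nat) \<Rightarrow> test \<Rightarrow> bool" where
  "test_value R (Less x y) \<longleftrightarrow> operand_value R x < operand_value R y"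
| "test_value R (Equal x y) \<longleftrightarrow> operand_value R x = operand_value R y"

text \<open>The generator draws a single number and unranks it deterministically, so no rule for \<open>Random\<close> is needed.\<close>

primrec wp :: "nat \<Rightarrow> nat \<Rightarrow> nat \<Rightarrow> com \<Rightarrow> assertion \<Rightarrow> assertion" where
  "wp w a b Skip Q = (\<lambda>R M O' t. Q R M O' (Suc t))"
| "wp w a b (Move r x) Q = (\<lambda>R M O' t. operand_value R x < 2 ^ w \<and> Q (R(r := operand_value R x)) M O' (Suc t))"
| "wp w a b (Arith f r x y) Q = (\<lambda>R M O' t. eval_arith f (operand_value R x) (operand_value R y) < 2 ^ w \<and>
     Q (R(r := eval_arith f (operand_value R x) (operand_value R y))) M O' (Suc t))"
| "wp w a b (Load r x) Q = (\<lambda>R M O' t. operand_value R x < b \<and> M (operand_value R x) < 2 ^ w \<and>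
     Q (R(r := M (operand_value R x))) M O' (Suc t))"
| "wp w a b (Store x y) Q = (\<lambda>R M O' t. a \<le> operand_value R x \<and> operand_value R x < b \<and> operand_value R y < 2 ^ w \<and>
     Q R (M(operand_value R x := operand_value R y)) O' (Suc t))"
| "wp w a b (Random r x) Q = (\<lambda>R M O' t. False)"
| "wp w a b (Print x y) Q = (\<lambda>R M O' t. Q R M (O' @ [(operand_value R x, operand_value R y)]) (Suc t))"
| "wp w a b (Seq c d) Q = wp w a b c (wp w a b d Q)"
| "wp w a b (If e c d) Q = (\<lambda>R M O' t. if test_value R e then wp w a b c Q R M O' (Suc t) else wp w a b d Q R M O' (Suc t))"
| "wp w a b (While e c) Q = (\<lambda>R M O' t. \<exists>m. rec_nat (\<lambda>R M O' t. \<not> test_value R e \<and> Q R M O' (Suc t))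
     (\<lambda>_ P R M O' t. test_value R e \<and> wp w a b c P R M O' (Suc t)) m R M O' t)"

lemma val_mk_state [simp]: "val (mk_state R M O' t) x = operand_value R x"
  by (cases x) auto

lemma holds_mk_state [simp]: "holds (mk_state R M O' t) e = test_value R e"
  by (cases e) auto

lemma tick_mk_state [simp]: "tick (mk_state R M O' t) = mk_state R M O' (Suc t)"
  by (simp add: tick_def)

theorem wp_sound:
  "wp w a b c Q R M O' t \<Longrightarrow>
     \<exists>R' M' O'' t'. exec w a b c (mk_state R M O' t) = return_spmf (mk_state R' M' O'' t') \<and> Q R' M' O'' t'"
proof (induction c arbitrary: Q R M O' t)
  case (Seq c d)
  from Seq.IH(1)[of "wp w a b d Q"] Seq.prems obtain R' M' O'' t' where
    1: "exec w a b c (mk_state R M O' t) = return_spmf (mk_state R' M' O'' t')" "wp w a b d Q R' M' O'' t'"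
    unfolding wp.simps by blast
  from Seq.IH(2)[OF 1(2)] 1(1) show ?case by simp
next
  case (While e c)
  define W where "W = rec_nat (\<lambda>R M O' t. \<not> test_value R e \<and> Q R M O' (Suc t))
     (\<lambda>_ P R M O' t. test_value R e \<and> wp w a b c P R M O' (Suc t))"
  have W: "W 0 = (\<lambda>R M O' t. \<not> test_value R e \<and> Q R M O' (Suc t))"
    "\<And>m. W (Suc m) = (\<lambda>R M O' t. test_value R e \<and> wp w a b c (W m) R M O' (Suc t))" by (simp_all add: W_def)
  have "W m R M O' t \<Longrightarrow> \<exists>R' M' O'' t'. exec w a b (While e c) (mk_state R M O' t) = return_spmf (mk_state R' M' O'' t') \<and> Q R' M' O'' t'" for m
  proof (induction m arbitrary: R M O' t)
    case 0
    thus ?case by (simp add: W loop.simps)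
  next
    case (Suc m)
    hence e: "test_value R e" "wp w a b c (W m) R M O' (Suc t)" by (auto simp: W)
    from While.IH[OF e(2)] obtain R' M' O'' t' where
      1: "exec w a b c (mk_state R M O' (Suc t)) = return_spmf (mk_state R' M' O'' t')" "W m R' M' O'' t'" by blast
    have "exec w a b (While e c) (mk_state R M O' t) = exec w a b (While e c) (mk_state R' M' O'' t')"
      using e(1) 1(1) by (simp add: loop.simps[of _ _ "mk_state R M O' t"])
    thus ?case using Suc.IH[OF 1(2)] by simp
  qed
  thus ?case using While.prems by (auto simp: W_def)
qed (auto simp: set_reg_def set_mem_def split: if_splits)

lemma wp_mono:
  "wp w a b c P R M O' t \<Longrightarrow> (\<And>R' M' O'' t'. P R' M' O'' t' \<Longrightarrow> Q R' M' O'' t') \<Longrightarrow> wp w a b c Q R M O' t"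
proof (induction c arbitrary: P Q R M O' t)
  case (Seq c d)
  show ?case using Seq.IH(1)[of "wp w a b d P" _ _ _ _ "wp w a b d Q"] Seq.IH(2)[of P _ _ _ _ Q] Seq.prems by auto
next
  case (If e c d)
  show ?case using If.IH(1)[of P R M O' "Suc t" Q] If.IH(2)[of P R M O' "Suc t" Q] If.prems by auto
next
  case (While e c)
  define W where "W Q = rec_nat (\<lambda>R M O' t. \<not> test_value R e \<and> Q R M O' (Suc t))
     (\<lambda>_ P R M O' t. test_value R e \<and> wp w a b c P R M O' (Suc t))" for Q
  have W: "W Q 0 = (\<lambda>R M O' t. \<not> test_value R e \<and> Q R M O' (Suc t))"
    "\<And>m. W Q (Suc m) = (\<lambda>R M O' t. test_value R e \<and> wp w a b c (W Q m) R M O' (Suc t))" for Q by (simp_all add: W_def)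
  have "W P m R M O' t \<Longrightarrow> W Q m R M O' t" for m R M O' t
  proof (induction m arbitrary: R M O' t)
    case 0 thus ?case using While.prems(2) by (simp add: W)
  next
    case (Suc m) thus ?case using While.IH[of "W P m" R M O' "Suc t" "W Q m"] by (auto simp: W)
  qed
  thus ?case using While.prems(1) unfolding W_def wp.simps by blast
qed auto

lemma wp_seqI:
  assumes "wp w a b c P R M O' t" "\<And>R' M' O'' t'. P R' M' O'' t' \<Longrightarrow> wp w a b d Q R' M' O'' t'"
  shows "wp w a b (Seq c d) Q R M O' t"
  using wp_mono[OF assms] by simp

lemma wp_while:
  assumes "I m R M O' t"
    and "\<And>m R M O' t. I (Suc m) R M O' t \<Longrightarrow> test_value R e \<and> wp w a b c (I m) R M O' (Suc t)"
    and "\<And>R M O' t. I 0 R M O' t \<Longrightarrow> \<not> test_value R e \<and> Q R M O' (Suc t)"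
  shows "wp w a b (While e c) Q R M O' t"
proof -
  define W where "W = rec_nat (\<lambda>R M O' t. \<not> test_value R e \<and> Q R M O' (Suc t))
     (\<lambda>_ P R M O' t. test_value R e \<and> wp w a b c P R M O' (Suc t))"
  have W: "W 0 = (\<lambda>R M O' t. \<not> test_value R e \<and> Q R M O' (Suc t))"
    "\<And>m. W (Suc m) = (\<lambda>R M O' t. test_value R e \<and> wp w a b c (W m) R M O' (Suc t))" by (simp_all add: W_def)
  have "I m R M O' t \<Longrightarrow> W m R M O' t" for m R M O' t
  proof (induction m arbitrary: R M O' t)
    case 0 thus ?case using assms(3) by (simp add: W)
  next
    case (Suc m) thus ?case using assms(2)[OF Suc.prems] wp_mono[of w a b c "I m" R M O' "Suc t" "W m"] by (simp add: W)
  qed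
  thus ?thesis using assms(1) unfolding W_def wp.simps by blast
qed

subsection \<open>Bit masks\<close>

lemma and_pred_odd_multiple: "and (2 ^ k * (2 * c + 1)) (2 ^ k * (2 * c + 1) - 1) = (2 ^ k * (2 * c) :: nat)"
proof (induction k)
  case 0
  show ?case by (simp add: and_rec[of "Suc (2 * c)" "2 * c"])
next
  case (Suc k)
  let ?x = "2 ^ k * (2 * c + 1) :: nat"
  have pos: "0 < ?x" by simp
  have a: "(2 * ?x) div 2 = ?x" "(2 * ?x - 1) div 2 = ?x - 1" using pos by auto
  have "and (2 * ?x) (2 * ?x - 1) = 2 * and ((2 * ?x) div 2) ((2 * ?x - 1) div 2)"
    by (subst and_rec) simp
  also have "\<dots> = 2 * (2 ^ k * (2 * c))" unfolding a Suc.IH ..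
  finally show ?case by (simp add: mult.assoc)
qed

definition row_mask :: "nat \<Rightarrow> nat set \<Rightarrow> nat" where
  "row_mask n R = (\<Sum>v\<in>R. 4 ^ (n - v))"

lemma sum_powers_less: "finite E \<Longrightarrow> (\<And>e. e \<in> E \<Longrightarrow> e < m) \<Longrightarrow> (\<Sum>e\<in>E. 4 ^ e) < (4::nat) ^ m"
proof (induction m arbitrary: E)
  case (Suc m)
  have "(\<Sum>e\<in>E. 4 ^ e) \<le> (\<Sum>e\<in>insert m (E - {m}). 4 ^ e :: nat)" using Suc.prems by (intro sum_mono2) auto
  also have "\<dots> = 4 ^ m + (\<Sum>e\<in>E - {m}. 4 ^ e)" using Suc.prems by (subst sum.insert) auto
  also have "(\<Sum>e\<in>E - {m}. 4 ^ e) < (4::nat) ^ m" using Suc.prems by (intro Suc.IH) (auto simp: less_Suc_eq)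
  finally show ?case by simp
next
  case 0
  hence "E = {}" by blast
  thus ?case by simp
qed

lemma row_mask_bound:
  assumes "R \<subseteq> {1..n}" shows "row_mask n R < 4 ^ n"
proof -
  have fin: "finite R" using assms finite_subset by blast
  have inj: "inj_on (\<lambda>v. n - v) R" using assms by (intro inj_onI) (metis atLeastAtMost_iff diff_diff_cancel subsetD)
  have "row_mask n R = (\<Sum>e\<in>(\<lambda>v. n - v) ` R. 4 ^ e)" unfolding row_mask_def by (simp add: sum.reindex[OF inj])
  also have "\<dots> < 4 ^ n" using fin assms by (intro sum_powers_less) force+
  finally show ?thesis .
qed

lemma row_mask_insert: "finite R \<Longrightarrow> v \<notin> R \<Longrightarrow> row_mask n (insert v R) = row_mask n R + 4 ^ (n - v)"
  by (simp add: row_mask_def)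

lemma row_mask_remove: "finite R \<Longrightarrow> v \<in> R \<Longrightarrow> row_mask n (R - {v}) = row_mask n R - 4 ^ (n - v)"
  by (simp add: row_mask_def sum_diff1_nat)

lemma row_mask_truncate:
  assumes R: "R \<subseteq> {1..n}" and x: "1 \<le> x" "x \<le> n"
  shows "row_mask n R div 4 ^ (n - x) * 4 ^ (n - x) = row_mask n {v \<in> R. v \<le> x}"
proof -
  have fin: "finite R" using R finite_subset by blast
  let ?lo = "{v \<in> R. x < v}" and ?hi = "{v \<in> R. v \<le> x}"
  have split: "row_mask n R = row_mask n ?hi + row_mask n ?lo"
    unfolding row_mask_def using fin by (subst sum.union_disjoint[symmetric]) (auto intro!: sum.cong)
  have inj: "inj_on (\<lambda>v. n - v) ?lo"
    using R by (intro inj_onI) (metis (no_types, lifting) atLeastAtMost_iff diff_diff_cancel mem_Collect_eq subsetD)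
  have "row_mask n ?lo = (\<Sum>e\<in>(\<lambda>v. n - v) ` ?lo. 4 ^ e)" unfolding row_mask_def by (simp add: sum.reindex[OF inj])
  also have "\<dots> < 4 ^ (n - x)" using fin R by (intro sum_powers_less) (auto intro!: diff_less_mono2)
  finally have lo: "row_mask n ?lo < 4 ^ (n - x)" .
  have "(4::nat) ^ (n - x) dvd row_mask n ?hi"
    unfolding row_mask_def by (intro dvd_sum) (auto intro!: le_imp_power_dvd diff_le_mono2)
  then obtain c where "row_mask n ?hi = 4 ^ (n - x) * c" by (elim dvdE)
  thus ?thesis unfolding split using lo by simp
qed

lemma row_mask_lowest:
  assumes R: "R \<subseteq> {1..n}" "R \<noteq> {}"
  shows "and (row_mask n R) (row_mask n R - 1) = row_mask n R - 4 ^ (n - Max R)" "4 ^ (n - Max R) \<le> row_mask n R"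
proof -
  have fin: "finite R" using R finite_subset by blast
  let ?x = "Max R" let ?k = "n - ?x"
  have x: "?x \<in> R" using fin R by simp
  have "row_mask n R = row_mask n (R - {?x}) + 4 ^ ?k" using row_mask_insert[of "R - {?x}" ?x n] fin x by (simp add: insert_absorb)
  moreover have "(4::nat) ^ Suc ?k dvd row_mask n (R - {?x})"
    unfolding row_mask_def
  proof (intro dvd_sum le_imp_power_dvd)
    fix v assume v: "v \<in> R - {?x}"
    hence "v < ?x" using fin Max_ge[OF fin, of v] by (simp add: le_neq_implies_less)
    thus "Suc ?k \<le> n - v" using x R by auto
  qed
  then obtain c where "row_mask n (R - {?x}) = 4 ^ Suc ?k * c" by (elim dvdE)
  ultimately have "row_mask n R = 4 ^ ?k * (2 * (2 * c) + 1)" by (simp add: algebra_simps)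
  moreover have "(4::nat) ^ ?k = 2 ^ (2 * ?k)" by (simp only: power_mult) simp
  ultimately have m: "row_mask n R = 2 ^ (2 * ?k) * (2 * (2 * c) + 1)" by simp
  show "4 ^ ?k \<le> row_mask n R" unfolding m by (simp add: power_mult)
  have "row_mask n R - 4 ^ ?k = 2 ^ (2 * ?k) * (2 * (2 * c))" unfolding m by (simp add: power_mult)
  thus "and (row_mask n R) (row_mask n R - 1) = row_mask n R - 4 ^ ?k" unfolding m using and_pred_odd_multiple[of "2 * ?k" "2 * c"] by simp
qed

subsection \<open>Discrete logarithms to base 4 modulo powers of 3\<close>

lemma four_power_mod_3: "\<exists>y. (4::nat) ^ f = 3 * y + 1"
proof (induction f)
  case (Suc f)
  then obtain y where "(4::nat) ^ f = 3 * y + 1" by blast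
  hence "(4::nat) ^ Suc f = 3 * (4 * y + 1) + 1" by simp
  thus ?case by blast
qed simp

lemma three_power_dvd_four_power:
  "(3::nat) ^ Suc m dvd 4 ^ e - 1 \<Longrightarrow> 3 ^ m dvd e"
proof (induction m arbitrary: e)
  case (Suc m)
  have "(9::nat) dvd 4 ^ e - 1" using Suc.prems by (rule dvd_trans[rotated]) simp
  have "3 dvd e"
  proof -
    define f where "f = e div 3"
    have e: "e = 3 * f + e mod 3" by (simp add: f_def)
    have "(4::nat) ^ (3 * f) mod 9 = 1" by (simp add: power_mult power_mod[symmetric, of 64])
    hence "(4::nat) ^ e mod 9 = 4 ^ (e mod 3) mod 9" by (subst e, subst power_add) (simp add: mod_mult_left_eq[symmetric, of "4 ^ (3 * f)"])
    moreover have "(4::nat) ^ e mod 9 = 1"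
    proof -
      obtain c where "(4::nat) ^ e - 1 = 9 * c" using \<open>9 dvd 4 ^ e - 1\<close> by (elim dvdE)
      hence "(4::nat) ^ e = 9 * c + 1" by (metis le_add_diff_inverse2 one_le_numeral one_le_power)
      thus ?thesis by simp
    qed
    ultimately have "(4::nat) ^ (e mod 3) mod 9 = 1" by simp
    moreover have "e mod 3 < 3" by simp
    ultimately have "e mod 3 = 0" by (cases "e mod 3" rule: nat.exhaust; cases "e mod 3 = 1"; cases "e mod 3 = 2") auto
    thus ?thesis by auto
  qed
  then obtain f where f: "e = 3 * f" by (elim dvdE)
  obtain y where y: "(4::nat) ^ f = 3 * y + 1" using four_power_mod_3 by blast
  have "(4::nat) ^ e = (3 * y + 1) ^ 3" unfolding f by (subst mult.commute) (simp only: power_mult y)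
  hence "(4::nat) ^ e - 1 = 3 * (3 * y * (1 + 3 * y + 3 * y\<^sup>2))" by (simp add: power3_eq_cube power2_eq_square algebra_simps)
  hence "3 * 3 ^ Suc m dvd 3 * (3 * y * (1 + 3 * y + 3 * y\<^sup>2))" using Suc.prems by (simp only: power_Suc)
  hence "3 ^ Suc m dvd 3 * y * (1 + 3 * y + 3 * y\<^sup>2)" by (subst (asm) nat_mult_dvd_cancel1) simp_all
  moreover have "coprime (3 ^ Suc m) (1 + 3 * y + 3 * y\<^sup>2)"
  proof -
    have "(1 + 3 * (y + y\<^sup>2)) mod 3 = 1" by presburger
    hence "gcd (1 + 3 * (y + y\<^sup>2)) 3 = 1" using gcd_red_nat[of "1 + 3 * (y + y\<^sup>2)" 3] by simp
    hence "coprime 3 (1 + 3 * (y + y\<^sup>2))" by (simp only: coprime_iff_gcd_eq_1 gcd.commute)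
    hence "coprime 3 (1 + 3 * y + 3 * y\<^sup>2)" by (simp add: algebra_simps)
    thus ?thesis by (rule coprime_power_left_iff[THEN iffD2, OF disjI1])
  qed
  ultimately have "3 ^ Suc m dvd 3 * y" using coprime_dvd_mult_left_iff by blast
  hence "(3::nat) ^ Suc m dvd 4 ^ f - 1" using y by simp
  hence "3 ^ m dvd f" by (rule Suc.IH)
  thus ?case using f by simp
qed simp

lemma four_power_mod_inj:
  assumes q: "q = 3 ^ Suc m" "n < 3 ^ m" and ij: "i \<le> n" "j \<le> n" "(4::nat) ^ i mod q = 4 ^ j mod q"
  shows "i = j"
proof -
  have le: "j \<le> i" if ij: "i \<le> j" "j \<le> n" "(4::nat) ^ i mod q = 4 ^ j mod q" for i j
  proof -
    have e: "(4::nat) ^ j = 4 ^ i * 4 ^ (j - i)" using ij by (simp add: power_add[symmetric])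
    have "q dvd 4 ^ j - 4 ^ i" using ij(3) mod_eq_dvd_iff_nat[of "4 ^ i" "4 ^ j" q] ij(1) by (simp add: power_increasing)
    hence "q dvd 4 ^ i * (4 ^ (j - i) - 1)" unfolding e by (simp add: diff_mult_distrib2)
    moreover have "coprime q (4 ^ i)" unfolding q(1)
      by (intro coprime_power_left_iff[THEN iffD2, OF disjI1] coprime_power_right_iff[THEN iffD2, OF disjI1])
        (simp add: coprime_iff_gcd_eq_1 gcd_non_0_nat)
    ultimately have "q dvd 4 ^ (j - i) - 1" by (simp add: coprime_dvd_mult_right_iff)
    hence "3 ^ m dvd j - i" using three_power_dvd_four_power q(1) by blast
    moreover have "j - i < 3 ^ m" using ij q(2) by simp
    ultimately have "j - i = 0" using dvd_imp_le by fastforce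
    thus ?thesis by simp
  qed
  show ?thesis
  proof (cases "i \<le> j")
    case True thus ?thesis using le[OF True ij(2,3)] by simp
  next
    case False
    hence "j \<le> i" by simp
    thus ?thesis using le[OF _ ij(1) ij(3)[symmetric]] by simp
  qed
qed

subsection \<open>Preprocessing\<close>

primrec seqs :: "com list \<Rightarrow> com" where
  "seqs [] = Skip"
| "seqs (c # cs) = Seq c (seqs cs)"

primrec unroll :: "nat \<Rightarrow> (nat \<Rightarrow> com) \<Rightarrow> com" where
  "unroll 0 f = Skip"
| "unroll (Suc r) f = Seq (unroll r f) (f r)"

lemma wp_unroll:
  assumes "I 0 R M O' (Suc t)"
    and "\<And>r R M O' t. r < l \<Longrightarrow> I r R M O' t \<Longrightarrow> wp w a b (f r) (I (Suc r)) R M O' t"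
  shows "wp w a b (unroll l f) (I l) R M O' t"
  using assms(2)
proof (induction l)
  case 0 show ?case using assms(1) by simp
next
  case (Suc l)
  have "wp w a b (unroll l f) (I l) R M O' t" using Suc by simp
  thus ?case using Suc.prems[of l] by (auto intro: wp_mono)
qed

definition prep_steps :: "nat \<Rightarrow> nat \<Rightarrow> nat" where
  "prep_steps l n = 11 * n + 4 * l + 28 + n * ((17 * l + 18) * (n + 3) ^ l + 6)"

definition prep_cells :: "nat \<Rightarrow> nat \<Rightarrow> nat" where
  "prep_cells l n = 9 * n + 7 + (n + 2) * (2 * (n + 3) ^ l)"

text \<open>
  Registers: 0 holds \<open>n\<close>, 1 the base \<open>B = n + 3\<close>, 2 the modulus \<open>q\<close>, 3 and 5 the numbers \<open>B\<^sup>l\<close> and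
  \<open>S = 2 B\<^sup>l\<close>, 4 the code of the empty shape, 6 the address of the table, 7 the address of the current
  layer, 8 a counter, 9 the current code, 10 the rank, 18 the bit of the current vertex, and
  \<open>32 + 2 r\<close> and \<open>33 + 2 r\<close> the mask of row \<open>r\<close> and \<open>B\<^sup>r\<close>; the others are scratch.
  Memory: cells 0, 1, 2 hold \<open>n\<close>, \<open>q\<close>, \<open>4\<^sup>n\<close>; the next \<open>q\<close> cells hold the logarithms; then come
  layers of \<open>S\<close> cells, the cell for code \<open>p\<close> in layer \<open>j\<close> holding \<open>code_table B l j p\<close>.
\<close>

definition setup_com :: "nat \<Rightarrow> com" where
  "setup_com l = seqs [Arith Add 1 (Reg 0) (Imm 3), Move 3 (Imm 1), Move 4 (Imm 0),
     unroll l (\<lambda>r. seqs [Move (33 + 2 * r) (Reg 3), Arith Add 4 (Reg 4) (Reg 3), Arith Mul 3 (Reg 3) (Reg 1)]),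
     Arith Mul 5 (Reg 3) (Imm 2), Arith Add 6 (Reg 2) (Imm 3)]"

definition modulus_com :: com where
  "modulus_com = seqs [Arith Mul 11 (Reg 0) (Imm 3), Arith Add 11 (Reg 11) (Imm 1), Move 2 (Imm 3),
     While (Less (Reg 2) (Reg 11)) (Arith Mul 2 (Reg 2) (Imm 3))]"

definition log_com :: com where
  "log_com = seqs [Move 12 (Imm 1), Move 13 (Reg 0),
     While (Less (Imm 0) (Reg 13)) (seqs [Arith Div 14 (Reg 12) (Reg 2), Arith Mul 14 (Reg 14) (Reg 2),
       Arith Sub 14 (Reg 12) (Reg 14), Arith Add 14 (Reg 14) (Imm 3), Store (Reg 14) (Reg 13),
       Arith Mul 12 (Reg 12) (Imm 4), Arith Sub 13 (Reg 13) (Imm 1)]),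
     Store (Imm 0) (Reg 0), Store (Imm 1) (Reg 2), Store (Imm 2) (Reg 12)]"

definition check_com :: "nat \<Rightarrow> com" where
  "check_com l = seqs [Move 15 (Imm 1), Move 11 (Reg 9), Move 12 (Reg 1),
     unroll l (\<lambda>r. seqs [Arith Div 13 (Reg 11) (Reg 1), Arith Mul 14 (Reg 13) (Reg 1), Arith Sub 14 (Reg 11) (Reg 14),
       If (Equal (Reg 14) (Imm 0)) (Move 15 (Imm 0)) Skip, If (Less (Reg 12) (Reg 14)) (Move 15 (Imm 0)) Skip,
       Move 11 (Reg 13), Move 12 (Reg 14)])]"

definition sum_com :: "nat \<Rightarrow> com" where
  "sum_com l = seqs [Arith Add 11 (Reg 7) (Reg 9), Arith Sub 12 (Reg 11) (Reg 5), Load 13 (Reg 12),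
     unroll l (\<lambda>r. seqs [Arith Add 14 (Reg 12) (Reg (33 + 2 * r)), Load 14 (Reg 14), Arith Add 13 (Reg 13) (Reg 14),
       Arith Sub 14 (Reg 12) (Reg (33 + 2 * r)), Load 14 (Reg 14), Arith Add 13 (Reg 13) (Reg 14)]),
     Arith Sub 14 (Reg 12) (Reg 5), Load 14 (Reg 14), Arith Sub 13 (Reg 13) (Reg 14), Store (Reg 11) (Reg 13)]"

definition cell_com :: "nat \<Rightarrow> com" where
  "cell_com l = seqs [check_com l, If (Equal (Reg 15) (Imm 1)) (sum_com l) Skip, Arith Add 9 (Reg 9) (Imm 1)]"

definition layer_com :: "nat \<Rightarrow> com" where
  "layer_com l = seqs [Move 9 (Imm 0), While (Less (Reg 9) (Reg 3)) (cell_com l),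
     Arith Add 7 (Reg 7) (Reg 5), Arith Sub 8 (Reg 8) (Imm 1)]"

definition prep_com :: "nat \<Rightarrow> com" where
  "prep_com l = seqs [modulus_com, log_com, setup_com l, Arith Add 7 (Reg 6) (Reg 5), Arith Add 11 (Reg 7) (Reg 4),
     Store (Reg 11) (Imm 1), Arith Add 7 (Reg 7) (Reg 5), Move 8 (Reg 0),
     While (Less (Imm 0) (Reg 8)) (layer_com l)]"

locale rna_machine =
  fixes l n w :: nat
  assumes l_pos: "1 \<le> l"
    and cells_bound: "prep_cells l n < 2 ^ w"
    and four_power_bound: "4 ^ Suc n \<le> (2::nat) ^ w"
    and count_bound: "(2 * l + 1) ^ Suc n < (2::nat) ^ w"
begin

abbreviation B :: nat where "B \<equiv> n + 3"
definition S :: nat where "S = 2 * B ^ l"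
abbreviation cells :: nat where "cells \<equiv> prep_cells l n"

lemma cells_eq: "cells = 9 * n + 7 + (n + 2) * S"
  by (simp add: prep_cells_def S_def)

lemma B_power_le: "r \<le> l \<Longrightarrow> B ^ r \<le> B ^ l"
  by (intro power_increasing) auto

lemma layer_le: "j \<le> n + 1 \<Longrightarrow> q \<le> 9 * n + 3 \<Longrightarrow> p < S \<Longrightarrow> 3 + q + j * S + p < cells"
proof -
  assume a: "j \<le> n + 1" "q \<le> 9 * n + 3" "p < S"
  have "(j + 1) * S \<le> (n + 2) * S" using a by (intro mult_right_mono) auto
  thus ?thesis using a unfolding cells_eq by simp
qed

lemma S_le_cells: "2 * S + 9 * n + 7 \<le> cells"
proof -
  have "2 * S \<le> (n + 2) * S" by (intro mult_right_mono) auto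
  thus ?thesis unfolding cells_eq by simp
qed

definition setup_regs :: "nat \<Rightarrow> (nat \<Rightarrow> nat) \<Rightarrow> bool" where
  "setup_regs q R \<longleftrightarrow> R 0 = n \<and> R 1 = B \<and> R 2 = q \<and> R 3 = B ^ l \<and> R 4 = encode B l (\<lambda>_. 1) \<and> R 5 = S \<and> R 6 = 3 + q \<and>
     (\<forall>r<l. R (33 + 2 * r) = B ^ r)"

lemma encode_one_less: "encode B r (\<lambda>_. 1) < B ^ r"
  by (rule encode_less) simp

lemma setup_spec:
  assumes R: "R 0 = n" "R 2 = q" and q: "q \<le> 9 * n + 3"
  shows "wp w a b (setup_com l) (\<lambda>R' M' O'' t'. M' = M \<and> O'' = O' \<and> t' \<le> t + 4 * l + 8 \<and> setup_regs q R' \<and>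
    (\<forall>x. x \<notin> {1, 3, 4, 5, 6} \<longrightarrow> (\<forall>i<l. x \<noteq> 33 + 2 * i) \<longrightarrow> R' x = R x)) R M O' t"
proof -
  define I where "I r R' M' O'' t' \<longleftrightarrow> M' = M \<and> O'' = O' \<and> t' \<le> t + 4 + 4 * r \<and> R' 1 = B \<and> R' 3 = B ^ r \<and>
    R' 4 = encode B r (\<lambda>_. 1) \<and> (\<forall>i<r. R' (33 + 2 * i) = B ^ i) \<and>
    (\<forall>x. x \<notin> {1, 3, 4, 5, 6} \<longrightarrow> (\<forall>i<r. x \<noteq> 33 + 2 * i) \<longrightarrow> R' x = R x)" for r R' M' O'' t'
  have Sl: "2 * B ^ l < 2 ^ w" "9 * n + 7 < 2 ^ w" using S_le_cells cells_bound by (auto simp: S_def)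
  have Bl: "B ^ r < 2 ^ w" if "r \<le> l" for r using B_power_le[OF that] Sl by linarith
  have body: "wp w a b (seqs [Move (33 + 2 * r) (Reg 3), Arith Add 4 (Reg 4) (Reg 3), Arith Mul 3 (Reg 3) (Reg 1)])
      (I (Suc r)) R' M' O'' t'" if "r < l" "I r R' M' O'' t'" for r R' M' O'' t'
  proof -
    have 1: "B ^ r < 2 ^ w" "B ^ r * B < 2 ^ w" using Bl[of r] Bl[of "Suc r"] that(1) by (simp_all add: mult.commute)
    have 2: "encode B (Suc r) (\<lambda>_. 1) = encode B r (\<lambda>_. 1) + B ^ r" by (simp add: encode_def)
    have 3: "encode B r (\<lambda>_. 1) + B ^ r < 2 ^ w" using encode_one_less[of "Suc r"] 2 Bl[of "Suc r"] that(1) by simp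
    show ?thesis using that(2) 1 2 3 by (auto simp: I_def less_Suc_eq mult.commute)
  qed
  have I0: "I 0 (R(1 := B, 3 := 1, 4 := 0)) M O' (Suc (Suc (Suc (Suc t))))"
    by (simp add: I_def encode_def)
  have "wp w a b (unroll l (\<lambda>r. seqs [Move (33 + 2 * r) (Reg 3), Arith Add 4 (Reg 4) (Reg 3), Arith Mul 3 (Reg 3) (Reg 1)]))
      (I l) (R(1 := B, 3 := 1, 4 := 0)) M O' (Suc (Suc (Suc t)))"
    by (rule wp_unroll[OF I0 body])
  hence "wp w a b (setup_com l) (\<lambda>R' M' O'' t'. M' = M \<and> O'' = O' \<and> t' \<le> t + 7 + 4 * l \<and> setup_regs q R' \<and>
    (\<forall>x. x \<notin> {1, 3, 4, 5, 6} \<longrightarrow> (\<forall>i<l. x \<noteq> 33 + 2 * i) \<longrightarrow> R' x = R x)) R M O' t"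
    unfolding setup_com_def using R q Sl
    by (simp, elim wp_mono) (auto simp: I_def setup_regs_def S_def)
  thus ?thesis by (rule wp_mono) auto
qed

definition header :: "nat \<Rightarrow> nat \<Rightarrow> (nat \<Rightarrow> nat) \<Rightarrow> bool" where
  "header m q M \<longleftrightarrow> q = 3 ^ Suc m \<and> n < 3 ^ m \<and> q \<le> 9 * n + 3 \<and> M 0 = n \<and> M 1 = q \<and> M 2 = 4 ^ n \<and>
     (\<forall>v. 1 \<le> v \<and> v \<le> n \<longrightarrow> M (3 + 4 ^ (n - v) mod q) = v)"

lemma modulus_exists: "\<exists>m. n < 3 ^ m \<and> m \<le> n \<and> 3 ^ Suc m \<le> 9 * n + 3 \<and> (\<forall>i<m. 3 ^ i \<le> n)"
proof -
  have "n < 3 ^ n" by (induction n) auto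
  then obtain m where m: "n < 3 ^ m" "\<And>i. i < m \<Longrightarrow> \<not> n < 3 ^ i"
    using exists_least_iff[of "\<lambda>m. n < 3 ^ m"] by blast
  have "m \<le> n" using m(2)[of n] \<open>n < 3 ^ n\<close> by (meson not_le)
  moreover have "3 ^ Suc m \<le> 9 * n + 3" using m(2)[of "m - 1"] by (cases m) auto
  moreover have "\<forall>i<m. 3 ^ i \<le> n" using m(2) by (simp add: not_less)
  ultimately show ?thesis using m(1) by blast
qed

lemma modulus_spec:
  assumes R: "R 0 = n" and m: "n < 3 ^ m" "m \<le> n" "3 ^ Suc m \<le> 9 * n + 3" "\<forall>i<m. 3 ^ i \<le> n"
  shows "wp w a b modulus_com (\<lambda>R' M' O'' t'. M' = M \<and> O'' = O' \<and> t' \<le> t + 2 * n + 6 \<and> R' 0 = n \<and> R' 2 = 3 ^ Suc m) R M O' t"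
proof -
  have W: "9 * n + 7 < 2 ^ w" using S_le_cells cells_bound by linarith
  define I where "I i R' M' O'' t' \<longleftrightarrow> M' = M \<and> O'' = O' \<and> t' \<le> t + 3 + 2 * (m - i) \<and> i \<le> m \<and> R' 0 = n \<and>
    R' 11 = 3 * n + 1 \<and> R' 2 = 3 ^ Suc (m - i)" for i :: nat and R' :: "nat \<Rightarrow> nat" and M' O'' t'
  have loop: "wp w a b (While (Less (Reg 2) (Reg 11)) (Arith Mul 2 (Reg 2) (Imm 3)))
      (\<lambda>R' M' O'' t'. M' = M \<and> O'' = O' \<and> t' \<le> t + 2 * n + 5 \<and> R' 0 = n \<and> R' 2 = 3 ^ Suc m) R' M' O'' t'"
    if "I m R' M' O'' t'" for R' M' O'' t'
  proof (rule wp_while[of I, OF that])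
    fix i R' M' O'' t' assume I: "I (Suc i) R' M' O'' t'"
    have s: "m - i = Suc (m - Suc i)" and lt: "m - Suc i < m" using I by (auto simp: I_def)
    have le: "3 ^ (m - Suc i) \<le> n" using m(4) lt by blast
    have "(3::nat) ^ (m - i) * 3 \<le> 9 * n" unfolding s using le by simp
    thus "test_value R' (Less (Reg 2) (Reg 11)) \<and> wp w a b (Arith Mul 2 (Reg 2) (Imm 3)) (I i) R' M' O'' (Suc t')"
      using I le s W by (auto simp: I_def)
  next
    fix R' M' O'' t' assume I: "I 0 R' M' O'' t'"
    show "\<not> test_value R' (Less (Reg 2) (Reg 11)) \<and> (M' = M \<and> O'' = O' \<and> Suc t' \<le> t + 2 * n + 5 \<and> R' 0 = n \<and> R' 2 = 3 ^ Suc m)"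
      using I m(1,2) by (auto simp: I_def)
  qed
  have I0: "I m (R(11 := 3 * n + 1, 2 := 3)) M O' (Suc (Suc (Suc t)))" using R by (simp add: I_def)
  have "wp w a b (While (Less (Reg 2) (Reg 11)) (Arith Mul 2 (Reg 2) (Imm 3)))
      (\<lambda>R' M' O'' t'. M' = M \<and> O'' = O' \<and> t' \<le> t + 2 * n + 5 \<and> R' 0 = n \<and> R' 2 = 3 ^ Suc m) (R(11 := 3 * n + 1, 2 := 3)) M O' (Suc (Suc (Suc t)))"
    by (rule loop[OF I0])
  thus ?thesis unfolding modulus_com_def using R W
    by (simp add: mult.commute)
qed

lemma log_spec:
  assumes R: "R 0 = n" "R 2 = q" and q: "q = 3 ^ Suc m" "n < 3 ^ m" "q \<le> 9 * n + 3" and M: "\<And>x. M x = 0"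
  shows "wp w 0 cells log_com (\<lambda>R' M' O'' t'. O'' = O' \<and> t' \<le> t + 9 * n + 7 \<and> R' 0 = n \<and> R' 2 = q \<and> header m q M' \<and>
    (\<forall>x\<ge>3 + q. M' x = 0)) R M O' t"
proof -
  have W: "9 * n + 7 < 2 ^ w" "9 * n + 7 \<le> cells" using S_le_cells cells_bound by linarith+
  have q0: "0 < q" using q by simp
  define I where "I i R' M' O'' t' \<longleftrightarrow> O'' = O' \<and> t' \<le> t + 2 + 9 * (n - i) \<and> i \<le> n \<and> R' 0 = n \<and> R' 2 = q \<and>
    R' 13 = i \<and> R' 12 = 4 ^ (n - i) \<and> (\<forall>v. i < v \<and> v \<le> n \<longrightarrow> M' (3 + 4 ^ (n - v) mod q) = v) \<and> (\<forall>x\<ge>3 + q. M' x = 0)"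
    for i :: nat and R' :: "nat \<Rightarrow> nat" and M' O'' t'
  let ?body = "seqs [Arith Div 14 (Reg 12) (Reg 2), Arith Mul 14 (Reg 14) (Reg 2),
       Arith Sub 14 (Reg 12) (Reg 14), Arith Add 14 (Reg 14) (Imm 3), Store (Reg 14) (Reg 13),
       Arith Mul 12 (Reg 12) (Imm 4), Arith Sub 13 (Reg 13) (Imm 1)]"
  have loop: "wp w 0 cells (While (Less (Imm 0) (Reg 13)) ?body)
      (\<lambda>R' M' O'' t'. I 0 R' M' O'' (t' - 1) \<and> 0 < t') R' M' O'' t'"
    if "I n R' M' O'' t'" for R' M' O'' t'
  proof (rule wp_while[of I, OF that])
    fix i R' M' O'' t' assume I: "I (Suc i) R' M' O'' t'"
    let ?y = "4 ^ (n - Suc i) :: nat"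
    have s: "n - i = Suc (n - Suc i)" using I by (auto simp: I_def)
    have pw: "?y * 4 < 2 ^ w" "?y < 2 ^ w"
    proof -
      have "?y * 4 = 4 ^ (n - i)" unfolding s by simp
      also have "\<dots> < 4 ^ Suc n" by (intro power_strict_increasing) auto
      finally show "?y * 4 < 2 ^ w" using four_power_bound by (rule less_le_trans)
      thus "?y < 2 ^ w" by simp
    qed
    have d: "?y div q * q \<le> ?y" "?y div q \<le> ?y" "?y - ?y div q * q = ?y mod q" by (simp_all add: minus_div_mult_eq_mod)
    have d4: "?y + 3 - ?y div q * q = ?y mod q + 3" using d(1,3) by linarith
    have md: "?y mod q < q" using q0 by simp
    have new: "(4::nat) ^ (n - v) mod q \<noteq> ?y mod q" if "Suc i < v" "v \<le> n" for v
    proof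
      assume "(4::nat) ^ (n - v) mod q = ?y mod q"
      hence "n - v = n - Suc i" using four_power_mod_inj[OF q(1,2), of "n - v" "n - Suc i"] by simp
      thus False using that by simp
    qed
    have tbl: "(M'(3 + ?y mod q := Suc i)) (3 + 4 ^ (n - v) mod q) = v" if "i < v" "v \<le> n" for v
    proof (cases "v = Suc i")
      case True thus ?thesis by simp
    next
      case False thus ?thesis using that new[of v] I by (simp add: I_def)
    qed
    have si: "Suc i \<le> n" using I by (simp add: I_def)
    have regs: "R' 0 = n" "R' 2 = q" "R' 13 = Suc i" "R' 12 = ?y" using I by (auto simp: I_def)
    have fin: "I i R'' (M'(x := Suc i)) O'' t''" if "R'' 0 = n" "R'' 2 = q" "R'' 13 = i" "R'' 12 = ?y * 4" "t'' \<le> t' + 9"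
      "x = 3 + ?y mod q" for R'' x t''
    proof -
      have "t'' \<le> t + 2 + 9 * (n - i)" using that(5) I s by (simp add: I_def)
      moreover have "?y * 4 = 4 ^ (n - i)" unfolding s by simp
      moreover have "(M'(x := Suc i)) y = 0" if "3 + q \<le> y" for y using that \<open>x = _\<close> md I by (simp add: I_def)
      moreover have "\<forall>v. i < v \<and> v \<le> n \<longrightarrow> (M'(x := Suc i)) (3 + 4 ^ (n - v) mod q) = v" using tbl \<open>x = _\<close> by blast
      ultimately show ?thesis using that(1-4) I unfolding I_def by simp
    qed
    have bnd: "?y div q < 2 ^ w" "?y div q * q < 2 ^ w" "?y mod q < 2 ^ w" "?y mod q + 3 < 2 ^ w" "?y mod q + 3 < cells" "Suc i < 2 ^ w" "i < 2 ^ w"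
      using pw(2) d md W q(3) si by linarith+
    show "test_value R' (Less (Imm 0) (Reg 13)) \<and> wp w 0 cells ?body (I i) R' M' O'' (Suc t')"
      using regs pw bnd by (simp add: d(3) d4 fin)
  next
    fix R' M' O'' t' assume I: "I 0 R' M' O'' t'"
    hence "R' 13 = 0" unfolding I_def by blast
    thus "\<not> test_value R' (Less (Imm 0) (Reg 13)) \<and> (I 0 R' M' O'' (Suc t' - 1) \<and> 0 < Suc t')" using I by simp
  qed
  have I0: "I n (R(12 := 1, 13 := n)) M O' (Suc (Suc t))" using R M by (simp add: I_def)
  have n4: "4 ^ n < (2::nat) ^ w" using four_power_bound by (rule less_le_trans[rotated]) simp
  have "wp w 0 cells (Seq (While (Less (Imm 0) (Reg 13)) ?body) (seqs [Store (Imm 0) (Reg 0), Store (Imm 1) (Reg 2), Store (Imm 2) (Reg 12)]))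
      (\<lambda>R' M' O'' t'. O'' = O' \<and> t' \<le> t + 9 * n + 7 \<and> R' 0 = n \<and> R' 2 = q \<and> header m q M' \<and> (\<forall>x\<ge>3 + q. M' x = 0))
      (R(12 := 1, 13 := n)) M O' (Suc (Suc t))"
  proof (rule wp_seqI[OF loop[OF I0]])
    fix R' M' O'' t' assume "I 0 R' M' O'' (t' - 1) \<and> 0 < t'"
    hence I: "O'' = O'" "t' \<le> t + 3 + 9 * n" "R' 0 = n" "R' 2 = q" "R' 12 = 4 ^ n"
      "\<And>v. 0 < v \<Longrightarrow> v \<le> n \<Longrightarrow> M' (3 + 4 ^ (n - v) mod q) = v" "\<And>x. 3 + q \<le> x \<Longrightarrow> M' x = 0"
      unfolding I_def by auto
    have "header m q (M'(0 := n, 1 := q, 2 := 4 ^ n))" unfolding header_def using q I(6) by simp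
    thus "wp w 0 cells (seqs [Store (Imm 0) (Reg 0), Store (Imm 1) (Reg 2), Store (Imm 2) (Reg 12)])
      (\<lambda>R' M' O'' t'. O'' = O' \<and> t' \<le> t + 9 * n + 7 \<and> R' 0 = n \<and> R' 2 = q \<and> header m q M' \<and> (\<forall>x\<ge>3 + q. M' x = 0)) R' M' O'' t'"
      using W q(3) n4 I(1-5,7) by simp
  qed
  thus ?thesis unfolding log_com_def using R W by simp
qed

lemma digit_step: "p div B ^ r div B = p div B ^ Suc r" "p div B ^ r - p div B ^ r div B * B = digit B p r"
proof -
  show "p div B ^ r div B = p div B ^ Suc r" by (simp add: div_mult2_eq[symmetric] mult.commute)
  show "p div B ^ r - p div B ^ r div B * B = digit B p r" by (simp only: digit_def minus_div_mult_eq_mod)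
qed

lemma check_spec:
  assumes R: "R 1 = B" "R 9 = p" and p: "p < B ^ l"
  shows "wp w a b (check_com l) (\<lambda>R' M' O'' t'. M' = M \<and> O'' = O' \<and> t' \<le> t + 10 * l + 5 \<and> R' 15 = of_bool (valid_code B l p) \<and>
    (\<forall>x. x \<notin> {11, 12, 13, 14, 15} \<longrightarrow> R' x = R x)) R M O' t"
proof -
  have W: "2 * S + 9 * n + 7 < 2 ^ w" using S_le_cells cells_bound by linarith
  hence W': "B < 2 ^ w" "p < 2 ^ w" using p by (auto simp: S_def)
  define I where "I r R' M' O'' t' \<longleftrightarrow> M' = M \<and> O'' = O' \<and> t' \<le> t + 4 + 10 * r \<and> R' 11 = p div B ^ r \<and>
    R' 12 = (if r = 0 then B else digit B p (r - 1)) \<and>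
    R' 15 = of_bool (\<forall>i<r. 0 < digit B p i \<and> (0 < i \<longrightarrow> digit B p i \<le> digit B p (i - 1))) \<and>
    (\<forall>x. x \<notin> {11, 12, 13, 14, 15} \<longrightarrow> R' x = R x)" for r R' M' O'' t'
  let ?body = "\<lambda>r::nat. seqs [Arith Div 13 (Reg 11) (Reg 1), Arith Mul 14 (Reg 13) (Reg 1), Arith Sub 14 (Reg 11) (Reg 14),
       If (Equal (Reg 14) (Imm 0)) (Move 15 (Imm 0)) Skip, If (Less (Reg 12) (Reg 14)) (Move 15 (Imm 0)) Skip,
       Move 11 (Reg 13), Move 12 (Reg 14)]"
  have body: "wp w a b (?body r) (I (Suc r)) R' M' O'' t'" if "r < l" "I r R' M' O'' t'" for r R' M' O'' t'
  proof -
    let ?d = "digit B p r"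
    have dB: "?d < B" by (simp add: digit_def)
    have le: "p div B ^ r < 2 ^ w" "p div B ^ Suc r < 2 ^ w" using W' by (meson div_le_dividend le_less_trans)+
    have le2: "p div B ^ Suc r * B < 2 ^ w"
      using le(1) digit_step(1)[of p r] div_times_less_eq_dividend[of "p div B ^ r" B] by simp
    have R1: "R' 1 = B" "R' 11 = p div B ^ r" "R' 12 = (if r = 0 then B else digit B p (r - 1))" using that(2) R by (auto simp: I_def)
    have step: "(\<forall>i<Suc r. 0 < digit B p i \<and> (0 < i \<longrightarrow> digit B p i \<le> digit B p (i - 1))) \<longleftrightarrow>
        (\<forall>i<r. 0 < digit B p i \<and> (0 < i \<longrightarrow> digit B p i \<le> digit B p (i - 1))) \<and> ?d \<noteq> 0 \<and> \<not> (if r = 0 then B else digit B p (r - 1)) < ?d"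
      using dB by (auto simp: less_Suc_eq)
    have dd: "p div B ^ r - p div B ^ Suc r * B = ?d" using digit_step[of p r] by simp
    show ?thesis using that(2) R1 le le2 dB W' dd unfolding I_def step
      by (simp add: digit_step(1) del: power_Suc) auto
  qed
  have I0: "I 0 (R(15 := 1, 11 := p, 12 := B)) M O' (Suc (Suc (Suc (Suc t))))" by (simp add: I_def)
  have v: "valid_code B l p \<longleftrightarrow> (\<forall>i<l. 0 < digit B p i \<and> (0 < i \<longrightarrow> digit B p i \<le> digit B p (i - 1)))"
    unfolding valid_code_def using p by (auto simp: gr0_conv_Suc)
  have "wp w a b (unroll l ?body) (I l) (R(15 := 1, 11 := p, 12 := B)) M O' (Suc (Suc (Suc t)))"
    by (rule wp_unroll[OF I0 body])
  hence "wp w a b (unroll l ?body) (\<lambda>R' M' O'' t'. M' = M \<and> O'' = O' \<and> Suc t' \<le> t + 10 * l + 5 \<and> R' 15 = of_bool (valid_code B l p) \<and>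
    (\<forall>x. x \<notin> {11, 12, 13, 14, 15} \<longrightarrow> R' x = R x)) (R(15 := 1, 11 := p, 12 := B)) M O' (Suc (Suc (Suc t)))"
    by (rule wp_mono) (simp add: I_def v)
  moreover have "1 < (2::nat) ^ w" using W by linarith
  ultimately show ?thesis unfolding check_com_def using R W' by simp
qed

lemma partial_sum_bound:
  assumes "r \<le> l" "j \<le> n"
  shows "code_table B l j p + (\<Sum>i<r. code_table B l j (p + B ^ i) + code_table B l j (p - B ^ i)) < 2 ^ w"
proof -
  let ?b = "(2 * l + 1) ^ j"
  have "code_table B l j p + (\<Sum>i<r. code_table B l j (p + B ^ i) + code_table B l j (p - B ^ i)) \<le> ?b + (\<Sum>i<r. ?b + ?b)"
    by (intro add_mono sum_mono code_table_bound)
  also have "\<dots> = (2 * r + 1) * ?b" by (simp add: algebra_simps)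
  also have "\<dots> \<le> (2 * l + 1) ^ Suc j" using assms(1) by simp
  also have "\<dots> \<le> (2 * l + 1) ^ Suc n" using assms(2) by (intro power_increasing) auto
  finally show ?thesis using count_bound by (rule le_less_trans)
qed

lemma code_table_less: "j \<le> Suc n \<Longrightarrow> code_table B l j p < 2 ^ w"
  using code_table_bound[of B l j p] power_increasing[of j "Suc n" "2 * l + 1"] count_bound by linarith

lemma valid_code_ge: "valid_code B l p \<Longrightarrow> r < l \<Longrightarrow> B ^ r \<le> p"
  by (rule ccontr) (auto simp: valid_code_def digit_def)

lemma sum_spec:
  assumes R: "setup_regs q R" "R 7 = L" "R 9 = p" and L: "L = 3 + q + Suc (Suc j) * S" and q: "q \<le> 9 * n + 3" and j: "Suc j \<le> n"
    and p: "valid_code B l p"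
    and M: "\<And>i p. i \<le> Suc j \<Longrightarrow> p < S \<Longrightarrow> M (3 + q + i * S + p) = code_table B l i p"
  shows "wp w 0 cells (sum_com l) (\<lambda>R' M' O'' t'. M' = M(L + p := code_table B l (Suc (Suc j)) p) \<and> O'' = O' \<and>
    t' \<le> t + 7 * l + 9 \<and> (\<forall>x. x \<notin> {11, 12, 13, 14} \<longrightarrow> R' x = R x)) R M O' t"
proof -
  define a where "a = 3 + q + Suc j * S + p"
  have La: "L + p = a + S" by (simp add: L a_def)
  have pl: "p < B ^ l" using p by (simp add: valid_code_def)
  have pr: "p + B ^ r < S" "p - B ^ r < S" "p < S" if "r < l" for r
  proof -
    have "B ^ r \<le> B ^ l" using B_power_le that by simp
    thus "p + B ^ r < S" "p - B ^ r < S" "p < S" using pl unfolding S_def by linarith+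
  qed
  have pS: "p < S" using pl by (simp add: S_def)
  have addr: "3 + q + i * S + p' < cells" if "i \<le> Suc (Suc j)" "p' < S" for i p'
    using layer_le[of i q p'] that j q by simp
  have addrw: "3 + q + i * S + p' < 2 ^ w" if "i \<le> Suc (Suc j)" "p' < S" for i p'
    using addr[OF that] cells_bound by linarith
  define I where "I r R' M' O'' t' \<longleftrightarrow> M' = M \<and> O'' = O' \<and> t' \<le> t + 4 + 7 * r \<and> R' 11 = a + S \<and> R' 12 = a \<and>
    R' 13 = code_table B l (Suc j) p + (\<Sum>i<r. code_table B l (Suc j) (p + B ^ i) + code_table B l (Suc j) (p - B ^ i)) \<and>
    (\<forall>x. x \<notin> {11, 12, 13, 14} \<longrightarrow> R' x = R x)" for r R' M' O'' t'
  let ?body = "\<lambda>r. seqs [Arith Add 14 (Reg 12) (Reg (33 + 2 * r)), Load 14 (Reg 14), Arith Add 13 (Reg 13) (Reg 14),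
       Arith Sub 14 (Reg 12) (Reg (33 + 2 * r)), Load 14 (Reg 14), Arith Add 13 (Reg 13) (Reg 14)]"
  have body: "wp w 0 cells (?body r) (I (Suc r)) R' M' O'' t'" if r: "r < l" and I: "I r R' M' O'' t'" for r R' M' O'' t'
  proof -
    have Rr: "R' (33 + 2 * r) = B ^ r" using I R(1) r by (simp add: I_def setup_regs_def)
    have e1: "M (a + B ^ r) = code_table B l (Suc j) (p + B ^ r)"
      using M[of "Suc j" "p + B ^ r"] pr[OF r] unfolding a_def by (simp add: add.assoc)
    have e2: "a - B ^ r = 3 + q + Suc j * S + (p - B ^ r)" using valid_code_ge[OF p r] by (simp add: a_def)
    have e3: "M (a - B ^ r) = code_table B l (Suc j) (p - B ^ r)" unfolding e2 using M[of "Suc j" "p - B ^ r"] pr[OF r] by simp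
    have a1: "a + B ^ r < cells" "a + B ^ r < 2 ^ w" using addr[of "Suc j" "p + B ^ r"] addrw[of "Suc j" "p + B ^ r"] pr[OF r] unfolding a_def by (simp_all add: add.assoc)
    have a2: "a - B ^ r < cells" "a - B ^ r < 2 ^ w" using a1 by simp_all
    have s1: "code_table B l (Suc j) p + (\<Sum>i<r. code_table B l (Suc j) (p + B ^ i) + code_table B l (Suc j) (p - B ^ i)) +
        code_table B l (Suc j) (p + B ^ r) + code_table B l (Suc j) (p - B ^ r) < 2 ^ w"
      using partial_sum_bound[of "Suc r" "Suc j" p] r j by (simp add: add.assoc)
    show ?thesis
      using I Rr e1 e3 a1 a2 s1 unfolding I_def by (auto simp: add.assoc)
  qed
  have I0: "I 0 (R(11 := a + S, 12 := a, 13 := code_table B l (Suc j) p)) M O' (Suc (Suc (Suc (Suc t))))" by (simp add: I_def)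
  have un: "wp w 0 cells (unroll l ?body) (I l) (R(11 := a + S, 12 := a, 13 := code_table B l (Suc j) p)) M O' (Suc (Suc (Suc t)))"
    by (rule wp_unroll[OF I0 body])
  let ?Q = "\<lambda>R' M' O'' t'. M' = M(L + p := code_table B l (Suc (Suc j)) p) \<and> O'' = O' \<and>
    t' \<le> t + 7 * l + 9 \<and> (\<forall>x. x \<notin> {11, 12, 13, 14} \<longrightarrow> R' x = R x)"
  let ?rest = "seqs [Arith Sub 14 (Reg 12) (Reg 5), Load 14 (Reg 14), Arith Sub 13 (Reg 13) (Reg 14), Store (Reg 11) (Reg 13)]"
  have "wp w 0 cells (Seq (unroll l ?body) ?rest) ?Q (R(11 := a + S, 12 := a, 13 := code_table B l (Suc j) p)) M O' (Suc (Suc (Suc t)))"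
  proof (rule wp_seqI[OF un])
    fix R' M' O'' t' assume I: "I l R' M' O'' t'"
    have R5: "R' 5 = S" using I R(1) by (simp add: I_def setup_regs_def)
    have e: "a - S = 3 + q + j * S + p" by (simp add: a_def)
    have e': "a + S = 3 + q + Suc (Suc j) * S + p" by (simp add: a_def)
    have e1: "M (a - S) = code_table B l j p" unfolding e using M[of j p] pS by simp
    have a1: "a - S < cells" "a - S < 2 ^ w" "a + S < cells" using addr[of j p] addrw[of j p] addr[of "Suc (Suc j)" p] pS unfolding e e' by simp_all
    have v: "code_table B l (Suc (Suc j)) p = code_table B l (Suc j) p +
      (\<Sum>i<l. code_table B l (Suc j) (p + B ^ i) + code_table B l (Suc j) (p - B ^ i)) - code_table B l j p" using p by simp
    have lt: "code_table B l (Suc (Suc j)) p < 2 ^ w" "code_table B l j p < 2 ^ w" using code_table_less[of "Suc (Suc j)"] code_table_less[of j] j by simp_all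
    show "wp w 0 cells ?rest ?Q R' M' O'' t'"
      unfolding La using I R5 e1 a1 lt v unfolding I_def by (simp del: code_table.simps)
  qed
  moreover have "a < cells" "a < 2 ^ w" "a + S < 2 ^ w" "M a = code_table B l (Suc j) p" "code_table B l (Suc j) p < 2 ^ w"
    using addr[of "Suc j" p] addrw[of "Suc j" p] addrw[of "Suc (Suc j)" p] M[of "Suc j" p] pS code_table_less[of "Suc j"] j unfolding a_def by simp_all
  moreover have "R 7 + R 9 = a + S" "R 5 = S" using R La by (simp_all add: setup_regs_def)
  ultimately show ?thesis unfolding sum_com_def by (simp del: code_table.simps)
qed

lemma cell_spec:
  assumes R: "setup_regs q R" "R 7 = L" "R 9 = p" and L: "L = 3 + q + Suc (Suc j) * S" and q: "q \<le> 9 * n + 3" and j: "Suc j \<le> n"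
    and p: "p < B ^ l" and zero: "M (L + p) = 0"
    and M: "\<And>i p. i \<le> Suc j \<Longrightarrow> p < S \<Longrightarrow> M (3 + q + i * S + p) = code_table B l i p"
  shows "wp w 0 cells (cell_com l) (\<lambda>R' M' O'' t'. M' = M(L + p := code_table B l (Suc (Suc j)) p) \<and> O'' = O' \<and>
    t' \<le> t + 17 * l + 17 \<and> R' 9 = Suc p \<and> (\<forall>x. x \<notin> {9, 11, 12, 13, 14, 15} \<longrightarrow> R' x = R x)) R M O' t"
proof -
  let ?Q = "\<lambda>R' M' O'' t'. M' = M(L + p := code_table B l (Suc (Suc j)) p) \<and> O'' = O' \<and>
    t' \<le> t + 17 * l + 17 \<and> R' 9 = Suc p \<and> (\<forall>x. x \<notin> {9, 11, 12, 13, 14, 15} \<longrightarrow> R' x = R x)"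
  have R1: "R 1 = B" using R by (simp add: setup_regs_def)
  have W: "Suc p < 2 ^ w" using p S_le_cells cells_bound by (simp add: S_def)
  show ?thesis unfolding cell_com_def seqs.simps
  proof (rule wp_seqI[OF check_spec[OF R1 R(3) p]])
    fix R' M' O'' t' assume A: "M' = M \<and> O'' = O' \<and> t' \<le> t + 10 * l + 5 \<and> R' 15 = of_bool (valid_code B l p) \<and>
      (\<forall>x. x \<notin> {11, 12, 13, 14, 15} \<longrightarrow> R' x = R x)"
    show "wp w 0 cells (Seq (If (Equal (Reg 15) (Imm 1)) (sum_com l) Skip) (Seq (Arith Add 9 (Reg 9) (Imm 1)) Skip)) ?Q R' M' O'' t'"
    proof (cases "valid_code B l p")
      case False
      have "M(L + p := code_table B l (Suc (Suc j)) p) = M" using False zero by (simp add: fun_upd_idem)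
      thus ?thesis using A False W R(3) by (simp del: code_table.simps)
    next
      case True
      have sr: "setup_regs q R'" "R' 7 = L" "R' 9 = p" using A R by (auto simp: setup_regs_def)
      have "wp w 0 cells (sum_com l) (wp w 0 cells (Seq (Arith Add 9 (Reg 9) (Imm 1)) Skip) ?Q) R' M O' (Suc t')"
        by (rule wp_mono[OF sum_spec[OF sr L q j True M]]) (use A W sr(3) R(3) in \<open>auto simp del: code_table.simps\<close>)
      thus ?thesis using A True by (simp del: code_table.simps)
    qed
  qed
qed

definition layers :: "nat \<Rightarrow> nat \<Rightarrow> (nat \<Rightarrow> nat) \<Rightarrow> bool" where
  "layers q j M \<longleftrightarrow> (\<forall>i<j. \<forall>p<S. M (3 + q + i * S + p) = code_table B l i p)"

lemma layer_spec:
  assumes R: "setup_regs q R" "R 7 = 3 + q + Suc (Suc j) * S" "R 8 = Suc m" and q: "q \<le> 9 * n + 3" and j: "Suc j \<le> n"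
    and M: "layers q (Suc (Suc j)) M" and zero: "\<And>x. 3 + q + Suc (Suc j) * S \<le> x \<Longrightarrow> M x = 0" and m: "m < n"
  shows "wp w 0 cells (layer_com l) (\<lambda>R' M' O'' t'. layers q (Suc (Suc (Suc j))) M' \<and> O'' = O' \<and>
    (\<forall>x. 3 + q + Suc (Suc (Suc j)) * S \<le> x \<longrightarrow> M' x = 0) \<and> (\<forall>x<3 + q. M' x = M x) \<and>
    t' \<le> t + (17 * l + 18) * B ^ l + 5 \<and> setup_regs q R' \<and> R' 7 = 3 + q + Suc (Suc (Suc j)) * S \<and> R' 8 = m) R M O' t"
proof -
  define L where "L = 3 + q + Suc (Suc j) * S"
  have L_next: "3 + q + Suc (Suc (Suc j)) * S = L + S" by (simp add: L_def)
  have lower: "3 + q + i * S + p < L" if "i < Suc (Suc j)" "p < S" for i p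
  proof -
    have "(i + 1) * S \<le> Suc (Suc j) * S" using that by (intro mult_right_mono) auto
    thus ?thesis using that by (simp add: L_def)
  qed
  have qL: "3 + q \<le> L" by (simp add: L_def)
  have BS: "B ^ l \<le> S" by (simp add: S_def)
  let ?C = "17 * l + 18"
  define I where "I i R' M' O'' t' \<longleftrightarrow> (\<exists>P. O'' = O' \<and> P + i = B ^ l \<and> t' \<le> t + 1 + ?C * P \<and>
    R' 9 = P \<and> setup_regs q R' \<and> R' 7 = L \<and> R' 8 = Suc m \<and>
    layers q (Suc (Suc j)) M' \<and> (\<forall>p<P. M' (L + p) = code_table B l (Suc (Suc j)) p) \<and>
    (\<forall>x. L + P \<le> x \<longrightarrow> M' x = 0) \<and> (\<forall>x<3 + q. M' x = M x))" for i :: nat and R' :: "nat \<Rightarrow> nat" and M' O'' t'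
  have loop: "wp w 0 cells (While (Less (Reg 9) (Reg 3)) (cell_com l))
      (\<lambda>R' M' O'' t'. 0 < t' \<and> I 0 R' M' O'' (t' - 1)) R' M' O'' t'" if "I (B ^ l) R' M' O'' t'" for R' M' O'' t'
  proof (rule wp_while[of I, OF that])
    fix i R' M' O'' t' assume "I (Suc i) R' M' O'' t'"
    then obtain P where I: "O'' = O'" "P + Suc i = B ^ l" "t' \<le> t + 1 + ?C * P"
      "R' 9 = P" "setup_regs q R'" "R' 7 = L" "R' 8 = Suc m"
      "layers q (Suc (Suc j)) M'" "\<And>p. p < P \<Longrightarrow> M' (L + p) = code_table B l (Suc (Suc j)) p"
      "\<And>x. L + P \<le> x \<Longrightarrow> M' x = 0" "\<And>x. x < 3 + q \<Longrightarrow> M' x = M x" unfolding I_def by blast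
    have p: "P < B ^ l" using I(2) by linarith
    have lay: "M' (3 + q + i * S + p) = code_table B l i p" if "i \<le> Suc j" "p < S" for i p
      using I(8) that by (simp add: layers_def)
    have "wp w 0 cells (cell_com l) (I i) R' M' O'' (Suc t')"
    proof (rule wp_mono[OF cell_spec[OF I(5,6,4) L_def q j p I(10)[OF order_refl] lay]])
      fix R'' M'' O3 t'' assume "M'' = M'(L + P := code_table B l (Suc (Suc j)) P) \<and> O3 = O'' \<and>
        t'' \<le> Suc t' + 17 * l + 17 \<and> R'' 9 = Suc P \<and> (\<forall>x. x \<notin> {9, 11, 12, 13, 14, 15} \<longrightarrow> R'' x = R' x)"
      hence A: "M'' = M'(L + P := code_table B l (Suc (Suc j)) P)" "O3 = O''" "t'' \<le> Suc t' + 17 * l + 17"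
        "R'' 9 = Suc P" "\<And>x. x \<notin> {9, 11, 12, 13, 14, 15} \<Longrightarrow> R'' x = R' x" by blast+
      have "setup_regs q R''" using A(5) I(5) by (simp add: setup_regs_def)
      moreover have "layers q (Suc (Suc j)) M''"
        unfolding layers_def
      proof (intro allI impI)
        fix i' p' assume ip: "i' < Suc (Suc j)" "p' < S"
        have "3 + q + i' * S + p' \<noteq> L + P" using lower[OF ip] by linarith
        thus "M'' (3 + q + i' * S + p') = code_table B l i' p'" unfolding A(1) using I(8) ip by (simp add: layers_def del: code_table.simps)
      qed
      moreover have "t'' \<le> t + 1 + ?C * Suc P" using A(3) I(3) by simp
      moreover have "M'' (L + p') = code_table B l (Suc (Suc j)) p'" if "p' < Suc P" for p'
        unfolding A(1) using that I(9)[of p'] by (cases "p' = P") (simp_all del: code_table.simps)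
      moreover have "M'' x = 0" if "L + Suc P \<le> x" for x
        unfolding A(1) using that I(10)[of x] by (simp del: code_table.simps)
      moreover have "M'' x = M x" if "x < 3 + q" for x
        unfolding A(1) using that I(11)[of x] qL by (simp del: code_table.simps)
      moreover have "R'' 7 = L" "R'' 8 = Suc m" using A(5) I(6,7) by simp_all
      ultimately show "I i R'' M'' O3 t''" unfolding I_def using A(2,4) I(1,2) by (intro exI[of _ "Suc P"] conjI allI impI) auto
    qed
    moreover have "R' 3 = B ^ l" using I(5) by (simp add: setup_regs_def)
    ultimately show "test_value R' (Less (Reg 9) (Reg 3)) \<and> wp w 0 cells (cell_com l) (I i) R' M' O'' (Suc t')"
      using I(4) p by simp
  next
    fix R' M' O'' t' assume I: "I 0 R' M' O'' t'"
    hence "R' 3 = B ^ l" "R' 9 = B ^ l" by (auto simp: I_def setup_regs_def)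
    thus "\<not> test_value R' (Less (Reg 9) (Reg 3)) \<and> (0 < Suc t' \<and> I 0 R' M' O'' (Suc t' - 1))" using I by simp
  qed
  have I0: "I (B ^ l) (R(9 := 0)) M O' (Suc t)" unfolding I_def
    by (rule exI[of _ 0]) (use R M zero in \<open>auto simp: setup_regs_def L_def\<close>)
  let ?rest = "seqs [Arith Add 7 (Reg 7) (Reg 5), Arith Sub 8 (Reg 8) (Imm 1)]"
  let ?Q = "\<lambda>R' M' O'' t'. layers q (Suc (Suc (Suc j))) M' \<and> O'' = O' \<and>
    (\<forall>x. L + S \<le> x \<longrightarrow> M' x = 0) \<and> (\<forall>x<3 + q. M' x = M x) \<and>
    t' \<le> t + ?C * B ^ l + 5 \<and> setup_regs q R' \<and> R' 7 = L + S \<and> R' 8 = m"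
  have "wp w 0 cells (Seq (While (Less (Reg 9) (Reg 3)) (cell_com l)) ?rest) ?Q (R(9 := 0)) M O' (Suc t)"
  proof (rule wp_seqI[OF loop[OF I0]])
    fix R' M' O'' t' assume A: "0 < t' \<and> I 0 R' M' O'' (t' - 1)"
    then obtain P where "O'' = O' \<and> P + 0 = B ^ l \<and> t' - 1 \<le> t + 1 + ?C * P \<and>
      R' 9 = P \<and> setup_regs q R' \<and> R' 7 = L \<and> R' 8 = Suc m \<and>
      layers q (Suc (Suc j)) M' \<and> (\<forall>p<P. M' (L + p) = code_table B l (Suc (Suc j)) p) \<and>
      (\<forall>x. L + P \<le> x \<longrightarrow> M' x = 0) \<and> (\<forall>x<3 + q. M' x = M x)" unfolding I_def by blast
    hence I: "O'' = O'" "P = B ^ l" "t' - 1 \<le> t + 1 + ?C * P"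
      "setup_regs q R'" "R' 7 = L" "R' 8 = Suc m"
      "layers q (Suc (Suc j)) M'" "\<And>p. p < P \<Longrightarrow> M' (L + p) = code_table B l (Suc (Suc j)) p"
      "\<And>x. L + P \<le> x \<Longrightarrow> M' x = 0" "\<And>x. x < 3 + q \<Longrightarrow> M' x = M x"
      unfolding add_0_right by blast+
    have lay: "layers q (Suc (Suc (Suc j))) M'"
      unfolding layers_def
    proof (intro allI impI)
      fix i p assume ip: "i < Suc (Suc (Suc j))" "p < S"
      show "M' (3 + q + i * S + p) = code_table B l i p"
      proof (cases "i = Suc (Suc j)")
        case False thus ?thesis using I(7) ip by (simp add: layers_def)
      next
        case True
        show ?thesis
        proof (cases "p < B ^ l")
          case p: True
          thus ?thesis using I(2) I(8)[of p] unfolding True L_def[symmetric] by (simp del: code_table.simps)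
        next
          case p: False
          moreover have "code_table B l (Suc (Suc j)) p = 0"
            using p by (intro code_table_invalid) (auto simp: valid_code_def)
          ultimately show ?thesis using I(2) I(9)[of "L + p"] unfolding True L_def[symmetric] by (simp del: code_table.simps)
        qed
      qed
    qed
    have z: "M' x = 0" if "L + S \<le> x" for x using I(9)[of x] BS that I(2) by simp
    have "Suc (Suc (Suc j)) * S \<le> (n + 2) * S" using j by (intro mult_right_mono) auto
    hence a: "L + S < 2 ^ w" using q cells_bound unfolding cells_eq L_next[symmetric] by linarith
    have b: "m < 2 ^ w" using m S_le_cells cells_bound by linarith
    have regs: "R' 5 = S" using I(4) by (simp add: setup_regs_def)
    have sr: "setup_regs q (R'(7 := x, 8 := m))" for x using I(4) by (simp add: setup_regs_def)
    have tm: "t' + 3 \<le> t + ?C * B ^ l + 5" using A I(2,3) by simp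
    show "wp w 0 cells ?rest ?Q R' M' O'' t'"
      using lay z a b regs sr tm I(1,5,6,10) by simp
  qed
  thus ?thesis unfolding layer_com_def L_next by simp
qed

definition table_ok :: "nat \<Rightarrow> nat \<Rightarrow> (nat \<Rightarrow> nat) \<Rightarrow> bool" where
  "table_ok m q M \<longleftrightarrow> header m q M \<and> layers q (n + 2) M"

lemma prep_spec:
  assumes R: "R 0 = n" and M: "\<And>x. M x = 0"
  shows "wp w 0 cells (prep_com l) (\<lambda>R' M' O'' t'. (\<exists>m q. table_ok m q M') \<and> t' \<le> t + prep_steps l n) R M O' t"
proof -
  obtain m where m: "n < 3 ^ m" "m \<le> n" "3 ^ Suc m \<le> 9 * n + 3" "\<forall>i<m. 3 ^ i \<le> n" using modulus_exists by blast
  define q where "q = (3::nat) ^ Suc m"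
  have q: "q \<le> 9 * n + 3" using m by (simp add: q_def)
  let ?C = "(17 * l + 18) * B ^ l + 6"
  let ?Q = "\<lambda>R' M' O'' t'. (\<exists>m q. table_ok m q M') \<and> t' \<le> t + prep_steps l n"
  define I where "I i R' M' O'' t' \<longleftrightarrow> i \<le> n \<and> t' \<le> t + 11 * n + 4 * l + 26 + (n - i) * ?C \<and> setup_regs q R' \<and> R' 8 = i \<and>
    R' 7 = 3 + q + (n + 2 - i) * S \<and> layers q (n + 2 - i) M' \<and> header m q M' \<and> (\<forall>x. 3 + q + (n + 2 - i) * S \<le> x \<longrightarrow> M' x = 0)"
    for i :: nat and R' :: "nat \<Rightarrow> nat" and M' and O'' :: "(nat \<times> nat) list" and t'
  have head: "header m q M'" if "header m q M''" "\<And>x. x < 3 + q \<Longrightarrow> M' x = M'' x" for M' M''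
  proof -
    have "q > 0" by (simp add: q_def)
    hence e: "M' (3 + y mod q) = M'' (3 + y mod q)" for y using that(2) by simp
    have e': "M' 0 = M'' 0" "M' 1 = M'' 1" "M' 2 = M'' 2" using that(2) by simp_all
    show ?thesis using that(1) unfolding header_def e e' .
  qed
  have loop: "wp w 0 cells (While (Less (Imm 0) (Reg 8)) (layer_com l)) (\<lambda>R' M' O'' t'. 0 < t' \<and> I 0 R' M' O'' (t' - 1)) R' M' O'' t'"
    if "I n R' M' O'' t'" for R' M' O'' t'
  proof (rule wp_while[of I, OF that])
    fix i R' M' O'' t' assume I: "I (Suc i) R' M' O'' t'"
    obtain j where j: "n + 2 - Suc i = Suc (Suc j)" "n + 2 - i = Suc (Suc (Suc j))" "Suc j \<le> n"
    proof (rule that[of "n - Suc i"])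
      show "n + 2 - Suc i = Suc (Suc (n - Suc i))" "n + 2 - i = Suc (Suc (Suc (n - Suc i)))" "Suc (n - Suc i) \<le> n"
        using I by (auto simp: I_def)
    qed
    have ni: "n - i = Suc (n - Suc i)" using I by (auto simp: I_def)
    have pre: "setup_regs q R'" "R' 7 = 3 + q + Suc (Suc j) * S" "R' 8 = Suc i" "layers q (Suc (Suc j)) M'"
      "\<And>x. 3 + q + Suc (Suc j) * S \<le> x \<Longrightarrow> M' x = 0" "i < n" "header m q M'" using I unfolding I_def j by auto
    have "wp w 0 cells (layer_com l) (I i) R' M' O'' (Suc t')"
    proof (rule wp_mono[OF layer_spec[OF pre(1-3) q j(3) pre(4-6)]])
      fix R'' M'' O3 t'' assume A: "layers q (Suc (Suc (Suc j))) M'' \<and> O3 = O'' \<and>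
        (\<forall>x. 3 + q + Suc (Suc (Suc j)) * S \<le> x \<longrightarrow> M'' x = 0) \<and> (\<forall>x<3 + q. M'' x = M' x) \<and>
        t'' \<le> Suc t' + (17 * l + 18) * B ^ l + 5 \<and> setup_regs q R'' \<and> R'' 7 = 3 + q + Suc (Suc (Suc j)) * S \<and> R'' 8 = i"
      have "header m q M''" using head[OF pre(7)] A by blast
      moreover have "t'' \<le> t + 11 * n + 4 * l + 26 + (n - i) * ?C" using A I unfolding I_def ni by simp
      ultimately show "I i R'' M'' O3 t''" using A pre(6) unfolding I_def j by simp
    qed
    thus "test_value R' (Less (Imm 0) (Reg 8)) \<and> wp w 0 cells (layer_com l) (I i) R' M' O'' (Suc t')" using pre(3) by simp
  next
    fix R' M' O'' t' assume I: "I 0 R' M' O'' t'"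
    thus "\<not> test_value R' (Less (Imm 0) (Reg 8)) \<and> (0 < Suc t' \<and> I 0 R' M' O'' (Suc t' - 1))" by (simp add: I_def)
  qed
  show ?thesis unfolding prep_com_def seqs.simps
  proof (rule wp_seqI[OF modulus_spec[where R = R and m = m, OF R m]])
    fix R1 :: "nat \<Rightarrow> nat" and M1 O1 t1 assume A1: "M1 = M \<and> O1 = O' \<and> t1 \<le> t + 2 * n + 6 \<and> R1 0 = n \<and> R1 2 = 3 ^ Suc m"
    have R1: "R1 0 = n" "R1 2 = q" using A1 by (auto simp: q_def)
    have M1: "\<And>x. M1 x = 0" using A1 M by simp
    show "wp w 0 cells (Seq log_com (Seq (setup_com l) (Seq (Arith Add 7 (Reg 6) (Reg 5)) (Seq (Arith Add 11 (Reg 7) (Reg 4))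
      (Seq (Store (Reg 11) (Imm 1)) (Seq (Arith Add 7 (Reg 7) (Reg 5)) (Seq (Move 8 (Reg 0)) (Seq (While (Less (Imm 0) (Reg 8)) (layer_com l)) Skip))))))))
      ?Q R1 M1 O1 t1"
    proof (rule wp_seqI[OF log_spec[OF R1 q_def m(1) q M1]])
      fix R2 :: "nat \<Rightarrow> nat" and M2 O2 t2 assume A2: "O2 = O1 \<and> t2 \<le> t1 + 9 * n + 7 \<and> R2 0 = n \<and> R2 2 = q \<and> header m q M2 \<and> (\<forall>x\<ge>3 + q. M2 x = 0)"
      have R2: "R2 0 = n" "R2 2 = q" using A2 by auto
      show "wp w 0 cells (Seq (setup_com l) (Seq (Arith Add 7 (Reg 6) (Reg 5)) (Seq (Arith Add 11 (Reg 7) (Reg 4))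
        (Seq (Store (Reg 11) (Imm 1)) (Seq (Arith Add 7 (Reg 7) (Reg 5)) (Seq (Move 8 (Reg 0)) (Seq (While (Less (Imm 0) (Reg 8)) (layer_com l)) Skip)))))))
        ?Q R2 M2 O2 t2"
      proof (rule wp_seqI[OF setup_spec[OF R2 q]])
        fix R3 :: "nat \<Rightarrow> nat" and M3 O3 t3 assume A3: "M3 = M2 \<and> O3 = O2 \<and> t3 \<le> t2 + 4 * l + 8 \<and> setup_regs q R3 \<and>
          (\<forall>x. x \<notin> {1, 3, 4, 5, 6} \<longrightarrow> (\<forall>i<l. x \<noteq> 33 + 2 * i) \<longrightarrow> R3 x = R2 x)"
        have regs: "R3 0 = n" "R3 4 = encode B l (\<lambda>_. 1)" "R3 5 = S" "R3 6 = 3 + q" using A3 by (auto simp: setup_regs_def)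
        let ?e = "encode B l (\<lambda>_. 1)"
        have eS: "?e < S" using encode_one_less[of l] by (simp add: S_def)
        define M4 where "M4 = M2(3 + q + S + ?e := 1)"
        define R4 where "R4 = R3(7 := 3 + q + 2 * S, 11 := 3 + q + S + ?e, 8 := n)"
        have sr: "setup_regs q R4" using A3 by (auto simp: setup_regs_def R4_def)
        have lay: "layers q (n + 2 - n) M4" unfolding layers_def
        proof (intro allI impI)
          fix i p assume ip: "i < n + 2 - n" "p < S"
          have "i = 0 \<or> i = 1" using ip by auto
          thus "M4 (3 + q + i * S + p) = code_table B l i p" using ip A2 by (auto simp: M4_def)
        qed
        have hd4: "header m q M4" by (rule head[of M2]) (use A2 in \<open>auto simp: M4_def\<close>)
        have z4: "M4 x = 0" if "3 + q + (n + 2 - n) * S \<le> x" for x using that A2 eS by (auto simp: M4_def)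
        have I0: "I n R4 M4 O3 (Suc (Suc (Suc (Suc (Suc t3)))))"
          using sr lay hd4 z4 A1 A2 A3 by (auto simp: I_def R4_def)
        have fin: "wp w 0 cells (Seq (While (Less (Imm 0) (Reg 8)) (layer_com l)) Skip) ?Q R4 M4 O3 (Suc (Suc (Suc (Suc (Suc t3)))))"
        proof (rule wp_seqI[OF loop[OF I0]])
          fix R' M' O'' t' assume A: "0 < t' \<and> I 0 R' M' O'' (t' - 1)"
          hence "table_ok m q M'" by (simp add: I_def table_ok_def)
          moreover have "t' - 1 \<le> t + 11 * n + 4 * l + 26 + n * ?C" using A unfolding I_def by simp
          hence "Suc t' \<le> t + prep_steps l n" unfolding prep_steps_def by linarith
          ultimately show "wp w 0 cells Skip ?Q R' M' O'' t'" by auto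
        qed
        have W: "3 + q + S + ?e < cells" "3 + q + 2 * S < 2 ^ w" "n < 2 ^ w" "3 + q + S < 2 ^ w"
          using S_le_cells cells_bound q eS by linarith+
        have eqR: "R3(7 := 3 + q + S, 11 := 3 + q + S + ?e, 7 := 3 + q + S + S, 8 := n) = R4"
          by (auto simp: R4_def fun_eq_iff)
        show "wp w 0 cells (Seq (Arith Add 7 (Reg 6) (Reg 5)) (Seq (Arith Add 11 (Reg 7) (Reg 4))
        (Seq (Store (Reg 11) (Imm 1)) (Seq (Arith Add 7 (Reg 7) (Reg 5)) (Seq (Move 8 (Reg 0)) (Seq (While (Less (Imm 0) (Reg 8)) (layer_com l)) Skip))))))
        ?Q R3 M3 O3 t3"
          using fin W cells_bound A3 regs eqR M4_def by (simp add: fun_upd_twist)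
      qed
    qed
  qed
qed

end

subsection \<open>Generation\<close>

text \<open>The largest entry of a row is the lowest bit of its mask \<open>z\<close>, namely \<open>z - (z & (z - 1))\<close>; dividing and
  multiplying by the bit of \<open>x\<close> first removes the entries above \<open>x\<close>, so the predecessor takes constant time.\<close>

definition pop_first_com :: "nat \<Rightarrow> com" where
  "pop_first_com r = seqs [Arith Sub 12 (Reg (32 + 2 * r)) (Imm 1), Arith And 12 (Reg (32 + 2 * r)) (Reg 12),
     Arith Sub 13 (Reg (32 + 2 * r)) (Reg 12), Move (32 + 2 * r) (Reg 12)]"

definition pop_next_com :: "nat \<Rightarrow> com" where
  "pop_next_com r = seqs [Arith Div 12 (Reg (32 + 2 * r)) (Reg 13), Arith Mul 12 (Reg 12) (Reg 13),
     Arith Sub 14 (Reg 12) (Imm 1), Arith And 14 (Reg 12) (Reg 14), Arith Sub 14 (Reg 12) (Reg 14),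
     Arith Sub (32 + 2 * r) (Reg (32 + 2 * r)) (Reg 14), Arith Add (32 + 2 * r) (Reg (32 + 2 * r)) (Reg 13), Move 13 (Reg 14)]"

primrec pops_com :: "nat \<Rightarrow> com" where
  "pops_com 0 = Skip"
| "pops_com (Suc r) = Seq (pop_next_com r) (pops_com r)"

definition print_com :: com where
  "print_com = seqs [Arith Div 12 (Reg 13) (Reg 2), Arith Mul 12 (Reg 12) (Reg 2), Arith Sub 12 (Reg 13) (Reg 12),
     Arith Add 12 (Reg 12) (Imm 3), Load 12 (Reg 12), Print (Reg 12) (Reg 8)]"

fun move_com :: "move \<Rightarrow> com" where
  "move_com Stay = Skip"
| "move_com (Up r) = seqs [Arith Add 9 (Reg 9) (Reg (33 + 2 * r)), Arith Add (32 + 2 * r) (Reg (32 + 2 * r)) (Reg 18)]"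
| "move_com (Down r) = seqs [Arith Sub 9 (Reg 9) (Reg (33 + 2 * r)), pop_first_com r, pops_com r, print_com]"

fun count_com :: "move \<Rightarrow> com" where
  "count_com Stay = Load 12 (Reg 11)"
| "count_com (Up r) = (if r = 0 then seqs [Arith Add 12 (Reg 11) (Imm 1), Load 12 (Reg 12), Arith Sub 13 (Reg 11) (Reg 5),
     Load 13 (Reg 13), Arith Sub 12 (Reg 12) (Reg 13)] else seqs [Arith Add 12 (Reg 11) (Reg (33 + 2 * r)), Load 12 (Reg 12)])"
| "count_com (Down r) = seqs [Arith Sub 12 (Reg 11) (Reg (33 + 2 * r)), Load 12 (Reg 12)]"

primrec choice_com :: "move list \<Rightarrow> com" where
  "choice_com [] = Skip"
| "choice_com (m # ms) = Seq (count_com m) (If (Less (Reg 10) (Reg 12)) (move_com m)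
     (Seq (Arith Sub 10 (Reg 10) (Reg 12)) (choice_com ms)))"

definition moves :: "nat \<Rightarrow> move list" where
  "moves l = Stay # Up 0 # map Up [1..<l] @ map Down [1..<l] @ [Down 0]"

definition step_com :: "nat \<Rightarrow> com" where
  "step_com l = seqs [Arith Add 8 (Reg 8) (Imm 1), Arith Div 18 (Reg 18) (Imm 4), Arith Sub 7 (Reg 7) (Reg 5),
     Arith Add 11 (Reg 7) (Reg 9), choice_com (moves l)]"

definition init_com :: "nat \<Rightarrow> com" where
  "init_com l = seqs [Load 0 (Imm 0), Load 2 (Imm 1), Load 18 (Imm 2), setup_com l,
     unroll l (\<lambda>r. Move (32 + 2 * r) (Imm 0)), Move 9 (Reg 4), Arith Mul 7 (Reg 0) (Reg 5), Arith Add 7 (Reg 7) (Reg 5),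
     Arith Add 7 (Reg 7) (Reg 6), Move 8 (Imm 0), Arith Add 11 (Reg 7) (Reg 9), Load 11 (Reg 11)]"

definition gen_steps :: "nat \<Rightarrow> nat \<Rightarrow> nat" where
  "gen_steps l n = 5 * l + 22 + n * (27 * l + 32)"

definition gen_com :: "nat \<Rightarrow> com" where
  "gen_com l = Seq (init_com l) (Seq (Random 10 (Reg 11)) (While (Less (Reg 8) (Reg 0)) (step_com l)))"

lemma moves_choices: "map fst (all_choices l False j \<mu>) = moves l"
  by (simp add: all_choices_def choices_def moves_def comp_def)

lemma choice_spec:
  assumes count: "\<And>m c R' t'. (m, c) \<in> set cs \<Longrightarrow> (\<And>x. x \<notin> {10, 12, 13} \<Longrightarrow> R' x = R x) \<Longrightarrow>
      wp w a b (count_com m) (\<lambda>R'' M' O'' t''. M' = M \<and> O'' = O' \<and> t'' \<le> t' + 6 \<and> R'' 12 = c \<and> (\<forall>x. x \<notin> {12, 13} \<longrightarrow> R'' x = R' x)) R' M O' t'"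
    and u: "u < sum_list (map snd cs)" "u < 2 ^ w" "R 10 = u"
    and move: "\<And>m v R' t'. select cs u = (m, v) \<Longrightarrow> R' 10 = v \<Longrightarrow> (\<And>x. x \<notin> {10, 12, 13} \<Longrightarrow> R' x = R x) \<Longrightarrow>
      t' \<le> t + 9 * length cs \<Longrightarrow> wp w a b (move_com m) Q R' M O' t'"
  shows "wp w a b (choice_com (map fst cs)) Q R M O' t"
  using assms
proof (induction cs arbitrary: u R t)
  case (Cons p cs)
  obtain m c where p: "p = (m, c)" by fastforce
  have "wp w a b (count_com m) (\<lambda>R'' M' O'' t''. M' = M \<and> O'' = O' \<and> t'' \<le> t + 6 \<and> R'' 12 = c \<and> (\<forall>x. x \<notin> {12, 13} \<longrightarrow> R'' x = R x)) R M O' t"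
    by (rule Cons.prems(1)) (auto simp: p)
  hence "wp w a b (Seq (count_com m) (If (Less (Reg 10) (Reg 12)) (move_com m)
     (Seq (Arith Sub 10 (Reg 10) (Reg 12)) (choice_com (map fst cs))))) Q R M O' t"
  proof (rule wp_seqI)
    fix R' M' O'' t' assume A: "M' = M \<and> O'' = O' \<and> t' \<le> t + 6 \<and> R' 12 = c \<and> (\<forall>x. x \<notin> {12, 13} \<longrightarrow> R' x = R x)"
    have R10: "R' 10 = u" using A Cons.prems(4) by simp
    show "wp w a b (If (Less (Reg 10) (Reg 12)) (move_com m)
     (Seq (Arith Sub 10 (Reg 10) (Reg 12)) (choice_com (map fst cs)))) Q R' M' O'' t'"
    proof (cases "u < c")
      case True
      have "wp w a b (move_com m) Q R' M O' (Suc t')"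
        by (rule Cons.prems(5)[of m u]) (use A R10 True p in auto)
      thus ?thesis using A R10 True by simp
    next
      case False
      have "wp w a b (choice_com (map fst cs)) Q (R'(10 := u - c)) M O' (Suc (Suc t'))"
      proof (rule Cons.IH)
        show "u - c < sum_list (map snd cs)" "u - c < 2 ^ w" "(R'(10 := u - c)) 10 = u - c"
          using Cons.prems(2,3) False p by auto
      next
        fix m' c' R'' t'' assume "(m', c') \<in> set cs" "\<And>x. x \<notin> {10, 12, 13} \<Longrightarrow> R'' x = (R'(10 := u - c)) x"
        thus "wp w a b (count_com m') (\<lambda>R3 M' O'' t3. M' = M \<and> O'' = O' \<and> t3 \<le> t'' + 6 \<and> R3 12 = c' \<and> (\<forall>x. x \<notin> {12, 13} \<longrightarrow> R3 x = R'' x)) R'' M O' t''"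
          using A by (intro Cons.prems(1)) auto
      next
        fix m' v R'' t'' assume B: "select cs (u - c) = (m', v)" "R'' 10 = v" "\<And>x. x \<notin> {10, 12, 13} \<Longrightarrow> R'' x = (R'(10 := u - c)) x"
          "t'' \<le> Suc (Suc t') + 9 * length cs"
        show "wp w a b (move_com m') Q R'' M O' t''"
          by (rule Cons.prems(5)[of m' v]) (use A B False p in auto)
      qed
      moreover have "u - c < 2 ^ w" using Cons.prems(3) by simp
      ultimately show ?thesis using A R10 False by simp
    qed
  qed
  thus ?case by (simp add: p)
qed simp

context rna_machine
begin

definition rows_ok :: "tableau \<Rightarrow> (nat \<Rightarrow> nat) \<Rightarrow> bool" where
  "rows_ok T R \<longleftrightarrow> (\<forall>r<l. R (32 + 2 * r) = row_mask n (T r))"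

lemma four_power_less: "i \<le> n \<Longrightarrow> 4 ^ i < (2::nat) ^ w"
proof -
  assume "i \<le> n"
  hence "(4::nat) ^ i < 4 ^ Suc n" by (intro power_strict_increasing) auto
  thus ?thesis using four_power_bound by (rule less_le_trans)
qed

lemma row_mask_less: "R \<subseteq> {1..n} \<Longrightarrow> row_mask n R < 2 ^ w"
  using row_mask_bound[of R n] four_power_less[of n] by linarith

lemma pops_spec:
  assumes T: "is_tableau T" "T \<rho> \<noteq> {}" and ent: "entries T \<subseteq> {1..n}" and \<rho>: "\<rho> < l"
  shows "j \<le> \<rho> \<Longrightarrow> R 13 = 4 ^ (n - pop T \<rho> (\<rho> - j)) \<Longrightarrow> (\<And>i. i < j \<Longrightarrow> R (32 + 2 * i) = row_mask n (T i)) \<Longrightarrow>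
    wp w a b (pops_com j) (\<lambda>R' M' O'' t'. M' = M \<and> O'' = O' \<and> t' \<le> t + 9 * j + 1 \<and> R' 13 = 4 ^ (n - pop T \<rho> \<rho>) \<and>
      (\<forall>i<j. R' (32 + 2 * i) = row_mask n (row_delete T \<rho> i)) \<and>
      (\<forall>x. x \<notin> {12, 13, 14} \<longrightarrow> (\<forall>i<j. x \<noteq> 32 + 2 * i) \<longrightarrow> R' x = R x)) R M O' t"
proof (induction j arbitrary: R t)
  case 0
  thus ?case by simp
next
  case (Suc j)
  let ?i = "\<rho> - Suc j"
  have Si: "Suc ?i = \<rho> - j" and \<rho>i: "\<rho> - ?i = Suc j" "\<rho> - Suc ?i = j" using Suc.prems(1) by auto
  define x y where "x = pop T \<rho> ?i" and "y = pop T \<rho> (\<rho> - j)"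
  have sub: "T r \<subseteq> {1..n}" for r using ent by (auto simp: entries_def)
  have fin: "finite (T j)" using tableau_finite_row[OF T(1)] .
  have xin: "x \<in> T (Suc j)" using pop_in(1)[OF T, of ?i] Suc.prems(1) \<rho>i by (simp add: x_def)
  have yin: "y \<in> T j" using pop_in(1)[OF T, of "\<rho> - j"] Suc.prems(1) by (simp add: y_def)
  have yx: "y < x" using pop_in(2)[OF T, of ?i] Suc.prems(1) unfolding x_def y_def Si[symmetric] by simp
  have xnot: "x \<notin> T j" using tableau_disjoint[OF T(1) xin, of j] by auto
  have xn: "1 \<le> x" "x \<le> n" "1 \<le> y" "y \<le> n" using subsetD[OF sub xin] subsetD[OF sub yin] by auto
  let ?E = "{v \<in> T j. v \<le> x}"
  have Max: "Max ?E = y"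
  proof (rule Max_eqI)
    show "finite ?E" using fin by simp
    show "y \<in> ?E" using yin yx by simp
    fix z assume z: "z \<in> ?E"
    hence "z < x" using xnot by (auto simp: le_less)
    thus "z \<le> y" using pop_in(3)[OF T, of ?i z] z Suc.prems(1) \<rho>i(2) unfolding x_def y_def Si[symmetric] by simp
  qed
  have Esub: "?E \<subseteq> {1..n}" "?E \<noteq> {}" using sub yin yx by auto
  let ?mj = "row_mask n (T j)" and ?me = "row_mask n ?E" and ?bx = "4 ^ (n - x) :: nat" and ?by = "4 ^ (n - y) :: nat"
  have trunc: "?mj div ?bx * ?bx = ?me" using row_mask_truncate[OF sub xn(1,2)] .
  have low: "and ?me (?me - Suc 0) = ?me - ?by" "?by \<le> ?me" using row_mask_lowest[OF Esub] unfolding Max by simp_all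
  have del: "row_delete T \<rho> j = insert x (T j - {y})"
    using Suc.prems(1) unfolding row_delete_def x_def y_def by simp
  have rm: "row_mask n (T j - {y}) = ?mj - ?by" using row_mask_remove[OF fin yin] .
  have new: "row_mask n (row_delete T \<rho> j) = ?mj - ?by + ?bx"
    unfolding del using row_mask_insert[of "T j - {y}" x n] fin xnot rm by simp
  have delsub: "row_delete T \<rho> j \<subseteq> {1..n}" unfolding del using sub xn by auto
  have b: "?mj < 2 ^ w" "?me < 2 ^ w" "?mj - ?by + ?bx < 2 ^ w" "?by < 2 ^ w" "?mj div ?bx < 2 ^ w"
    using row_mask_less[OF sub] row_mask_less[OF Esub(1)] row_mask_less[OF delsub] four_power_less[of "n - y"] new
    by (auto intro: le_less_trans[OF div_le_dividend])
  have b2: "?me - Suc 0 < 2 ^ w" "?me - ?by < 2 ^ w" "?mj - ?by < 2 ^ w" using b by simp_all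
  have lowy: "?me - (?me - ?by) = ?by" using low(2) by simp
  have R13: "R 13 = ?bx" using Suc.prems(2) by (simp add: x_def)
  have Rj: "R (32 + 2 * j) = ?mj" using Suc.prems(3)[of j] by simp
  define R1 where "R1 = R(12 := ?me, 14 := ?by, 32 + 2 * j := ?mj - ?by + ?bx, 13 := ?by)"
  define Q where "Q = (\<lambda>R' M' O'' t'. M' = M \<and> O'' = O' \<and> t' \<le> t + 9 * Suc j + 1 \<and> R' 13 = 4 ^ (n - pop T \<rho> \<rho>) \<and>
      (\<forall>i<Suc j. R' (32 + 2 * i) = row_mask n (row_delete T \<rho> i)) \<and>
      (\<forall>x. x \<notin> {12, 13, 14} \<longrightarrow> (\<forall>i<Suc j. x \<noteq> 32 + 2 * i) \<longrightarrow> R' x = R x))"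
  have rest: "wp w a b (pops_com j) Q R1 M O' t1" if t1: "t1 \<le> t + 9" for t1
  proof (rule wp_mono[OF Suc.IH[of R1 t1]])
    show "j \<le> \<rho>" using Suc.prems(1) by simp
    show "R1 13 = 4 ^ (n - pop T \<rho> (\<rho> - j))" by (simp add: R1_def y_def)
    show "R1 (32 + 2 * i) = row_mask n (T i)" if "i < j" for i using that Suc.prems(3)[of i] by (simp add: R1_def)
    fix R' M' O'' t' assume A: "M' = M \<and> O'' = O' \<and> t' \<le> t1 + 9 * j + 1 \<and> R' 13 = 4 ^ (n - pop T \<rho> \<rho>) \<and>
      (\<forall>i<j. R' (32 + 2 * i) = row_mask n (row_delete T \<rho> i)) \<and>
      (\<forall>x. x \<notin> {12, 13, 14} \<longrightarrow> (\<forall>i<j. x \<noteq> 32 + 2 * i) \<longrightarrow> R' x = R1 x)"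
    have "R' (32 + 2 * j) = R1 (32 + 2 * j)" using A by auto
    hence "R' (32 + 2 * j) = row_mask n (row_delete T \<rho> j)" using new by (simp add: R1_def)
    moreover have "R' x = R x" if "x \<notin> {12, 13, 14}" "\<forall>i<Suc j. x \<noteq> 32 + 2 * i" for x
    proof -
      have "R' x = R1 x" using A that by auto
      thus ?thesis using that by (simp add: R1_def)
    qed
    ultimately show "Q R' M' O'' t'" unfolding Q_def using A t1 by (auto simp: less_Suc_eq)
  qed
  have "wp w a b (pop_next_com j) (wp w a b (pops_com j) Q) R M O' t"
    using R13 Rj b b2 unfolding pop_next_com_def by (simp add: trunc low lowy rest[unfolded R1_def])
  thus ?case unfolding Q_def by simp
qed

lemma mask_power_distinct [simp]: "33 + 2 * i \<noteq> 32 + 2 * (j::nat)" "32 + 2 * j \<noteq> 33 + 2 * i"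
  by presburger+

lemma print_spec:
  assumes hd: "header m q M" and R: "R 13 = 4 ^ (n - v)" "R 2 = q" and v: "1 \<le> v" "v \<le> n"
  shows "wp w a cells print_com (\<lambda>R' M' O'' t'. M' = M \<and> O'' = O' @ [(v, R 8)] \<and> t' \<le> t + 7 \<and>
    (\<forall>x. x \<noteq> 12 \<longrightarrow> R' x = R x)) R M O' t"
proof -
  let ?y = "4 ^ (n - v) :: nat"
  have W: "9 * n + 7 < 2 ^ w" "9 * n + 7 \<le> cells" using S_le_cells cells_bound by linarith+
  have q: "0 < q" "q \<le> 9 * n + 3" using hd by (auto simp: header_def)
  have y: "?y < 2 ^ w" by (rule four_power_less) simp
  have d: "?y div q * q \<le> ?y" "?y div q \<le> ?y" "?y - ?y div q * q = ?y mod q" by (simp_all add: minus_div_mult_eq_mod)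
  have d4: "?y + 3 - ?y div q * q = ?y mod q + 3" using d(1,3) by linarith
  have md: "?y mod q < q" using q by simp
  have b: "?y div q < 2 ^ w" "?y div q * q < 2 ^ w" "?y mod q < 2 ^ w" "?y mod q + 3 < 2 ^ w" "?y mod q + 3 < cells" "v < 2 ^ w"
    using y d md W q v by linarith+
  have "M (3 + ?y mod q) = v" using hd v unfolding header_def by blast
  hence Mv: "M (?y mod q + 3) = v" by (simp only: add.commute)
  show ?thesis unfolding print_com_def using R b by (simp add: d(3) d4 Mv)
qed

lemma move_spec:
  assumes T: "is_tableau T" and ent: "entries T \<subseteq> {1..s}" and s: "s < n" and leg: "legal l (shape T) mv"
    and sh: "is_shape l (shape T)" and bound: "shape T 0 + 2 < B" and hd: "header m q M"
    and R: "setup_regs q R" "rows_ok T R" "R 9 = shape_code B l (shape T)" "R 8 = Suc s" "R 18 = 4 ^ (n - Suc s)"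
  shows "wp w a cells (move_com mv) (\<lambda>R' M' O'' t'. M' = M \<and> set O'' = set O' \<union> step_arcs (Suc s) mv T \<and> t' \<le> t + 9 * l + 16 \<and>
    setup_regs q R' \<and> rows_ok (tableau_step (Suc s) mv T) R' \<and> R' 9 = shape_code B l (move_shape mv (shape T)) \<and>
    R' 7 = R 7 \<and> R' 8 = R 8 \<and> R' 10 = R 10 \<and> R' 18 = R 18) R M O' t"
proof -
  have W: "2 * S + 9 * n + 7 < 2 ^ w" using S_le_cells cells_bound by linarith
  have sub: "T r \<subseteq> {1..s}" for r using ent by (auto simp: entries_def)
  have subn: "T r \<subseteq> {1..n}" for r using sub[of r] s by auto
  have fin: "finite (T r)" for r using tableau_finite_row[OF T] .
  have code: "shape_code B l \<mu> < 2 ^ w" if "is_shape l \<mu>" "\<mu> 0 + 1 < B" for \<mu>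
    using shape_code_less[OF that] W by (simp add: S_def)
  show ?thesis
  proof (cases mv)
    case Stay
    thus ?thesis using R by simp
  next
    case (Up r)
    have r: "r < l" using legal_Up_bound leg Up by blast
    have shU: "is_shape l (move_shape (Up r) (shape T))" using leg Up by simp
    have c: "R 9 + B ^ r = shape_code B l (move_shape (Up r) (shape T))" using R(3) shape_code_Up[OF r] by simp
    have cb: "shape_code B l (move_shape (Up r) (shape T)) < 2 ^ w" by (rule code[OF shU]) (use bound in auto)
    have Rr: "R (33 + 2 * r) = B ^ r" "R (32 + 2 * r) = row_mask n (T r)" using R(1,2) r by (auto simp: setup_regs_def rows_ok_def)
    have "Suc s \<notin> T r" using sub[of r] by auto
    hence mk: "row_mask n (insert (Suc s) (T r)) = row_mask n (T r) + 4 ^ (n - Suc s)" using row_mask_insert fin by blast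
    have mb: "row_mask n (T r) + 4 ^ (n - Suc s) < 2 ^ w" unfolding mk[symmetric] using subn[of r] s by (intro row_mask_less) auto
    have rows: "rows_ok (tableau_step (Suc s) (Up r) T) (R(9 := x, 32 + 2 * r := row_mask n (T r) + 4 ^ (n - Suc s)))" for x
      using R(2) mk by (auto simp: rows_ok_def)
    have sr: "setup_regs q (R(9 := x, 32 + 2 * r := y))" for x y using R(1) by (simp add: setup_regs_def)
    show ?thesis unfolding Up using Rr cb mb rows sr R(4,5)
      by (simp add: c del: move_shape.simps tableau_step.simps)
  next
    case (Down r)
    have pos: "0 < shape T r" and shD: "is_shape l (move_shape (Down r) (shape T))" using leg Down by auto
    have r: "r < l" using legal_Down_bound[OF sh] leg Down by blast
    have ne: "T r \<noteq> {}" using pos by (auto simp: shape_def)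
    have c: "R 9 - B ^ r = shape_code B l (move_shape (Down r) (shape T))"
      using R(3) shape_code_Down[where \<mu> = "shape T" and B = B, OF r pos] by simp
    have cb: "shape_code B l (move_shape (Down r) (shape T)) < 2 ^ w" by (rule code[OF shD]) (use bound in auto)
    have Rr: "R (33 + 2 * r) = B ^ r" "R (32 + 2 * r) = row_mask n (T r)" using R(1,2) r by (auto simp: setup_regs_def rows_ok_def)
    let ?mr = "row_mask n (T r)" and ?b = "4 ^ (n - Max (T r)) :: nat"
    have low: "and ?mr (?mr - Suc 0) = ?mr - ?b" "?b \<le> ?mr" using row_mask_lowest[OF subn ne] by simp_all
    have lowb: "?mr - (?mr - ?b) = ?b" using low(2) by simp
    have mb: "?mr < 2 ^ w" "?mr - Suc 0 < 2 ^ w" "?mr - ?b < 2 ^ w" "?b < 2 ^ w"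
      using row_mask_less[OF subn[of r]] four_power_less[of "n - Max (T r)"] by auto
    have mk: "row_mask n (T r - {Max (T r)}) = ?mr - ?b" using row_mask_remove[OF fin, of "Max (T r)" r] fin ne by simp
    define R1 where "R1 = R(9 := shape_code B l (move_shape (Down r) (shape T)), 12 := ?mr - ?b, 13 := ?b, 32 + 2 * r := ?mr - ?b)"
    define Q where "Q = (\<lambda>R' M' O'' t'. M' = M \<and> set O'' = set O' \<union> {(pop T r r, Suc s)} \<and> t' \<le> t + 9 * l + 16 \<and>
      setup_regs q R' \<and> rows_ok (row_delete T r) R' \<and> R' 9 = shape_code B l (move_shape (Down r) (shape T)) \<and>
      R' 7 = R 7 \<and> R' 8 = R 8 \<and> R' 10 = R 10 \<and> R' 18 = R 18)"
    have entn: "entries T \<subseteq> {1..n}" using ent s by auto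
    have rest: "wp w a cells (Seq (pops_com r) (Seq print_com Skip)) Q R1 M O' t1" if t1: "t1 \<le> t + 6" for t1
    proof (rule wp_seqI[OF pops_spec[OF T ne entn r, of r R1]])
      show "R1 13 = 4 ^ (n - pop T r (r - r))" by (simp add: R1_def)
      show "R1 (32 + 2 * i) = row_mask n (T i)" if "i < r" for i using that R(2) r by (simp add: R1_def rows_ok_def)
      fix R2 M2 O2 t2 assume A: "M2 = M \<and> O2 = O' \<and> t2 \<le> t1 + 9 * r + 1 \<and> R2 13 = 4 ^ (n - pop T r r) \<and>
        (\<forall>i<r. R2 (32 + 2 * i) = row_mask n (row_delete T r i)) \<and>
        (\<forall>x. x \<notin> {12, 13, 14} \<longrightarrow> (\<forall>i<r. x \<noteq> 32 + 2 * i) \<longrightarrow> R2 x = R1 x)"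
      have fr: "R2 x = R1 x" if "x \<notin> {12, 13, 14}" "\<And>i. i < r \<Longrightarrow> x \<noteq> 32 + 2 * i" for x using A that by blast
      have R2: "R2 2 = q" "R2 8 = Suc s" "R2 7 = R 7" "R2 10 = R 10" "R2 18 = R 18"
        "R2 9 = shape_code B l (move_shape (Down r) (shape T))"
        using fr[of 2] fr[of 8] fr[of 7] fr[of 10] fr[of 18] fr[of 9] R by (auto simp: R1_def setup_regs_def simp del: move_shape.simps)
      have sr2: "setup_regs q R2" using R(1) fr by (auto simp: setup_regs_def R1_def)
      have rows2: "R2 (32 + 2 * i) = row_mask n (row_delete T r i)" if "i < l" for i
      proof -
        consider "i < r" | "i = r" | "i > r" by linarith
        thus ?thesis
        proof cases
          case 1 thus ?thesis using A by blast
        next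
          case 2 thus ?thesis using fr[of "32 + 2 * r"] mk by (simp add: R1_def row_delete_def)
        next
          case 3 thus ?thesis using fr[of "32 + 2 * i"] R(2) that by (simp add: R1_def row_delete_def rows_ok_def)
        qed
      qed
      have "pop T r r \<in> T 0" using pop_in(1)[OF T ne, of r] by simp
      hence v: "1 \<le> pop T r r" "pop T r r \<le> n" using subsetD[OF subn] by auto
      have rl: "9 * r + 9 \<le> 9 * l" using r by simp
      show "wp w a cells (Seq print_com Skip) Q R2 M2 O2 t2"
      proof (rule wp_seqI[OF print_spec[where q = q and v = "pop T r r" and m = m]])
        show "header m q M2" "R2 13 = 4 ^ (n - pop T r r)" "R2 2 = q" "1 \<le> pop T r r" "pop T r r \<le> n" using A hd R2 v by auto
        fix R3 M3 O3 t3 assume A3: "M3 = M2 \<and> O3 = O2 @ [(pop T r r, R2 8)] \<and> t3 \<le> t2 + 7 \<and> (\<forall>x. x \<noteq> 12 \<longrightarrow> R3 x = R2 x)"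
        have fr3: "R3 x = R2 x" if "x \<noteq> 12" for x using A3 that by blast
        have "setup_regs q R3" using sr2 fr3 by (simp add: setup_regs_def)
        moreover have "rows_ok (row_delete T r) R3" using rows2 fr3 by (simp add: rows_ok_def)
        moreover have "Suc t3 \<le> t + 9 * l + 16" using A A3 t1 rl by linarith
        moreover have "set O3 = set O' \<union> {(pop T r r, Suc s)}" using A A3 R2(2) by simp
        ultimately show "wp w a cells Skip Q R3 M3 O3 t3" unfolding Q_def using A A3 R2 fr3 R(4) by (simp del: move_shape.simps)
      qed
    qed simp
    have eq: "tableau_step (Suc s) (Down r) T = row_delete T r" "step_arcs (Suc s) (Down r) T = {(pop T r r, Suc s)}" by simp_all
    have "wp w a cells (move_com (Down r)) Q R M O' t"
      unfolding move_com.simps seqs.simps pop_first_com_def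
      using Rr cb mb rest[unfolded R1_def] by (simp add: c low lowb del: move_shape.simps)
    thus ?thesis unfolding Down eq Q_def .
  qed
qed

lemma count_spec:
  assumes mem: "(mv, c) \<in> set (all_choices l False (Suc j) \<mu>)" and sh: "is_shape l \<mu>" and bound: "\<mu> 0 + Suc j \<le> n"
    and lay: "layers q (n + 2) M" and q: "q \<le> 9 * n + 3"
    and R: "setup_regs q R" "R 11 = 3 + q + Suc j * S + shape_code B l \<mu>"
  shows "wp w a cells (count_com mv) (\<lambda>R' M' O'' t'. M' = M \<and> O'' = O' \<and> t' \<le> t + 6 \<and> R' 12 = c \<and>
    (\<forall>x. x \<notin> {12, 13} \<longrightarrow> R' x = R x)) R M O' t"
proof -
  define p where "p = shape_code B l \<mu>"
  have pl: "p < B ^ l" unfolding p_def using bound by (intro shape_code_less[OF sh]) simp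
  have M: "M (3 + q + i * S + p') = code_table B l i p'" "3 + q + i * S + p' < cells" "3 + q + i * S + p' < 2 ^ w"
    "code_table B l i p' < 2 ^ w" if "i \<le> Suc j" "p' < S" for i p'
    using lay that bound layer_le[of i q p'] q cells_bound code_table_less[of i p'] by (auto simp: layers_def)
  define L where "L = 3 + q + Suc j * S"
  define L' where "L' = 3 + q + j * S"
  have LL: "L + p - S = L' + p" by (simp add: L_def L'_def)
  note M1 = M[of "Suc j", folded L_def] and M0 = M[of j, folded L'_def]
  have R11: "R 11 = L + p" using R(2) by (simp add: L_def p_def)
  have BS: "p + B ^ r < S" "p - B ^ r < S" "p < S" if "r < l" for r
  proof -
    have "B ^ r \<le> B ^ l" using B_power_le that by simp
    thus "p + B ^ r < S" "p - B ^ r < S" "p < S" using pl unfolding S_def by linarith+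
  qed
  have Rr: "R (33 + 2 * r) = B ^ r" if "r < l" for r using R(1) that by (simp add: setup_regs_def)
  have R5: "R 5 = S" using R(1) by (simp add: setup_regs_def)
  have cS: "code_table B l i p = walk_count l i \<mu>" if "i \<le> Suc j" for i
    unfolding p_def using bound that by (intro code_table_shape_code[OF sh l_pos]) auto
  have cU: "code_table B l (Suc j) (p + B ^ r) = walk_count l (Suc j) (move_shape (Up r) \<mu>)" if "r < l" for r
    unfolding p_def
  proof (rule code_table_Up[OF sh that])
    assume "is_shape l (move_shape (Up r) \<mu>)"
    thus "code_table B l (Suc j) (shape_code B l (move_shape (Up r) \<mu>)) = walk_count l (Suc j) (move_shape (Up r) \<mu>)"
      using bound by (intro code_table_shape_code l_pos) auto
  qed (use bound in simp)
  have cD: "code_table B l (Suc j) (p - B ^ r) = down_count l (Suc j) \<mu> r" if "r < l" for r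
    unfolding p_def
  proof (rule code_table_Down[OF sh that])
    assume "is_shape l (move_shape (Down r) \<mu>)"
    thus "code_table B l (Suc j) (shape_code B l (move_shape (Down r) \<mu>)) = walk_count l (Suc j) (move_shape (Down r) \<mu>)"
      using bound by (intro code_table_shape_code l_pos) auto
  qed (use bound in simp)
  have l0: "0 < l" using l_pos by simp
  consider "mv = Stay" "c = walk_count l (Suc j) \<mu>"
    | "mv = Up 0" "c = walk_count l (Suc j) (move_shape (Up 0) \<mu>) - walk_count l j \<mu>"
    | r where "mv = Up r" "r \<noteq> 0" "r < l" "c = walk_count l (Suc j) (move_shape (Up r) \<mu>)"
    | r where "mv = Down r" "r < l" "c = down_count l (Suc j) \<mu> r"
    using mem l0 by (auto simp: all_choices_def choices_def simp del: move_shape.simps split: if_splits)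
  thus ?thesis
  proof cases
    case 1
    thus ?thesis using R11 M1[of p] BS(3)[OF l0] cS[of "Suc j"] by (simp del: walk_count.simps code_table.simps)
  next
    case 2
    let ?x = "walk_count l (Suc j) (move_shape (Up 0) \<mu>)"
    have a: "M (Suc (L + p)) = ?x" "Suc (L + p) < cells" "Suc (L + p) < 2 ^ w" "?x < 2 ^ w"
      using M1[of "p + 1"] BS(1)[OF l0] cU[OF l0] by (simp_all del: walk_count.simps code_table.simps move_shape.simps)
    have b: "M (L' + p) = walk_count l j \<mu>" "L' + p < cells" "L' + p < 2 ^ w" "walk_count l j \<mu> < 2 ^ w"
      using M0[of p] BS(3)[OF l0] cS[of j] by (simp_all del: walk_count.simps code_table.simps)
    have "?x - walk_count l j \<mu> < 2 ^ w" using a(4) by simp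
    thus ?thesis using 2 R11 R5 a b by (simp add: LL del: walk_count.simps code_table.simps move_shape.simps)
  next
    case 3
    thus ?thesis using R11 Rr[OF 3(3)] M1[of "p + B ^ r"] BS(1)[OF 3(3)] cU[OF 3(3)]
      by (simp add: add.assoc del: walk_count.simps code_table.simps move_shape.simps)
  next
    case 4
    have e: "L + p - B ^ r = L + (p - B ^ r)" using shape_code_ge[OF 4(2), of B \<mu>] by (simp add: p_def)
    show ?thesis using 4 R11 Rr[OF 4(2)] M1[of "p - B ^ r"] BS(2)[OF 4(2)] cD[OF 4(2)]
      by (simp add: e del: walk_count.simps code_table.simps)
  qed
qed

lemma table_ok_cong:
  assumes "table_ok m q M" "\<And>x. x < cells \<Longrightarrow> M' x = M x"
  shows "table_ok m q M'"
proof -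
  have hd: "header m q M" and lay: "layers q (n + 2) M" using assms(1) by (auto simp: table_ok_def)
  have q: "0 < q" "q \<le> 9 * n + 3" using hd by (auto simp: header_def)
  have c: "9 * n + 7 \<le> cells" using S_le_cells by linarith
  have e: "M' (3 + y mod q) = M (3 + y mod q)" for y
  proof -
    have "y mod q < q" using q by simp
    thus ?thesis using q c by (intro assms(2)) linarith
  qed
  have e': "M' 0 = M 0" "M' 1 = M 1" "M' 2 = M 2" using c by (auto intro!: assms(2))
  have "header m q M'" using hd unfolding header_def e e' .
  moreover have "layers q (n + 2) M'" unfolding layers_def
  proof (intro allI impI)
    fix i p assume ip: "i < n + 2" "p < S"
    have "3 + q + i * S + p < cells" using layer_le[of i q p] ip q by simp
    thus "M' (3 + q + i * S + p) = code_table B l i p" using assms(2) lay ip by (simp add: layers_def)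
  qed
  ultimately show ?thesis by (simp add: table_ok_def)
qed

lemma init_spec:
  assumes M: "table_ok m q M"
  shows "wp w a cells (init_com l) (\<lambda>R' M' O'' t'. M' = M \<and> O'' = O' \<and> t' \<le> t + 5 * l + 20 \<and> setup_regs q R' \<and>
    rows_ok (\<lambda>_. {}) R' \<and> R' 9 = shape_code B l (\<lambda>_. 0) \<and> R' 8 = 0 \<and> R' 7 = 3 + q + Suc n * S \<and> R' 18 = 4 ^ n \<and>
    R' 11 = walk_count l (Suc n) (\<lambda>_. 0)) R M O' t"
proof -
  have hd: "header m q M" and lay: "layers q (n + 2) M" using M by (auto simp: table_ok_def)
  have M012: "M 0 = n" "M 1 = q" "M 2 = 4 ^ n" and q: "q \<le> 9 * n + 3" using hd by (auto simp: header_def)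
  have W: "9 * n + 7 < 2 ^ w" "9 * n + 7 \<le> cells" using S_le_cells cells_bound by linarith+
  define Q where "Q = (\<lambda>R' M' O'' t'. M' = M \<and> O'' = O' \<and> t' \<le> t + 5 * l + 20 \<and> setup_regs q R' \<and>
    rows_ok (\<lambda>_. {}) R' \<and> R' 9 = shape_code B l (\<lambda>_. 0) \<and> R' 8 = 0 \<and> R' 7 = 3 + q + Suc n * S \<and> R' 18 = 4 ^ n \<and>
    R' 11 = walk_count l (Suc n) (\<lambda>_. 0))"
  define rest1 where "rest1 = seqs [Move 9 (Reg 4), Arith Mul 7 (Reg 0) (Reg 5), Arith Add 7 (Reg 7) (Reg 5),
     Arith Add 7 (Reg 7) (Reg 6), Move 8 (Imm 0), Arith Add 11 (Reg 7) (Reg 9), Load 11 (Reg 11)]"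
  define rest2 where "rest2 = Seq (unroll l (\<lambda>r. Move (32 + 2 * r) (Imm 0))) rest1"
  define e where "e = encode B l (\<lambda>_. 1)"
  have ecode: "shape_code B l (\<lambda>_. 0) = e" by (simp add: shape_code_def e_def)
  have el: "e < B ^ l" using encode_one_less by (simp add: e_def)
  hence eS: "e < S" by (simp add: S_def)
  define L where "L = n * S + S + (3 + q)"
  have L: "L = 3 + q + Suc n * S" by (simp add: L_def)
  have ad: "L + e < cells" using layer_le[of "Suc n" q e] q eS unfolding L by simp
  have b: "n * S < 2 ^ w" "n * S + S < 2 ^ w" "L < 2 ^ w" "L + e < 2 ^ w" "e < 2 ^ w" using ad cells_bound unfolding L_def by linarith+
  have cnt: "M (L + e) = walk_count l (Suc n) (\<lambda>_. 0)"
  proof -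
    have "M (3 + q + Suc n * S + e) = code_table B l (Suc n) e" using lay eS unfolding layers_def by (metis add_2_eq_Suc' lessI)
    also have "\<dots> = walk_count l (Suc n) (\<lambda>_. 0)"
      unfolding ecode[symmetric] by (rule code_table_shape_code[OF is_shape_0 l_pos]) simp_all
    finally show ?thesis unfolding L .
  qed
  have cb: "walk_count l (Suc n) (\<lambda>_. 0) < 2 ^ w"
  proof -
    have "code_table B l (Suc n) (shape_code B l (\<lambda>_. 0)) = walk_count l (Suc n) (\<lambda>_. 0)"
      by (rule code_table_shape_code[OF is_shape_0 l_pos]) simp_all
    thus ?thesis using code_table_less[of "Suc n"] by (metis order_refl)
  qed
  have fin: "wp w a cells rest1 Q R1 M O' t1" if sr: "setup_regs q R1" and rows: "rows_ok (\<lambda>_. {}) R1" and R18: "R1 18 = 4 ^ n" and t1: "t1 \<le> t + 5 * l + 12" for R1 t1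
  proof -
    have regs: "R1 0 = n" "R1 4 = e" "R1 5 = S" "R1 6 = 3 + q" using sr by (auto simp: setup_regs_def e_def)
    have Qi: "Q R2 M O' t2" if "t2 \<le> t1 + 8" "\<And>x. x \<notin> {7, 8, 9, 11} \<Longrightarrow> R2 x = R1 x" "R2 9 = e" "R2 8 = 0" "R2 7 = L" "R2 11 = walk_count l (Suc n) (\<lambda>_. 0)" for R2 t2
    proof -
      have "setup_regs q R2" using sr that(2) by (simp add: setup_regs_def)
      moreover have "rows_ok (\<lambda>_. {}) R2" using rows that(2) by (simp add: rows_ok_def)
      moreover have "R2 18 = 4 ^ n" using R18 that(2) by simp
      ultimately show ?thesis unfolding Q_def L[symmetric] ecode using that t1 by simp
    qed
    show ?thesis unfolding rest1_def using regs b ad cb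
      by (simp add: L_def[symmetric] cnt del: walk_count.simps) (rule Qi, auto)
  qed
  have clear: "wp w a cells rest2 Q R1 M O' t1" if sr: "setup_regs q R1" and R18: "R1 18 = 4 ^ n" and t1: "t1 \<le> t + 4 * l + 11" for R1 t1
  proof -
    define I where "I r R' M' O'' t' \<longleftrightarrow> M' = M \<and> O'' = O' \<and> t' \<le> t1 + 1 + r \<and> (\<forall>i<r. R' (32 + 2 * i) = 0) \<and>
      (\<forall>x. (\<forall>i. x \<noteq> 32 + 2 * i) \<longrightarrow> R' x = R1 x)" for r :: nat and R' :: "nat \<Rightarrow> nat" and M' O'' t'
    have un: "wp w a cells (unroll l (\<lambda>r. Move (32 + 2 * r) (Imm 0))) (I l) R1 M O' t1"
    proof (rule wp_unroll)
      show "I 0 R1 M O' (Suc t1)" by (simp add: I_def)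
      fix r R' M' O'' t' assume "I r R' M' O'' t'"
      thus "wp w a cells (Move (32 + 2 * r) (Imm 0)) (I (Suc r)) R' M' O'' t'" by (auto simp: I_def less_Suc_eq)
    qed
    show ?thesis unfolding rest2_def
    proof (rule wp_seqI[OF un])
      fix R' M' O'' t' assume I: "I l R' M' O'' t'"
      have fr: "R' x = R1 x" if "\<And>i. x \<noteq> 32 + 2 * i" for x using I that unfolding I_def by blast
      have "R' 18 = 4 ^ n" using fr[of 18] R18 by simp
      moreover have "setup_regs q R'" using sr fr by (simp add: setup_regs_def)
      moreover have "rows_ok (\<lambda>_. {}) R'" using I by (simp add: I_def rows_ok_def row_mask_def)
      ultimately show "wp w a cells rest1 Q R' M' O'' t'" using fin[of R' t'] I t1 by (simp add: I_def)
    qed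
  qed
  have R0: "(R(0 := n, 2 := q, 18 := 4 ^ n)) 0 = n" "(R(0 := n, 2 := q, 18 := 4 ^ n)) 2 = q" by simp_all
  have su: "wp w a cells (Seq (setup_com l) rest2) Q (R(0 := n, 2 := q, 18 := 4 ^ n)) M O' (Suc (Suc (Suc t)))"
  proof (rule wp_seqI[OF setup_spec[OF R0 q]])
    fix R' M' O'' t' assume A: "M' = M \<and> O'' = O' \<and> t' \<le> Suc (Suc (Suc t)) + 4 * l + 8 \<and> setup_regs q R' \<and>
      (\<forall>x. x \<notin> {1, 3, 4, 5, 6} \<longrightarrow> (\<forall>i<l. x \<noteq> 33 + 2 * i) \<longrightarrow> R' x = (R(0 := n, 2 := q, 18 := 4 ^ n)) x)"
    have "R' 18 = (R(0 := n, 2 := q, 18 := 4 ^ n)) 18" using A by auto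
    thus "wp w a cells rest2 Q R' M' O'' t'" using clear[of R' t'] A by simp
  qed
  have "wp w a cells (init_com l) Q R M O' t"
    unfolding init_com_def seqs.simps
    using su[unfolded rest2_def rest1_def seqs.simps] M012 W q four_power_less[of n] by simp
  thus ?thesis unfolding Q_def .
qed

definition gen_state :: "nat \<Rightarrow> move list \<Rightarrow> nat \<Rightarrow> nat \<Rightarrow> assertion" where
  "gen_state q W s i R M O' t \<longleftrightarrow> s + i = n \<and> setup_regs q R \<and> R 8 = s \<and> R 7 = 3 + q + Suc i * S \<and> R 18 = 4 ^ i \<and>
     (\<exists>f. R 10 < walk_number l f i (shape_at (\<lambda>_. 0) W s)) \<and> R 10 < 2 ^ w \<and>
     unrank l i (shape_at (\<lambda>_. 0) W s) (R 10) = drop s W \<and> rows_ok (tableau_at W s) R \<and>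
     R 9 = shape_code B l (shape_at (\<lambda>_. 0) W s) \<and> set O' = (\<Union>r<s. step_arcs (Suc r) (W ! r) (tableau_at W r))"

lemma step_spec:
  assumes M: "table_ok m q M" and W: "walk l False (\<lambda>_. 0) W" "length W = n" and st: "gen_state q W s (Suc j) R M O' t"
  shows "wp w a cells (step_com l) (\<lambda>R' M' O'' t'. M' = M \<and> gen_state q W (Suc s) j R' M' O'' t' \<and> t' \<le> t + 27 * l + 31) R M O' t"
proof -
  have hd: "header m q M" and lay: "layers q (n + 2) M" using M by (auto simp: table_ok_def)
  have q: "q \<le> 9 * n + 3" using hd by (auto simp: header_def)
  define \<mu> where "\<mu> = shape_at (\<lambda>_. 0) W s"
  define T where "T = tableau_at W s"
  have st1: "s + Suc j = n" "setup_regs q R" "R 8 = s" "R 7 = 3 + q + Suc (Suc j) * S" "R 18 = 4 ^ Suc j" "R 10 < 2 ^ w"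
    "unrank l (Suc j) \<mu> (R 10) = drop s W" "rows_ok T R" "R 9 = shape_code B l \<mu>"
    "set O' = (\<Union>r<s. step_arcs (Suc r) (W ! r) (tableau_at W r))"
    using st unfolding gen_state_def \<mu>_def T_def by blast+
  obtain f where f: "R 10 < walk_number l f (Suc j) \<mu>" using st unfolding gen_state_def \<mu>_def by blast
  have s: "s < n" using st1(1) by simp
  have sle: "s \<le> length W" using s W(2) by simp
  have T: "is_tableau T" and shT: "shape T = \<mu>" and ent: "entries T \<subseteq> {1..s}" and sh: "is_shape l \<mu>"
    using walk_tableau[OF W(1) sle] walk_shape[OF W(1) sle] walk_entries[OF W(1) sle] walk_is_shape[OF W(1) sle] by (auto simp: T_def \<mu>_def)
  have "\<mu> 0 \<le> s"
  proof -
    have "T 0 \<subseteq> {1..s}" using ent by (auto simp: entries_def)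
    hence "card (T 0) \<le> s" using card_mono[of "{1..s}" "T 0"] by simp
    thus ?thesis using shT by (simp add: shape_def fun_eq_iff)
  qed
  hence bound: "\<mu> 0 + Suc j \<le> n" "\<mu> 0 + 2 < B" using st1(1) by auto
  define p where "p = shape_code B l \<mu>"
  define L where "L = 3 + q + Suc j * S"
  have pS: "p < S" using shape_code_less[OF sh, of B] bound(2) by (simp add: p_def S_def)
  have LL: "R 7 - S = L" using st1(4) by (simp add: L_def)
  have ad: "L + p < 2 ^ w" using layer_le[of "Suc j" q p] q pS st1(1) cells_bound by (simp add: L_def)
  hence b: "L < 2 ^ w" "Suc s < 2 ^ w" "4 ^ j < (2::nat) ^ w" using S_le_cells cells_bound s four_power_less[of j] st1(1) by auto
  have R5: "R 5 = S" using st1(2) by (simp add: setup_regs_def)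
  define R1 where "R1 = R(8 := Suc s, 18 := 4 ^ j, 7 := L, 11 := L + p)"
  define Q where "Q = (\<lambda>R' M' O'' t'. M' = M \<and> gen_state q W (Suc s) j R' M' O'' t' \<and> t' \<le> t + 27 * l + 31)"
  let ?cs = "all_choices l False (Suc j) \<mu>"
  have len: "length ?cs = 2 * l + 1" using l_pos by (simp add: all_choices_def choices_def)
  have sr1: "setup_regs q R1" using st1(2) by (simp add: R1_def setup_regs_def)
  have choice: "wp w a cells (choice_com (map fst ?cs)) (wp w a cells Skip Q) R1 M O' t1" if t1: "t1 \<le> t + 4" for t1
  proof (rule choice_spec)
    fix mv c R' t' assume mem: "(mv, c) \<in> set ?cs" and fr: "\<And>x. x \<notin> {10, 12, 13} \<Longrightarrow> R' x = R1 x"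
    have "setup_regs q R'" using sr1 fr by (simp add: setup_regs_def)
    moreover have "R' 11 = 3 + q + Suc j * S + shape_code B l \<mu>" using fr[of 11] by (simp add: R1_def L_def p_def)
    ultimately show "wp w a cells (count_com mv) (\<lambda>R'' M' O'' t''. M' = M \<and> O'' = O' \<and> t'' \<le> t' + 6 \<and> R'' 12 = c \<and>
      (\<forall>x. x \<notin> {12, 13} \<longrightarrow> R'' x = R' x)) R' M O' t'"
      using count_spec[OF mem sh bound(1) lay q] by blast
  next
    show "R 10 < sum_list (map snd ?cs)" using f walk_number_mono[of l f j \<mu>] by simp
    show "R 10 < 2 ^ w" by (rule st1(6))
    show "R1 10 = R 10" by (simp add: R1_def)
  next
    fix mv v R' t' assume sel: "select ?cs (R 10) = (mv, v)" and v: "R' 10 = v" and fr: "\<And>x. x \<notin> {10, 12, 13} \<Longrightarrow> R' x = R1 x"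
      and t': "t' \<le> t1 + 9 * length ?cs"
    note US = unrank_step[OF l_pos sh f sel]
    have dr: "drop s W = mv # unrank l j (move_shape mv \<mu>) v" using st1(7) sel by simp
    have Ws: "W ! s = mv" using dr sle s W(2) by (metis Cons_nth_drop_Suc list.inject)
    have dr': "unrank l j (move_shape mv \<mu>) v = drop (Suc s) W" using dr by (metis Cons_nth_drop_Suc W(2) list.inject s)
    have sh': "shape_at (\<lambda>_. 0) W (Suc s) = move_shape mv \<mu>" using shape_at_Suc[of s W] s W(2) Ws by (simp add: \<mu>_def)
    have T': "tableau_at W (Suc s) = tableau_step (Suc s) mv T" by (simp add: Ws T_def)
    have sr': "setup_regs q R'" using sr1 fr by (simp add: setup_regs_def)
    have rows': "rows_ok T R'" using st1(8) fr by (simp add: rows_ok_def R1_def)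
    have regs': "R' 9 = shape_code B l (shape T)" "R' 8 = Suc s" "R' 18 = 4 ^ (n - Suc s)" "R' 7 = L"
      using fr[of 9] fr[of 8] fr[of 18] fr[of 7] st1(1,9) shT by (auto simp: R1_def)
    have leg: "legal l (shape T) mv" using US(1) shT by simp
    have shs: "is_shape l (shape T)" "shape T 0 + 2 < B" using sh bound(2) shT by auto
    show "wp w a cells (move_com mv) (wp w a cells Skip Q) R' M O' t'"
    proof (rule wp_mono[OF move_spec[OF T ent s leg shs hd sr' rows' regs'(1-3)]])
      fix R2 M2 O2 t2 assume A: "M2 = M \<and> set O2 = set O' \<union> step_arcs (Suc s) mv T \<and> t2 \<le> t' + 9 * l + 16 \<and>
        setup_regs q R2 \<and> rows_ok (tableau_step (Suc s) mv T) R2 \<and> R2 9 = shape_code B l (move_shape mv (shape T)) \<and>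
        R2 7 = R' 7 \<and> R2 8 = R' 8 \<and> R2 10 = R' 10 \<and> R2 18 = R' 18"
      have v2: "R2 10 = v" using A v by simp
      have vw: "v < 2 ^ w" using select_le[OF sel] st1(6) by simp
      have arcs: "set O2 = (\<Union>r<Suc s. step_arcs (Suc r) (W ! r) (tableau_at W r))"
        using A st1(10) by (simp add: lessThan_Suc Ws T_def Un_commute)
      have n': "n - Suc s = j" using st1(1) by simp
      have regs2: "R2 7 = 3 + q + Suc j * S" "R2 8 = Suc s" "R2 18 = 4 ^ j" "R2 9 = shape_code B l (move_shape mv \<mu>)"
        using A regs' n' shT by (auto simp: L_def)
      have "\<exists>f. R2 10 < walk_number l f j (shape_at (\<lambda>_. 0) W (Suc s))" using US(2) unfolding sh' v2 by blast
      moreover have "unrank l j (shape_at (\<lambda>_. 0) W (Suc s)) (R2 10) = drop (Suc s) W" using dr' unfolding sh' v2 .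
      moreover have "R2 9 = shape_code B l (shape_at (\<lambda>_. 0) W (Suc s))" using regs2(4) unfolding sh' .
      moreover have "rows_ok (tableau_at W (Suc s)) R2" using A unfolding T' by blast
      moreover have "Suc s + j = n" using st1(1) by simp
      ultimately have "gen_state q W (Suc s) j R2 M2 O2 t3" for t3
        unfolding gen_state_def using A vw v2 arcs regs2(1-3) by blast
      moreover have "Suc t2 \<le> t + 27 * l + 31" using A t' t1 len by simp
      ultimately show "wp w a cells Skip Q R2 M2 O2 t2" unfolding Q_def using A by simp
    qed
  qed
  have "wp w a cells (step_com l) Q R M O' t"
    unfolding step_com_def seqs.simps moves_choices[of l "Suc j" \<mu>, symmetric]
    using choice[unfolded R1_def] b ad st1(3,5,9) R5
    by (simp add: LL p_def[symmetric])
  thus ?thesis unfolding Q_def .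
qed

lemma loop_spec:
  assumes M: "table_ok m q M" and W: "walk l False (\<lambda>_. 0) W" "length W = n" and st: "gen_state q W 0 n R M O' t"
  shows "wp w a cells (While (Less (Reg 8) (Reg 0)) (step_com l)) (\<lambda>R' M' O'' t'. set O'' = walk_arcs W \<and> t' \<le> t + n * (27 * l + 32) + 1) R M O' t"
proof -
  define I where "I i R' M' O'' t' \<longleftrightarrow> M' = M \<and> (\<exists>s. gen_state q W s i R' M' O'' t' \<and> t' \<le> t + s * (27 * l + 32))" for i R' M' O'' t'
  show ?thesis
  proof (rule wp_while[of I n])
    show "I n R M O' t" using st by (auto simp: I_def)
  next
    fix i R' M' O'' t' assume "I (Suc i) R' M' O'' t'"
    then obtain s where s: "M' = M" "gen_state q W s (Suc i) R' M O'' t'" "t' \<le> t + s * (27 * l + 32)" by (auto simp: I_def)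
    have g: "gen_state q W s (Suc i) R' M O'' (Suc t')" using s(2) by (simp only: gen_state_def)
    have "wp w a cells (step_com l) (I i) R' M O'' (Suc t')"
      by (rule wp_mono[OF step_spec[OF M W g]]) (use s(3) in \<open>auto simp: I_def intro!: exI[of _ "Suc s"]\<close>)
    moreover have "R' 8 = s" "R' 0 = n" "s < n" using s(2) by (auto simp: gen_state_def setup_regs_def)
    ultimately show "test_value R' (Less (Reg 8) (Reg 0)) \<and> wp w a cells (step_com l) (I i) R' M' O'' (Suc t')" using s(1) by simp
  next
    fix R' M' O'' t' assume "I 0 R' M' O'' t'"
    then obtain s where s: "gen_state q W s 0 R' M' O'' t'" "t' \<le> t + s * (27 * l + 32)" by (auto simp: I_def)
    have "s = n" "R' 8 = n" "R' 0 = n" "set O'' = walk_arcs W"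
      using s(1) W(2) by (auto simp: gen_state_def setup_regs_def walk_arcs_def)
    thus "\<not> test_value R' (Less (Reg 8) (Reg 0)) \<and> (set O'' = walk_arcs W \<and> Suc t' \<le> t + n * (27 * l + 32) + 1)" using s(2) by simp
  qed
qed

theorem prep_run:
  "\<exists>p m q. exec w 0 cells (prep_com l) (initial_state n) = return_spmf p \<and> table_ok m q (mem p) \<and> time p \<le> prep_steps l n"
proof -
  let ?R = "\<lambda>r. if r = 0 then n else 0"
  have "wp w 0 cells (prep_com l) (\<lambda>R' M' O'' t'. (\<exists>m q. table_ok m q M') \<and> t' \<le> 0 + prep_steps l n) ?R (\<lambda>_. 0) [] 0"
    by (rule prep_spec) auto
  from wp_sound[OF this] obtain R' M' O'' t' m q where
    "exec w 0 cells (prep_com l) (mk_state ?R (\<lambda>_. 0) [] 0) = return_spmf (mk_state R' M' O'' t')"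
    "table_ok m q M'" "t' \<le> prep_steps l n" by auto
  thus ?thesis unfolding initial_state_def by (intro exI[of _ "mk_state R' M' O'' t'"] exI[of _ m] exI[of _ q]) simp
qed

theorem gen_run:
  assumes M: "table_ok m q (mem s)" and s: "printed s = []" "time s = 0"
  shows "\<exists>fin. exec w cells cells (gen_com l) s = map_spmf fin (spmf_of_set {..<walk_count l (Suc n) (\<lambda>_. 0)}) \<and>
    (\<forall>u<walk_count l (Suc n) (\<lambda>_. 0). set (printed (fin u)) = walk_arcs (unrank l n (\<lambda>_. 0) u) \<and> time (fin u) \<le> gen_steps l n)"
proof -
  let ?N = "walk_count l (Suc n) (\<lambda>_. 0)"
  have s': "s = mk_state (reg s) (mem s) [] 0" using s by simp
  from wp_sound[OF init_spec[OF M, of cells "[]" 0 "reg s"]] obtain R M' O1 t where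
    ex: "exec w cells cells (init_com l) s = return_spmf (mk_state R M' O1 t)" and
    A: "M' = mem s" "O1 = []" "t \<le> 0 + 5 * l + 20" "setup_regs q R" "rows_ok (\<lambda>_. {}) R" "R 9 = shape_code B l (\<lambda>_. 0)" "R 8 = 0"
      "R 7 = 3 + q + Suc n * S" "R 18 = 4 ^ n" "R 11 = ?N" unfolding s'[symmetric] by blast
  have Nw: "?N < 2 ^ w"
  proof -
    have "code_table B l (Suc n) (shape_code B l (\<lambda>_. 0)) = ?N" by (rule code_table_shape_code[OF is_shape_0 l_pos]) simp_all
    thus ?thesis using code_table_less[of "Suc n"] by (metis order_refl)
  qed
  have num: "walk_number l False n (\<lambda>_. 0) = ?N" using walk_number_False[OF l_pos is_shape_0] .
  let ?R = "\<lambda>u. R(10 := u)"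
  have loop: "\<exists>f. exec w cells cells (While (Less (Reg 8) (Reg 0)) (step_com l)) (mk_state (?R u) (mem s) [] (Suc t)) = return_spmf f \<and>
      set (printed f) = walk_arcs (unrank l n (\<lambda>_. 0) u) \<and> time f \<le> gen_steps l n" if u: "u < ?N" for u
  proof -
    let ?W = "unrank l n (\<lambda>_. 0) u"
    have W: "walk l False (\<lambda>_. 0) ?W" "length ?W = n" using unrank_walk[OF l_pos is_shape_0, of u False n] u num by auto
    have "setup_regs q (?R u)" "rows_ok (\<lambda>_. {}) (?R u)" using A by (auto simp: setup_regs_def rows_ok_def)
    hence "gen_state q ?W 0 n (?R u) (mem s) [] (Suc t)" unfolding gen_state_def using A u Nw num
      by (auto intro!: exI[of _ False])
    from wp_sound[OF loop_spec[OF M W this, of cells]] show ?thesis using A(3)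
      by (fastforce simp: gen_steps_def)
  qed
  define fin where "fin u = (SOME f. exec w cells cells (While (Less (Reg 8) (Reg 0)) (step_com l)) (mk_state (?R u) (mem s) [] (Suc t)) = return_spmf f \<and>
      set (printed f) = walk_arcs (unrank l n (\<lambda>_. 0) u) \<and> time f \<le> gen_steps l n)" for u
  have fin: "exec w cells cells (While (Less (Reg 8) (Reg 0)) (step_com l)) (mk_state (?R u) (mem s) [] (Suc t)) = return_spmf (fin u)"
      "set (printed (fin u)) = walk_arcs (unrank l n (\<lambda>_. 0) u)" "time (fin u) \<le> gen_steps l n" if "u < ?N" for u
    using someI_ex[OF loop[OF that]] unfolding fin_def by blast+
  have "exec w cells cells (gen_com l) s = bind_spmf (bind_spmf (spmf_of_set {0..<?N}) (\<lambda>v. set_reg w 10 v (mk_state R (mem s) [] t)))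
      (exec w cells cells (While (Less (Reg 8) (Reg 0)) (step_com l)))"
    unfolding gen_com_def using ex A by simp
  also have "\<dots> = bind_spmf (spmf_of_set {0..<?N}) (\<lambda>v. bind_spmf (set_reg w 10 v (mk_state R (mem s) [] t))
      (exec w cells cells (While (Less (Reg 8) (Reg 0)) (step_com l))))" by simp
  also have "\<dots> = bind_spmf (spmf_of_set {0..<?N}) (\<lambda>v. return_spmf (fin v))"
  proof (rule bind_spmf_cong[OF refl])
    fix v assume "v \<in> set_spmf (spmf_of_set {0..<?N})"
    hence v: "v < ?N" by simp
    have "set_reg w 10 v (mk_state R (mem s) [] t) = return_spmf (mk_state (?R v) (mem s) [] (Suc t))"
      using v Nw by (simp add: set_reg_def)
    thus "bind_spmf (set_reg w 10 v (mk_state R (mem s) [] t)) (exec w cells cells (While (Less (Reg 8) (Reg 0)) (step_com l))) = return_spmf (fin v)"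
      using fin(1)[OF v] by simp
  qed
  also have "\<dots> = map_spmf fin (spmf_of_set {..<?N})" by (simp add: map_spmf_conv_bind_spmf atLeast0LessThan)
  finally show ?thesis using fin(2,3) by blast
qed

theorem gen_output:
  assumes M: "table_ok m q (mem s)" and s: "printed s = []" "time s = 0"
  shows "halts_within (gen_steps l n) (exec w cells cells (gen_com l) s)"
    and "output_arcs (exec w cells cells (gen_com l) s) = spmf_of_set (rna_structures (Suc l) n)"
    and "finite (rna_structures (Suc l) n)" "rna_structures (Suc l) n \<noteq> {}"
proof -
  let ?N = "walk_count l (Suc n) (\<lambda>_. 0)"
  let ?f = "\<lambda>u. walk_arcs (unrank l n (\<lambda>_. 0) u)"
  obtain fin where ex: "exec w cells cells (gen_com l) s = map_spmf fin (spmf_of_set {..<?N})" and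
    fin: "\<And>u. u < ?N \<Longrightarrow> set (printed (fin u)) = ?f u" "\<And>u. u < ?N \<Longrightarrow> time (fin u) \<le> gen_steps l n"
    using gen_run[OF assms] by blast
  have bij: "bij_betw ?f {..<?N} (rna_structures (Suc l) n)"
    using bij_betw_trans[OF unrank_bij[OF l_pos] walk_arcs_bij] by (simp add: comp_def)
  have im: "?f ` {..<?N} = rna_structures (Suc l) n" and inj: "inj_on ?f {..<?N}" using bij by (auto simp: bij_betw_def)
  show "finite (rna_structures (Suc l) n)" unfolding im[symmetric] by simp
  have "noncrossing (Suc l) {}" using l_pos by (auto simp: noncrossing_def is_crossing_def)
  hence "{} \<in> rna_structures (Suc l) n" by (auto simp: rna_structures_def partial_matching_def arc_degree_def)
  thus ne: "rna_structures (Suc l) n \<noteq> {}" by blast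
  hence N: "{..<?N} \<noteq> {}" unfolding im[symmetric] by blast
  show "halts_within (gen_steps l n) (exec w cells cells (gen_com l) s)"
    unfolding halts_within_def ex using N fin(2) by auto
  have "output_arcs (exec w cells cells (gen_com l) s) = map_spmf (\<lambda>u. set (printed (fin u))) (spmf_of_set {..<?N})"
    unfolding output_arcs_def ex by (simp add: spmf.map_comp comp_def)
  also have "\<dots> = map_spmf ?f (spmf_of_set {..<?N})"
    by (rule map_spmf_cong[OF refl]) (use fin(1) in auto)
  also have "\<dots> = spmf_of_set (rna_structures (Suc l) n)"
    using map_spmf_of_set_inj_on[OF inj] im by simp
  finally show "output_arcs (exec w cells cells (gen_com l) s) = spmf_of_set (rna_structures (Suc l) n)" .
qed

end

subsection \<open>Asymptotic bounds\<close>

definition word_length :: "nat \<Rightarrow> nat \<Rightarrow> nat" where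
  "word_length l n = (2 * l + 6) * (n + 4)"

lemma rna_machine_word_length:
  assumes "1 \<le> l" shows "rna_machine l n (word_length l n)"
proof
  let ?w = "word_length l n"
  have le: "2 ^ i \<le> (2::nat) ^ ?w" if "i \<le> ?w" for i using that by (intro power_increasing) auto
  have wl: "?w = 2 * l * n + 8 * l + 6 * n + 24" by (simp add: word_length_def algebra_simps)
  show "1 \<le> l" by fact
  show "4 ^ Suc n \<le> (2::nat) ^ ?w"
  proof -
    have "(4::nat) ^ Suc n = 2 ^ (2 * Suc n)" by (simp only: power_mult) simp
    also have "\<dots> \<le> 2 ^ ?w" by (rule le) (simp add: wl)
    finally show ?thesis .
  qed
  show "(2 * l + 1) ^ Suc n < (2::nat) ^ ?w"
  proof -
    have "2 * l + 1 \<le> (2::nat) ^ (2 * l + 1)" using less_exp[of "2 * l + 1"] by simp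
    hence "(2 * l + 1) ^ Suc n \<le> (2 ^ (2 * l + 1)) ^ Suc n" by (rule power_mono) simp
    also have "\<dots> = 2 ^ ((2 * l + 1) * Suc n)" by (simp only: power_mult)
    also have "\<dots> < 2 ^ ?w" by (rule power_strict_increasing) (simp_all add: wl algebra_simps)
    finally show ?thesis .
  qed
  show "prep_cells l n < 2 ^ ?w"
  proof -
    have e: "n + 1 \<le> 2 ^ n" using Suc_leI[OF less_exp[of n]] by simp
    have "(2::nat) ^ (n + 4) = 16 * 2 ^ n" by (simp add: power_add)
    hence 1: "9 * n + 7 < 2 ^ (n + 4)" using e by linarith
    have "(2::nat) ^ (n + 3) = 8 * 2 ^ n" by (simp add: power_add)
    moreover have "(n + 2) * 2 \<le> 8 * (n + 1)" by simp
    hence "(n + 2) * 2 \<le> 8 * 2 ^ n" using mult_le_mono2[OF e, of 8] by (rule order.trans)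
    ultimately have 0: "(n + 2) * 2 \<le> 2 ^ (n + 3)" by (simp only:)
    have "n + 3 \<le> 2 ^ (n + 3)" using less_exp[of "n + 3"] by simp
    hence "(n + 3) ^ l \<le> (2 ^ (n + 3)) ^ l" by (rule power_mono) simp
    hence "(n + 2) * 2 * (n + 3) ^ l \<le> 2 ^ (n + 3) * (2 ^ (n + 3)) ^ l" using 0 by (intro mult_mono) simp_all
    also have "\<dots> = 2 ^ ((n + 3) * (l + 1))" by (simp only: power_mult power_add) simp
    finally have 2: "(n + 2) * (2 * (n + 3) ^ l) \<le> 2 ^ ((n + 3) * (l + 1))" by (simp add: mult.assoc)
    have 3: "(2::nat) ^ (n + 4) \<le> 2 ^ (?w - 1)" by (intro power_increasing) (simp_all add: wl)
    have 4: "(2::nat) ^ ((n + 3) * (l + 1)) \<le> 2 ^ (?w - 1)" by (intro power_increasing) (simp_all add: wl algebra_simps)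
    have sw: "Suc (?w - 1) = ?w" by (simp add: wl)
    have "(2::nat) ^ ?w = 2 * 2 ^ (?w - 1)" using power_Suc[of "2::nat" "?w - 1"] unfolding sw .
    thus ?thesis unfolding prep_cells_def using 1 2 3 4 by linarith
  qed
qed

lemma bigo_nat_bound:
  assumes "\<And>n. 1 \<le> n \<Longrightarrow> f n \<le> C * n ^ k"
  shows "(\<lambda>n. real (f n)) \<in> O(\<lambda>n. real n ^ k)"
proof (rule bigoI[of _ "real C"])
  show "\<forall>\<^sub>F n in sequentially. norm (real (f n)) \<le> real C * norm (real n ^ k)"
  proof (rule eventually_sequentiallyI[of 1])
    fix n :: nat assume "1 \<le> n"
    hence "real (f n) \<le> real (C * n ^ k)" using assms by (intro of_nat_mono)
    thus "norm (real (f n)) \<le> real C * norm (real n ^ k)" by simp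
  qed
qed

lemma shifted_power_le: "1 \<le> n \<Longrightarrow> (n + 3) ^ l \<le> 4 ^ l * (n::nat) ^ l"
  unfolding power_mult_distrib[symmetric] by (intro power_mono) auto

lemma prep_steps_bound:
  assumes n: "1 \<le> n"
  shows "prep_steps l n \<le> (4 * l + 45 + (17 * l + 18) * 4 ^ l) * n ^ (l + 2)"
proof -
  let ?p = "n ^ (l + 2)"
  have p1: "1 \<le> ?p" "n \<le> ?p" "n * n ^ l \<le> ?p"
    using n power_increasing[of 0 "l + 2" n] power_increasing[of 1 "l + 2" n] power_increasing[of "l + 1" "l + 2" n] by auto
  have "n * ((17 * l + 18) * (n + 3) ^ l) \<le> n * ((17 * l + 18) * (4 ^ l * n ^ l))"
    using shifted_power_le[OF n] by (intro mult_left_mono) auto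
  also have "\<dots> = (17 * l + 18) * 4 ^ l * (n * n ^ l)" by (simp only: ac_simps)
  also have "\<dots> \<le> (17 * l + 18) * 4 ^ l * ?p" using p1 by (intro mult_left_mono) auto
  finally have a: "n * ((17 * l + 18) * (n + 3) ^ l) \<le> (17 * l + 18) * 4 ^ l * ?p" .
  have b: "4 * l + 28 \<le> (4 * l + 28) * ?p" using p1 by simp
  have "prep_steps l n = 17 * n + (4 * l + 28) + n * ((17 * l + 18) * (n + 3) ^ l)" by (simp add: prep_steps_def algebra_simps)
  also have "\<dots> \<le> 17 * ?p + (4 * l + 28) * ?p + (17 * l + 18) * 4 ^ l * ?p"
    using a b p1 by (intro add_mono) auto
  also have "\<dots> = (4 * l + 45 + (17 * l + 18) * 4 ^ l) * ?p" by (simp add: algebra_simps)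
  finally show ?thesis .
qed

lemma prep_cells_bound:
  assumes n: "1 \<le> n"
  shows "prep_cells l n \<le> (16 + 6 * 4 ^ l) * n ^ (l + 1)"
proof -
  let ?p = "n ^ (l + 1)"
  have p1: "1 \<le> ?p" "n \<le> ?p" using n power_increasing[of 0 "l + 1" n] power_increasing[of 1 "l + 1" n] by auto
  have "(n + 2) * (2 * (n + 3) ^ l) \<le> (3 * n) * (2 * (4 ^ l * n ^ l))"
    using shifted_power_le[OF n, of l] n by (intro mult_mono) auto
  also have "\<dots> = 6 * 4 ^ l * ?p" by simp
  finally have "prep_cells l n \<le> 9 * n + 7 + 6 * 4 ^ l * ?p" unfolding prep_cells_def by simp
  also have "\<dots> \<le> 9 * ?p + 7 * ?p + 6 * 4 ^ l * ?p" using p1 by (intro add_mono) auto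
  also have "\<dots> = (16 + 6 * 4 ^ l) * ?p" by (simp add: algebra_simps)
  finally show ?thesis .
qed

theorem theorem3:
  fixes k :: nat
  assumes "k \<ge> 2"
  shows "\<exists>(prep :: com) (gen :: com)
           (word :: nat \<Rightarrow> nat)
           (prep_time :: nat \<Rightarrow> nat) (prep_space :: nat \<Rightarrow> nat)
           (gen_time :: nat \<Rightarrow> nat) (gen_space :: nat \<Rightarrow> nat).
      (\<lambda>n. real (word n)) \<in> O(\<lambda>n. real n) \<and>
      (\<lambda>n. real (prep_time n)) \<in> O(\<lambda>n. real n ^ (k + 1)) \<and>
      (\<lambda>n. real (prep_space n)) \<in> O(\<lambda>n. real n ^ k) \<and>
      (\<lambda>n. real (gen_time n)) \<in> O(\<lambda>n. real n) \<and>
      (\<lambda>n. real (gen_space n)) \<in> O(\<lambda>n. real n) \<and>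
      (\<forall>n.
         let P = exec (word n) 0 (prep_space n) prep (initial_state n)
         in halts_within (prep_time n) P \<and>
            (\<forall>p\<in>set_spmf P. \<forall>s\<in>ready (prep_space n) (mem p).
               let G = exec (word n) (prep_space n) (prep_space n + gen_space n) gen s
               in halts_within (gen_time n) G \<and>
                  set_spmf (output_arcs G) \<subseteq> rna_structures k n \<and>
                  (\<forall>M\<in>rna_structures k n.
                     spmf (output_arcs G) M = 1 / real (num_rna_structures k n))))"
proof -
  define l where "l = k - 1"
  have l: "1 \<le> l" and k: "k = Suc l" using assms by (auto simp: l_def)
  have "(\<lambda>n. real (word_length l n)) \<in> O(\<lambda>n. real n ^ 1)"
  proof (rule bigo_nat_bound[of _ "(2 * l + 6) * 5"])
    fix n :: nat assume "1 \<le> n"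
    thus "word_length l n \<le> (2 * l + 6) * 5 * n ^ 1" unfolding word_length_def mult.assoc by (intro mult_left_mono) auto
  qed
  moreover have "(\<lambda>n. real (prep_steps l n)) \<in> O(\<lambda>n. real n ^ (l + 2))"
    by (rule bigo_nat_bound[OF prep_steps_bound])
  moreover have "(\<lambda>n. real (prep_cells l n)) \<in> O(\<lambda>n. real n ^ (l + 1))"
    by (rule bigo_nat_bound[OF prep_cells_bound])
  moreover have "(\<lambda>n. real (gen_steps l n)) \<in> O(\<lambda>n. real n ^ 1)"
  proof (rule bigo_nat_bound[of _ "32 * l + 54"])
    fix n :: nat assume "1 \<le> n"
    hence "5 * l + 22 \<le> (5 * l + 22) * n" by simp
    thus "gen_steps l n \<le> (32 * l + 54) * n ^ 1" by (simp add: gen_steps_def algebra_simps)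
  qed
  moreover have "halts_within (prep_steps l n) (exec (word_length l n) 0 (prep_cells l n) (prep_com l) (initial_state n)) \<and>
      (\<forall>p\<in>set_spmf (exec (word_length l n) 0 (prep_cells l n) (prep_com l) (initial_state n)). \<forall>s\<in>ready (prep_cells l n) (mem p).
         halts_within (gen_steps l n) (exec (word_length l n) (prep_cells l n) (prep_cells l n + 0) (gen_com l) s) \<and>
         set_spmf (output_arcs (exec (word_length l n) (prep_cells l n) (prep_cells l n + 0) (gen_com l) s)) \<subseteq> rna_structures k n \<and>
         (\<forall>M\<in>rna_structures k n. spmf (output_arcs (exec (word_length l n) (prep_cells l n) (prep_cells l n + 0) (gen_com l) s)) M =
            1 / real (num_rna_structures k n)))" for n
  proof -
    interpret rna_machine l n "word_length l n" by (rule rna_machine_word_length[OF l])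
    obtain p m q where p: "exec (word_length l n) 0 cells (prep_com l) (initial_state n) = return_spmf p"
      "table_ok m q (mem p)" "time p \<le> prep_steps l n" using prep_run by blast
    have "halts_within (gen_steps l n) (exec (word_length l n) cells cells (gen_com l) s) \<and>
         set_spmf (output_arcs (exec (word_length l n) cells cells (gen_com l) s)) \<subseteq> rna_structures k n \<and>
         (\<forall>M\<in>rna_structures k n. spmf (output_arcs (exec (word_length l n) cells cells (gen_com l) s)) M =
            1 / real (num_rna_structures k n))" if s: "s \<in> ready cells (mem p)" for s
    proof -
      have "table_ok m q (mem s)" by (rule table_ok_cong[OF p(2)]) (use s in \<open>auto simp: ready_def\<close>)
      note G = gen_output[OF this]
      have "printed s = []" "time s = 0" using s by (auto simp: ready_def)
      note G = G[OF this, folded k]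
      show ?thesis using G(1,3,4) unfolding G(2) by (auto simp: spmf_of_set num_rna_structures_def)
    qed
    thus ?thesis using p(3) unfolding p(1) by (auto simp: halts_within_def)
  qed
  ultimately show ?thesis
    unfolding Let_def
    by (intro exI[of _ "prep_com l"] exI[of _ "gen_com l"] exI[of _ "word_length l"] exI[of _ "prep_steps l"]
        exI[of _ "prep_cells l"] exI[of _ "gen_steps l"] exI[of _ "\<lambda>_. 0"]) (simp add: k)
qed

end
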